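(* Let $\Omega=[0,1)$ with Lebesgue measure $\mathbb P$ and let $p(\cdot):[0,1)\to(0,\infty)$ be measurable with $p_-=\operatorname{ess\,inf}p$, $p_+=\operatorname{ess\,sup}p$, $0<p_-\le p_+<\infty$. Assume that there is a constant $K\ge 1$ such that $\mathbb P(A)^{p_-(A)-p_+(A)}\le K$ for every dyadic interval $A\subset[0,1)$, and that $\frac1{p_-}-\frac1{p_+}<1$. If $1/2<p_-<\infty$ and $f\in H_{p(\cdot)}$, then $\sigma_nf$ converges in the $L_{p(\cdot)}$-norm as $n\to\infty$.
   Context: For measurable $A\subset[0,1)$, $p_-(A)=\operatorname{ess\,inf}_{x\in A}p(x)$ and $p_+(A)=\operatorname{ess\,sup}_{x\in A}p(x)$. $\|f\|_{p(\cdot)}=\inf\{\lambda>0:\int_0^1(|f(x)|/\lambda)^{p(x)}dx\le1\}$ (the quasi-norm called the $L_{p(\cdot)}$-norm). Dyadic intervals are $[k2^{-n},(k+1)2^{-n})$, $n\in\mathbb N=\{0,1,2,\dots\}$, $0\le k<2^n$; $\mathcal F_n$ is the $\sigma$-algebra generated by the dyadic intervals of length $2^{-n}$. Martingales $f=(f_n)_{n\ge0}$ are taken with respect to $(\mathcal F_n)$. $M(f)=\sup_{n\ge0}|f_n|$. $H_{p(\cdot)}$ is the space of martingales with $\|f\|_{H_{p(\cdot)}}=\|M(f)\|_{p(\cdot)}<\infty$ (the paper uses this notation for any of five martingale Hardy spaces, which coincide with equivalent quasi-norms in the dyadic setting; this is one of them). Walsh system: $r(x)=1$ on $[0,1/2)$,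 $r(x)=-1$ on $[1/2,1)$, extended with period 1; $r_n(x)=r(2^nx)$; for $n=\sum_{k\ge0}n_k2^k$ with $n_k\in\{0,1\}$, $w_n=\prod_{k\ge0}r_k^{n_k}$. For a martingale $f$, $\widehat f(n)=\lim_{k\to\infty}\mathbb E(f_kw_n)$ (the sequence is eventually constant). Partial sums: $s_nf=\sum_{k=0}^{n-1}\widehat f(k)w_k$. Fejér means: $\sigma_nf=\frac1n\sum_{k=1}^ns_kf$, $n\ge1$. *)

theory Defs
  imports "HOL-Probability.Probability"
begin

abbreviation unit_leb :: "real measure" where
  "unit_leb \<equiv> lebesgue_on {0..<1}"

text \<open>Counterpart of the library's \<^const>\<open>esssup\<close>, with the dual convention for
  non-measurable functions.\<close>

definition essinf :: "'a measure \<Rightarrow> ('a \<Rightarrow> ereal) \<Rightarrow> ereal" where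
  "essinf M f = (if f \<in> borel_measurable M then Liminf (ae_filter M) f else bot)"

definition p_minus :: "(real \<Rightarrow> real) \<Rightarrow> real set \<Rightarrow> ereal" where
  "p_minus p A = essinf (lebesgue_on A) (\<lambda>x. ereal (p x))"

definition p_plus :: "(real \<Rightarrow> real) \<Rightarrow> real set \<Rightarrow> ereal" where
  "p_plus p A = esssup (lebesgue_on A) (\<lambda>x. ereal (p x))"

text \<open>Powers with a positive real exponent on \<open>[0,\<infinity>]\<close>; only exponents \<open>a > 0\<close> are used,
  so \<open>\<infinity>\<close> is sent to \<open>\<infinity>\<close> and \<open>0\<close> to \<open>0\<close>.\<close>

definition ennpowr :: "ennreal \<Rightarrow> real \<Rightarrow> ennreal" where
  "ennpowr x a = (if x = \<infinity> then \<infinity> else ennreal (enn2real x powr a))"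

text \<open>The quasi-norm takes \<open>[0,\<infinity>]\<close>-valued arguments because maximal functions may be infinite;
  for a real function \<open>f\<close> it is applied to \<open>|f|\<close>. Its value is \<open>\<infinity>\<close> if no \<open>l\<close> is admissible.\<close>

definition lp_norm :: "(real \<Rightarrow> real) \<Rightarrow> (real \<Rightarrow> ennreal) \<Rightarrow> ennreal" where
  "lp_norm p F = Inf {ennreal l | l. l > 0 \<and>
     (\<integral>\<^sup>+ x. ennpowr (F x / ennreal l) (p x) \<partial>unit_leb) \<le> 1}"

definition lp_space :: "(real \<Rightarrow> real) \<Rightarrow> (real \<Rightarrow> real) set" where
  "lp_space p = {f \<in> borel_measurable unit_leb. lp_norm p (\<lambda>x. ennreal \<bar>f x\<bar>) < \<infinity>}"

definition lp_convergent :: "(real \<Rightarrow> real) \<Rightarrow> (nat \<Rightarrow> real \<Rightarrow> real) \<Rightarrow> bool" where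
  "lp_convergent p u \<longleftrightarrow>
     (\<exists>g\<in>lp_space p. (\<lambda>n. lp_norm p (\<lambda>x. ennreal \<bar>u n x - g x\<bar>)) \<longlonglongrightarrow> 0)"

definition dyadic_interval :: "nat \<Rightarrow> nat \<Rightarrow> real set" where
  "dyadic_interval n k = {real k / 2 ^ n ..< (real k + 1) / 2 ^ n}"

definition dyadic_filtration :: "nat \<Rightarrow> real measure" where
  "dyadic_filtration n = sigma {0..<1} {dyadic_interval n k | k. k < 2 ^ n}"

definition dyadic_martingale :: "(nat \<Rightarrow> real \<Rightarrow> real) \<Rightarrow> bool" where
  "dyadic_martingale f \<longleftrightarrow>
     (\<forall>n. f n \<in> borel_measurable (dyadic_filtration n) \<and> integrable unit_leb (f n)) \<and>
     (\<forall>m n. n \<le> m \<longrightarrow>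
        (AE x in unit_leb. real_cond_exp unit_leb (dyadic_filtration n) (f m) x = f n x))"

definition maximal_function :: "(nat \<Rightarrow> real \<Rightarrow> real) \<Rightarrow> real \<Rightarrow> ennreal" where
  "maximal_function f x = (SUP n. ennreal \<bar>f n x\<bar>)"

definition hardy_space :: "(real \<Rightarrow> real) \<Rightarrow> (nat \<Rightarrow> real \<Rightarrow> real) set" where
  "hardy_space p = {f. dyadic_martingale f \<and> lp_norm p (maximal_function f) < \<infinity>}"

definition rademacher :: "nat \<Rightarrow> real \<Rightarrow> real" where
  "rademacher n x = (if frac (2 ^ n * x) < 1 / 2 then 1 else - 1)"

text \<open>\<open>n div 2 ^ k mod 2\<close> is the \<open>k\<close>-th binary digit of \<open>n\<close>; it vanishes for \<open>k > n\<close>.\<close>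

definition walsh :: "nat \<Rightarrow> real \<Rightarrow> real" where
  "walsh n x = (\<Prod>k\<le>n. rademacher k x ^ (n div 2 ^ k mod 2))"

definition walsh_coeff :: "(nat \<Rightarrow> real \<Rightarrow> real) \<Rightarrow> nat \<Rightarrow> real" where
  "walsh_coeff f n = lim (\<lambda>k. \<integral>x. f k x * walsh n x \<partial>unit_leb)"

definition walsh_partial_sum :: "(nat \<Rightarrow> real \<Rightarrow> real) \<Rightarrow> nat \<Rightarrow> real \<Rightarrow> real" where
  "walsh_partial_sum f n x = (\<Sum>k<n. walsh_coeff f k * walsh k x)"

definition fejer_mean :: "(nat \<Rightarrow> real \<Rightarrow> real) \<Rightarrow> nat \<Rightarrow> real \<Rightarrow> real" where
  "fejer_mean f n x = (\<Sum>k=1..n. walsh_partial_sum f k x) / real n"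

end

theory Submission
  imports Defs
begin

text \<open>
  The Fejer means of a dyadic martingale \<open>f\<close> are integral operators applied to its values: if
  \<open>n \<le> 2 ^ N \<le> 2 * n\<close>, then \<open>\<sigma>\<^sub>n f\<close> only depends on the function \<open>h = f\<^sub>N\<close>, which is constant on
  the dyadic intervals of length \<open>2\<^sup>-\<^sup>N\<close>. The proof rests on a bound for \<open>\<sigma>\<^sub>n h\<close> that is uniform in
  \<open>n\<close>; neither a maximal operator nor an atomic decomposition is needed.

  \<^emph>\<open>Kernel.\<close> Write \<open>J\<^sub>i\<^sub>j(x)\<close> for the dyadic interval of length \<open>2\<^sup>-\<^sup>i\<close> whose points have the same first
  \<open>i\<close> Rademacher signs as \<open>x\<close>, except that the sign number \<open>j\<close> is reversed (when \<open>j < i\<close>). The Fejer kernel is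
  bounded by a multiple of the sum over \<open>j \<le> i \<le> N\<close> of \<open>2 ^ (i + j - N)\<close> times the indicator of
  \<open>J\<^sub>i\<^sub>j(x)\<close> (lemmas \<open>fejer_sign_bound\<close> and \<open>fejer_op_bound\<close>). Hence \<open>\<bar>\<sigma>\<^sub>n h(x)\<bar>\<close> is at most four times
  the sum of the terms \<open>2 ^ (j - N)\<close> times the mean of \<open>\<bar>h\<bar>\<close> over \<open>J\<^sub>i\<^sub>j(x)\<close>.

  \<^emph>\<open>Modular bound.\<close> Assume that \<open>\<bar>h\<bar>\<^sup>p\<close> has integral at most 1, and let \<open>B\<close> be 1 plus the mean of
  \<open>\<bar>h\<bar>\<^sup>p\<close> over \<open>J\<^sub>i\<^sub>j(x)\<close>. Let \<open>q\<close> be the essential infimum of \<open>p\<close> on the dyadic interval of length \<open>2\<^sup>-\<^sup>j\<close> around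
  \<open>x\<close>, which contains \<open>J\<^sub>i\<^sub>j(x)\<close>. As \<open>h\<close> is constant on intervals of length \<open>2\<^sup>-\<^sup>N\<close>, its mean over
  \<open>J\<^sub>i\<^sub>j(x)\<close> is controlled by \<open>B powr (1 / q)\<close> with a loss of \<open>2 powr ((N - i) * (1 / q - 1))\<close> if
  \<open>q < 1\<close> (lemma \<open>cylinder_mean_bound\<close>); since \<open>p\<^sub>- > 1/2\<close>, the factor \<open>2 ^ (j - N)\<close> beats this loss.
  Raising to the power \<open>p x\<close>, one pays \<open>B powr (p x / q - 1)\<close>, where \<open>B \<le> 2 ^ (i + 1)\<close>. The part
  \<open>2 ^ j\<close> of this factor is harmless by the log-Hoelder condition, and the part \<open>2 ^ (i - j)\<close> is
  absorbed because \<open>1/p\<^sub>- - 1/p\<^sub>+ < 1\<close> (lemma \<open>exponent_bookkeeping\<close>). What remains is \<open>B\<close> times a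
  geometrically small factor in \<open>N - j\<close>, and \<open>B\<close> has integral at most 2 as a function of \<open>x\<close>, by
  Tonelli. Summation gives \<open>fejer_op_modular_bounded\<close>.

  \<^emph>\<open>Density.\<close> A dyadic martingale with almost everywhere finite maximal function has a limit \<open>g\<close> along
  subsequences: stopped predictably at a high level, it is bounded and converges in the mean, and the set where
  the stopping matters has at most twice the measure of the set where the maximal function is large
  (lemma \<open>martingale_limit\<close>). Domination by the maximal function gives \<open>f\<^sub>N \<longlonglongrightarrow> g\<close> in the modular.
  The theorem follows from
  \<open>\<sigma>\<^sub>n f - g = \<sigma>\<^sub>n (f\<^sub>N - f\<^sub>M) + (\<sigma>\<^sub>n f\<^sub>M - f\<^sub>M) + (f\<^sub>M - g)\<close>, where the middle term tends to 0
  uniformly for fixed \<open>M\<close>, because \<open>f\<^sub>M\<close> is a Walsh polynomial.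
\<close>

section \<open>Walsh kernels on sign sequences\<close>

text \<open>The Walsh function number \<open>n\<close> as a function of a sequence \<open>e\<close> of signs; for \<open>e\<close> the Rademacher
  signs of a point it is \<open>walsh n\<close>. Since \<open>w\<^sub>n(x) w\<^sub>n(t)\<close> is \<open>walsh_sign\<close> of the products of the signs of
  \<open>x\<close> and \<open>t\<close>, dyadic addition of points is never needed.\<close>

definition walsh_sign :: "(nat \<Rightarrow> real) \<Rightarrow> nat \<Rightarrow> real" where
  "walsh_sign e n = (\<Prod>k\<le>n. e k ^ (n div 2 ^ k mod 2))"

text \<open>The Dirichlet kernel as a function of a sign sequence.\<close>

definition dirichlet_sign :: "(nat \<Rightarrow> real) \<Rightarrow> nat \<Rightarrow> real" where
  "dirichlet_sign e n = (\<Sum>l<n. walsh_sign e l)"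

text \<open>The Fejer kernel as a function of a sign sequence, without the normalising factor \<open>1 / n\<close>.\<close>

definition fejer_sign :: "(nat \<Rightarrow> real) \<Rightarrow> nat \<Rightarrow> real" where
  "fejer_sign e n = (\<Sum>k=1..n. dirichlet_sign e k)"

lemma walsh_sign_upto:
  assumes "n < 2 ^ L"
  shows "walsh_sign e n = (\<Prod>k<L. e k ^ (n div 2 ^ k mod 2))"
proof -
  have *: "(\<Prod>k<M. e k ^ (n div 2 ^ k mod 2)) = (\<Prod>k<L'. e k ^ (n div 2 ^ k mod 2))"
    if "n < 2 ^ M" "M \<le> L'" for M L'
  proof (rule prod.mono_neutral_left)
    show "\<forall>k\<in>{..<L'} - {..<M}. e k ^ (n div 2 ^ k mod 2) = 1"
    proof
      fix k assume "k \<in> {..<L'} - {..<M}"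
      then have "(2::nat) ^ M \<le> 2 ^ k" by (intro power_increasing) auto
      with that(1) have "n div 2 ^ k = 0" by (meson div_less less_le_trans)
      then show "e k ^ (n div 2 ^ k mod 2) = 1" by simp
    qed
  qed (use that in auto)
  have "n < 2 ^ Suc n" by (metis less_exp power_Suc lessI less_trans)
  then show ?thesis
    using *[of "Suc n" "max L (Suc n)"] *[OF assms, of "max L (Suc n)"]
    by (simp add: walsh_sign_def lessThan_Suc_atMost)
qed

lemma walsh_sign_0 [simp]: "walsh_sign e 0 = 1"
  by (simp add: walsh_sign_def)

text \<open>Splitting off the lowest binary digit of the index shifts the sign sequence. This gives
  recursions by bits for all three kernels.\<close>

lemma walsh_sign_double:
  assumes "b < 2"
  shows "walsh_sign e (2 * n + b) = e 0 ^ b * walsh_sign (\<lambda>k. e (Suc k)) n"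
proof -
  have "2 * n + b < 2 ^ Suc n" using assms less_exp[of n] unfolding power_Suc by linarith
  then have "walsh_sign e (2 * n + b) = (\<Prod>k<Suc n. e k ^ ((2 * n + b) div 2 ^ k mod 2))"
    by (rule walsh_sign_upto)
  also have "\<dots> = e 0 ^ b * (\<Prod>k<n. e (Suc k) ^ (n div 2 ^ k mod 2))"
    using assms by (simp add: prod.lessThan_Suc_shift div_mult2_eq del: prod.lessThan_Suc)
  also have "\<dots> = e 0 ^ b * walsh_sign (\<lambda>k. e (Suc k)) n"
    by (subst walsh_sign_upto[of n n]) (auto simp: less_exp)
  finally show ?thesis .
qed

lemma walsh_sign_even: "walsh_sign e (2 * n) = walsh_sign (\<lambda>k. e (Suc k)) n"
  using walsh_sign_double[of 0 e n] by simp

lemma walsh_sign_odd: "walsh_sign e (Suc (2 * n)) = e 0 * walsh_sign (\<lambda>k. e (Suc k)) n"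
  using walsh_sign_double[of 1 e n] by simp

lemma dirichlet_sign_0 [simp]: "dirichlet_sign e 0 = 0"
  and dirichlet_sign_Suc: "dirichlet_sign e (Suc n) = dirichlet_sign e n + walsh_sign e n"
  by (simp_all add: dirichlet_sign_def)

lemma fejer_sign_0 [simp]: "fejer_sign e 0 = 0"
  and fejer_sign_Suc: "fejer_sign e (Suc n) = fejer_sign e n + dirichlet_sign e (Suc n)"
  by (simp_all add: fejer_sign_def)

lemma dirichlet_sign_even:
  "dirichlet_sign e (2 * n) = (1 + e 0) * dirichlet_sign (\<lambda>k. e (Suc k)) n"
proof (induction n)
  case (Suc n)
  have "2 * Suc n = Suc (Suc (2 * n))" by simp
  with Suc show ?case
    by (simp only: dirichlet_sign_Suc walsh_sign_even walsh_sign_odd) (simp add: ring_distribs)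
qed simp

lemma fejer_sign_even:
  "fejer_sign e (2 * n) = (1 + e 0) * (2 * fejer_sign (\<lambda>k. e (Suc k)) n
     - dirichlet_sign (\<lambda>k. e (Suc k)) n) + dirichlet_sign (\<lambda>k. e (Suc k)) n"
proof (induction n)
  case (Suc n)
  have "2 * Suc n = Suc (Suc (2 * n))" by simp
  with Suc show ?case
    by (simp only: fejer_sign_Suc dirichlet_sign_Suc dirichlet_sign_even walsh_sign_even
        walsh_sign_odd) (simp add: ring_distribs)
qed simp

lemma nat_even_odd_cases:
  obtains m where "n = 2 * m" | m where "n = Suc (2 * m)"
  by (metis oddE evenE Suc_eq_plus1)

lemma dirichlet_sign_bound:
  assumes "\<And>k. e k \<in> {-1, 1}" "\<And>k. k < j \<Longrightarrow> e k = 1" "e j = -1"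
  shows "\<bar>dirichlet_sign e n\<bar> \<le> 2 ^ j"
  using assms
proof (induction j arbitrary: e n)
  case 0
  let ?e = "\<lambda>k. e (Suc k)"
  have "\<bar>walsh_sign ?e m\<bar> = 1" for m
    using 0(1) by (auto simp: walsh_sign_def abs_prod power_abs intro!: prod.neutral)
      (metis abs_1 abs_minus power_one insertE singletonD)
  then show ?case
    using 0 by (cases n rule: nat_even_odd_cases)
      (simp_all add: dirichlet_sign_even dirichlet_sign_Suc walsh_sign_even)
next
  case (Suc j)
  let ?e = "\<lambda>k. e (Suc k)"
  have IH: "\<bar>dirichlet_sign ?e m\<bar> \<le> 2 ^ j" for m
    using Suc.prems by (intro Suc.IH) auto
  have e0: "e 0 = 1" using Suc.prems by auto
  show ?case
  proof (cases n rule: nat_even_odd_cases)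
    case (1 m)
    then show ?thesis using e0 IH[of m] by (simp add: dirichlet_sign_even abs_mult)
  next
    case (2 m)
    then have "dirichlet_sign e n = dirichlet_sign ?e m + dirichlet_sign ?e (Suc m)"
      using e0 by (simp add: dirichlet_sign_even dirichlet_sign_Suc walsh_sign_even)
    then show ?thesis using IH[of m] IH[of "Suc m"] by simp
  qed
qed

text \<open>Here \<open>j\<close> and \<open>i\<close> are the first two positions of a sign \<open>-1\<close>. The subtracted \<open>2 ^ j\<close> makes
  the induction on \<open>j\<close> close.\<close>

lemma fejer_sign_bound_aux:
  assumes "\<And>k. e k \<in> {-1, 1}" "\<And>k. k < i \<Longrightarrow> k \<noteq> j \<Longrightarrow> e k = 1" "e j = -1" "e i = -1" "j < i"
  shows "\<bar>fejer_sign e n\<bar> \<le> 2 ^ (i + j) - 2 ^ j"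
  using assms
proof (induction j arbitrary: e i n)
  case 0
  let ?e = "\<lambda>k. e (Suc k)"
  obtain i' where i: "i = Suc i'" using 0 by (cases i) auto
  have D: "\<bar>dirichlet_sign ?e m\<bar> \<le> 2 ^ i'" for m
    using 0 i by (intro dirichlet_sign_bound) auto
  have "\<exists>m. fejer_sign e n = dirichlet_sign ?e m"
    using 0 by (cases n rule: nat_even_odd_cases; intro exI[of _ "Suc n div 2"])
      (auto simp: fejer_sign_even dirichlet_sign_even fejer_sign_Suc dirichlet_sign_Suc
        walsh_sign_even)
  moreover have "(2::real) ^ i' \<le> 2 ^ (i + 0) - 2 ^ 0"
    using one_le_power[of "2::real" i'] i by simp
  ultimately show ?case using D by (metis order_trans)
next
  case (Suc j)
  let ?e = "\<lambda>k. e (Suc k)"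
  obtain i' where i: "i = Suc i'" using Suc by (cases i) auto
  have e0: "e 0 = 1" using Suc.prems by auto
  have IH: "\<bar>fejer_sign ?e m\<bar> \<le> 2 ^ (i' + j) - 2 ^ j" for m
    using Suc.prems i by (intro Suc.IH) auto
  have D: "\<bar>dirichlet_sign ?e m\<bar> \<le> 2 ^ j" for m
    using Suc.prems i by (intro dirichlet_sign_bound) auto
  have "\<exists>m l s. fejer_sign e n = 4 * fejer_sign ?e m + s * dirichlet_sign ?e l \<and> \<bar>s\<bar> = 1"
  proof (cases n rule: nat_even_odd_cases)
    case (1 m)
    then have "fejer_sign e n = 4 * fejer_sign ?e m + (-1) * dirichlet_sign ?e m"
      using e0 by (simp add: fejer_sign_even)
    then show ?thesis by (metis abs_1 abs_minus)
  next
    case (2 m)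
    then have "fejer_sign e n = 4 * fejer_sign ?e m + 1 * dirichlet_sign ?e (Suc m)"
      using e0 by (simp add: fejer_sign_even fejer_sign_Suc dirichlet_sign_Suc
          dirichlet_sign_even walsh_sign_even)
    then show ?thesis by (metis abs_1)
  qed
  then obtain m l s where eq: "fejer_sign e n = 4 * fejer_sign ?e m + s * dirichlet_sign ?e l"
    and s: "\<bar>s\<bar> = 1" by blast
  have "\<bar>fejer_sign e n\<bar> \<le> 4 * \<bar>fejer_sign ?e m\<bar> + \<bar>s\<bar> * \<bar>dirichlet_sign ?e l\<bar>"
    unfolding eq abs_mult[symmetric] by linarith
  also have "\<dots> \<le> 4 * (2 ^ (i' + j) - 2 ^ j) + 2 ^ j"
    using IH[of m] D[of l] s by simp
  also have "\<dots> \<le> 2 ^ (i + Suc j) - 2 ^ Suc j" using i by simp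
  finally show ?case .
qed

text \<open>The kernel estimate. The summand \<open>(i, j)\<close> is the indicator of the sign sequences whose first \<open>i\<close>
  entries are \<open>1\<close>, apart from a \<open>-1\<close> at position \<open>j\<close> if \<open>j < i\<close>.\<close>

lemma fejer_sign_bound:
  assumes e: "\<And>k. e k \<in> {-1, 1}" and n: "n \<le> 2 ^ N"
  shows "\<bar>fejer_sign e n\<bar> \<le> 2 * (\<Sum>i\<le>N. \<Sum>j\<le>i. 2 ^ (i + j) *
           of_bool (\<forall>k<i. e k = (if k = j then -1 else 1)))"
    (is "_ \<le> 2 * ?S")
proof -
  \<comment> \<open>Only the first \<open>N\<close> signs matter for \<open>n \<le> 2 ^ N\<close>, so two later ones may be assumed to be \<open>-1\<close>.\<close>
  define d where "d k = (if k < N then e k else -1)" for k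
  have d: "d k \<in> {-1, 1}" for k using e by (auto simp: d_def)
  have W: "walsh_sign e l = walsh_sign d l" if "l < 2 ^ N" for l
    unfolding walsh_sign_upto[OF that] by (rule prod.cong) (auto simp: d_def)
  have D: "dirichlet_sign e k = dirichlet_sign d k" if "k \<le> 2 ^ N" for k
    unfolding dirichlet_sign_def by (rule sum.cong) (use that in \<open>auto intro!: W\<close>)
  have F: "fejer_sign e n = fejer_sign d n"
    unfolding fejer_sign_def by (rule sum.cong) (use n in \<open>auto intro!: D\<close>)
  define j where "j = (LEAST k. d k = -1)"
  have dN: "d N = -1" "d (Suc N) = -1" by (auto simp: d_def)
  have j: "d j = -1" "j \<le> N" "\<And>k. k < j \<Longrightarrow> d k = 1"
    unfolding j_def using dN(1) d
    by (auto intro: LeastI Least_le dest: not_less_Least)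
  define i where "i = (LEAST k. j < k \<and> d k = -1)"
  have ex: "j < Suc N \<and> d (Suc N) = -1" using j dN by auto
  have i: "j < i" "d i = -1" "i \<le> Suc N" "\<And>k. j < k \<Longrightarrow> k < i \<Longrightarrow> d k = 1"
    unfolding i_def using LeastI[of "\<lambda>k. j < k \<and> d k = -1", OF ex]
      Least_le[of "\<lambda>k. j < k \<and> d k = -1", OF ex] d
    by (auto dest: not_less_Least)
  have one: "d k = 1" if "k < i" "k \<noteq> j" for k using that j i by (metis linorder_neqE_nat)
  have "\<bar>fejer_sign d n\<bar> \<le> 2 ^ (i + j) - 2 ^ j"
    by (rule fejer_sign_bound_aux) (use d one i j in auto)
  then have *: "\<bar>fejer_sign e n\<bar> \<le> 2 ^ (i + j)" using F
    by (smt (verit) zero_le_power)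
  define i' where "i' = min i N"
  have i': "i' \<le> N" "j \<le> i'" "i \<le> Suc i'" using i j by (auto simp: i'_def)
  have ok: "\<forall>k<i'. e k = (if k = j then -1 else 1)"
  proof safe
    fix k assume "k < i'"
    then have k: "k < N" "k < i" by (auto simp: i'_def)
    show "e k = (if k = j then -1 else 1)"
      using one[OF k(2)] j(1) k(1) by (auto simp: d_def)
  qed
  have le1: "2 ^ (i' + j) * of_bool (\<forall>k<i'. e k = (if k = j then -1 else (1::real)))
      \<le> (\<Sum>j\<le>i'. 2 ^ (i' + j) * of_bool (\<forall>k<i'. e k = (if k = j then -1 else (1::real))) :: real)"
    by (rule member_le_sum[where f="\<lambda>j. 2 ^ (i' + j) * of_bool (\<forall>k<i'. e k = (if k = j then -1 else (1::real)))"]) (use i' in auto)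
  also have "\<dots> \<le> ?S"
    by (rule member_le_sum[where f="\<lambda>i. \<Sum>j\<le>i. 2 ^ (i + j) *
           of_bool (\<forall>k<i. e k = (if k = j then -1 else 1))"]) (use i' in \<open>auto intro!: sum_nonneg\<close>)
  finally have "2 ^ (i' + j) \<le> ?S" using ok by simp
  moreover have "(2::real) ^ (i + j) \<le> 2 ^ Suc (i' + j)"
    using i' by (intro power_increasing) auto
  ultimately show ?thesis using * by simp
qed

section \<open>Dyadic cylinders and step functions\<close>

lemma rademacher_cases: "rademacher n x = 1 \<or> rademacher n x = -1"
  by (simp add: rademacher_def)

lemma borel_measurable_unit_leb:
  "f \<in> borel_measurable borel \<Longrightarrow> f \<in> borel_measurable unit_leb"
  by (intro measurable_restrict_space1 measurable_completion) simp

lemma rademacher_measurable [measurable]: "rademacher n \<in> borel_measurable unit_leb"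
  by (rule borel_measurable_unit_leb) (unfold rademacher_def frac_def, measurable)

lemma prob_space_unit_leb: "prob_space unit_leb"
  by (rule prob_spaceI) (simp add: emeasure_restrict_space space_restrict_space)

interpretation unit: prob_space unit_leb
  by (rule prob_space_unit_leb)

lemma space_unit_leb [simp]: "space unit_leb = {0..<1}"
  by (simp add: space_restrict_space)

lemma floor_power_Suc:
  "\<lfloor>2 ^ Suc n * x\<rfloor> = 2 * \<lfloor>2 ^ n * x\<rfloor> + of_bool (rademacher n x = -1)" for x :: real
proof -
  let ?y = "2 ^ n * x"
  have "\<lfloor>2 * ?y\<rfloor> = 2 * \<lfloor>?y\<rfloor> + of_bool (\<not> frac ?y < 1 / 2)"
    unfolding floor_eq_iff frac_def by auto linarith+
  then show ?thesis by (simp add: rademacher_def mult.assoc)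
qed

text \<open>The first \<open>n\<close> Rademacher signs of a point determine the dyadic interval of length \<open>2\<^sup>-\<^sup>n\<close>
  that contains it, and conversely.\<close>

lemma same_signs_iff_floor:
  assumes "x \<in> {0..<1}" "t \<in> {0..<1}"
  shows "(\<forall>k<n. rademacher k t = rademacher k x) \<longleftrightarrow> \<lfloor>2 ^ n * t\<rfloor> = \<lfloor>2 ^ n * x\<rfloor>"
proof (induction n)
  case 0
  then show ?case using assms by (simp add: floor_unique[of 0])
next
  case (Suc n)
  have "(rademacher n t = rademacher n x) \<longleftrightarrow>
      (of_bool (rademacher n t = -1) :: int) = of_bool (rademacher n x = -1)"
    using rademacher_cases[of n x] rademacher_cases[of n t] by auto
  with Suc show ?case
    unfolding floor_power_Suc All_less_Suc by (auto simp: of_bool_def; presburger)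
qed

lemma dyadic_interval_iff_floor: "t \<in> dyadic_interval n k \<longleftrightarrow> \<lfloor>2 ^ n * t\<rfloor> = int k"
  unfolding dyadic_interval_def floor_eq_iff by (auto simp: field_simps)

lemma exists_signs:
  assumes "\<And>k. s k = 1 \<or> s k = (-1 :: real)"
  shows "\<exists>y\<in>{0..<1}. \<forall>k<n. rademacher k y = s k"
proof (induction n)
  case 0
  show ?case by (intro bexI[of _ 0]) auto
next
  case (Suc n)
  then obtain y where y: "y \<in> {0..<1}" "\<forall>k<n. rademacher k y = s k" by blast
  define c where "c = \<lfloor>2 ^ n * y\<rfloor>"
  define h :: real where "h = (if s n = 1 then 0 else 1 / 2)"
  define z where "z = (of_int c + h) / 2 ^ n"
  have h: "0 \<le> h" "h < 1" by (auto simp: h_def)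
  have c: "0 \<le> c" "c < 2 ^ n"
    using y(1) by (auto simp: c_def floor_less_iff mult_less_cancel_left1)
  have "of_int c + 1 \<le> (2 ^ n :: real)"
  proof -
    have "of_int (c + 1) \<le> (of_int (2 ^ n) :: real)" using c by (subst of_int_le_iff) simp
    then show ?thesis by simp
  qed
  then have z: "z \<in> {0..<1}" using c h by (auto simp: z_def field_simps)
  have z': "2 ^ n * z = of_int c + h" by (simp add: z_def)
  have "\<lfloor>2 ^ n * z\<rfloor> = c" using h unfolding z' by (simp add: floor_eq_iff)
  then have "\<forall>k<n. rademacher k z = rademacher k y"
    using same_signs_iff_floor[OF y(1) z] by (simp add: c_def)
  moreover have "rademacher n z = s n"
  proof -
    have "frac (2 ^ n * z) = h" unfolding z' using h by (simp add: frac_def floor_eq_iff floor_unique)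
    then show ?thesis using assms[of n] by (auto simp: rademacher_def h_def)
  qed
  ultimately show ?case using y(2) z by (auto simp: less_Suc_eq)
qed

text \<open>The points of \<open>[0,1)\<close> with prescribed first \<open>n\<close> Rademacher signs; for \<open>s\<close> with values in
  \<open>{-1, 1}\<close> these are the dyadic intervals of length \<open>2\<^sup>-\<^sup>n\<close>.\<close>

definition cylinder :: "nat \<Rightarrow> (nat \<Rightarrow> real) \<Rightarrow> real set" where
  "cylinder n s = {t \<in> {0..<1}. \<forall>k<n. rademacher k t = s k}"

lemma dyadic_index:
  assumes "x \<in> {0..<1}"
  obtains k where "k < 2 ^ n" "x \<in> dyadic_interval n k"
proof
  have "0 \<le> \<lfloor>2 ^ n * x\<rfloor>" "\<lfloor>2 ^ n * x\<rfloor> < 2 ^ n"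
    using assms by (auto simp: floor_less_iff mult_less_cancel_left1)
  then show "nat \<lfloor>2 ^ n * x\<rfloor> < 2 ^ n" "x \<in> dyadic_interval n (nat \<lfloor>2 ^ n * x\<rfloor>)"
    by (auto simp: dyadic_interval_iff_floor nat_less_iff)
qed

lemma dyadic_interval_subset: "k < 2 ^ n \<Longrightarrow> dyadic_interval n k \<subseteq> {0..<1}"
proof -
  assume "k < 2 ^ n"
  then have "real k + 1 \<le> 2 ^ n"
    by (metis Suc_leI of_nat_Suc of_nat_le_iff of_nat_power of_nat_numeral add.commute)
  then show ?thesis by (auto simp: dyadic_interval_def field_simps)
qed

lemma cylinder_eq_dyadic_interval:
  assumes "\<And>k. s k = 1 \<or> s k = -1"
  obtains k where "k < 2 ^ n" "cylinder n s = dyadic_interval n k"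
proof -
  obtain y where y: "y \<in> {0..<1}" "\<forall>k<n. rademacher k y = s k"
    using exists_signs[of s n] assms by blast
  obtain k where k: "k < 2 ^ n" "y \<in> dyadic_interval n k"
    using dyadic_index[OF y(1)] by blast
  have "cylinder n s = {t \<in> {0..<1}. \<lfloor>2 ^ n * t\<rfloor> = \<lfloor>2 ^ n * y\<rfloor>}"
    using y same_signs_iff_floor[OF y(1), of _ n] by (auto simp: cylinder_def)
  also have "\<dots> = dyadic_interval n k"
    using k dyadic_interval_subset[OF k(1)] by (auto simp: dyadic_interval_iff_floor)
  finally show ?thesis using that k by blast
qed

lemma dyadic_interval_sets [measurable]: "k < 2 ^ n \<Longrightarrow> dyadic_interval n k \<in> sets unit_leb"
  using dyadic_interval_subset[of k n]
  by (auto simp: sets_restrict_space_iff dyadic_interval_def)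

lemma measure_dyadic_interval:
  assumes "k < 2 ^ n"
  shows "measure unit_leb (dyadic_interval n k) = 1 / 2 ^ n"
proof -
  have "measure unit_leb (dyadic_interval n k) = measure lebesgue (dyadic_interval n k)"
    by (rule measure_restrict_space) (use dyadic_interval_subset[OF assms] in auto)
  also have "\<dots> = 1 / 2 ^ n"
    by (simp add: dyadic_interval_def divide_right_mono add_divide_distrib)
  finally show ?thesis .
qed

lemma cylinder_sets [measurable]: "cylinder n s \<in> sets unit_leb"
proof -
  have "{t \<in> space unit_leb. \<forall>k<n. rademacher k t = s k} \<in> sets unit_leb" by measurable
  then show ?thesis by (simp add: cylinder_def)
qed

lemma measure_cylinder:
  assumes "\<And>k. s k = 1 \<or> s k = -1"
  shows "measure unit_leb (cylinder n s) = 1 / 2 ^ n"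
  using cylinder_eq_dyadic_interval[of s n, OF assms] measure_dyadic_interval by metis

text \<open>The dyadic interval of length \<open>2\<^sup>-\<^sup>n\<close> that contains \<open>x\<close>.\<close>

abbreviation dyadic_cell :: "nat \<Rightarrow> real \<Rightarrow> real set" where
  "dyadic_cell n x \<equiv> cylinder n (\<lambda>k. rademacher k x)"

lemma measure_dyadic_cell: "measure unit_leb (dyadic_cell n x) = 1 / 2 ^ n"
  by (rule measure_cylinder) (rule rademacher_cases)

text \<open>Functions that are constant on the dyadic intervals of length \<open>2\<^sup>-\<^sup>n\<close> in \<open>[0,1)\<close>; nothing is
  required outside \<open>[0,1)\<close>. For real functions this is measurability with respect to
  \<open>dyadic_filtration n\<close>.\<close>

definition dyadic_step :: "nat \<Rightarrow> (real \<Rightarrow> 'a) \<Rightarrow> bool" where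
  "dyadic_step n h \<longleftrightarrow> (\<forall>x\<in>{0..<1}. \<forall>t\<in>dyadic_cell n x. h t = h x)"

lemma dyadic_stepD: "dyadic_step n h \<Longrightarrow> x \<in> {0..<1} \<Longrightarrow> t \<in> dyadic_cell n x \<Longrightarrow> h t = h x"
  by (auto simp: dyadic_step_def)

lemma cylinder_antimono: "m \<le> n \<Longrightarrow> cylinder n s \<subseteq> cylinder m s"
  by (auto simp: cylinder_def)

lemma dyadic_step_mono: "dyadic_step m h \<Longrightarrow> m \<le> n \<Longrightarrow> dyadic_step n h"
  unfolding dyadic_step_def using cylinder_antimono by blast

lemma dyadic_step_comp2:
  "dyadic_step n f \<Longrightarrow> dyadic_step n g \<Longrightarrow> dyadic_step n (\<lambda>x. F (f x) (g x))"
  by (auto simp: dyadic_step_def)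

lemma dyadic_step_comp: "dyadic_step n f \<Longrightarrow> dyadic_step n (\<lambda>x. F (f x))"
  by (auto simp: dyadic_step_def)

lemma dyadic_step_prod:
  "(\<And>i. i \<in> I \<Longrightarrow> dyadic_step n (f i)) \<Longrightarrow> dyadic_step n (\<lambda>x. \<Prod>i\<in>I. f i x)"
  unfolding dyadic_step_def by (intro ballI prod.cong) auto

lemma dyadic_step_rademacher: "k < n \<Longrightarrow> dyadic_step n (rademacher k)"
  by (auto simp: dyadic_step_def cylinder_def)

lemma walsh_eq: "walsh n x = walsh_sign (\<lambda>k. rademacher k x) n"
  by (simp add: walsh_def walsh_sign_def)

lemma dyadic_step_walsh: "l < 2 ^ n \<Longrightarrow> dyadic_step n (walsh l)"
  unfolding walsh_eq[abs_def]
  by (subst walsh_sign_upto, assumption)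
    (intro dyadic_step_prod dyadic_step_comp[where F = "\<lambda>x. x ^ _"] dyadic_step_rademacher, simp)

lemma dyadic_step_interval:
  assumes "dyadic_step n h" "k < 2 ^ n" "x \<in> dyadic_interval n k"
  shows "h x = h (real k / 2 ^ n)"
proof -
  have "real k / 2 ^ n \<in> dyadic_interval n k"
    by (auto simp: dyadic_interval_def divide_strict_right_mono)
  moreover note dyadic_interval_subset[OF assms(2)]
  ultimately have "x \<in> dyadic_cell n (real k / 2 ^ n)" "real k / 2 ^ n \<in> {0..<1}"
    using assms same_signs_iff_floor[of "real k / 2 ^ n" x n]
    unfolding dyadic_interval_iff_floor cylinder_def
    by (auto simp: dyadic_interval_iff_floor subset_iff)
  then show ?thesis using dyadic_stepD[OF assms(1)] by blast
qed

lemma dyadic_step_expansion: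
  fixes h :: "real \<Rightarrow> real"
  assumes "dyadic_step n h" "x \<in> {0..<1}"
  shows "h x = (\<Sum>k<2 ^ n. h (real k / 2 ^ n) * indicator (dyadic_interval n k) x)"
proof -
  obtain k where k: "k < 2 ^ n" "x \<in> dyadic_interval n k" using dyadic_index[OF assms(2)] by blast
  have "(\<Sum>k<2 ^ n. h (real k / 2 ^ n) * indicator (dyadic_interval n k) x)
      = (\<Sum>l\<in>{k}. h (real l / 2 ^ n) * indicator (dyadic_interval n l) x)"
    using k by (intro sum.mono_neutral_right)
      (auto simp: dyadic_interval_iff_floor indicator_def)
  with k dyadic_step_interval[OF assms(1) k] show ?thesis by simp
qed

lemma dyadic_step_measurable_filtration:
  fixes h :: "real \<Rightarrow> real"
  assumes "dyadic_step n h"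
  shows "h \<in> borel_measurable (dyadic_filtration n)"
proof -
  have sub: "{dyadic_interval n k |k. k < 2 ^ n} \<subseteq> Pow {0..<1}"
    using dyadic_interval_subset by auto
  have sp: "space (dyadic_filtration n) = {0..<1}"
    unfolding dyadic_filtration_def using sub by (rule space_measure_of)
  have [measurable]: "dyadic_interval n k \<in> sets (dyadic_filtration n)" if "k < 2 ^ n" for k
    unfolding dyadic_filtration_def using that sub by auto
  have "(\<lambda>x. \<Sum>k<2 ^ n. h (real k / 2 ^ n) * indicator (dyadic_interval n k) x)
      \<in> borel_measurable (dyadic_filtration n)"
    by (intro borel_measurable_sum borel_measurable_times borel_measurable_const
        borel_measurable_indicator) auto
  then show ?thesis
    by (subst measurable_cong[OF dyadic_step_expansion[OF assms]]) (auto simp: sp)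
qed

lemma space_dyadic_filtration [simp]: "space (dyadic_filtration n) = {0..<1}"
  unfolding dyadic_filtration_def using dyadic_interval_subset by (intro space_measure_of) auto

lemma subalgebra_dyadic_filtration: "subalgebra unit_leb (dyadic_filtration n)"
  unfolding subalgebra_def
proof
  show "sets (dyadic_filtration n) \<subseteq> sets unit_leb"
    unfolding dyadic_filtration_def
  proof (subst sets_measure_of)
    show "{dyadic_interval n k |k. k < 2 ^ n} \<subseteq> Pow {0..<1}"
      using dyadic_interval_subset by auto
    have "{dyadic_interval n k |k. k < 2 ^ n} \<subseteq> sets unit_leb"
      using dyadic_interval_sets by auto
    from sets.sigma_sets_subset[OF this]
    show "sigma_sets {0..<1} {dyadic_interval n k |k. k < 2 ^ n} \<subseteq> sets unit_leb" by simp
  qed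
qed simp

lemma dyadic_step_measurable [measurable_dest]:
  fixes h :: "real \<Rightarrow> real"
  shows "dyadic_step n h \<Longrightarrow> h \<in> borel_measurable unit_leb"
  using dyadic_step_measurable_filtration measurable_from_subalg[OF subalgebra_dyadic_filtration]
  by blast

lemma dyadic_stepI_measurable:
  fixes h :: "real \<Rightarrow> real"
  assumes "h \<in> borel_measurable (dyadic_filtration n)"
  shows "dyadic_step n h"
  unfolding dyadic_step_def
proof (intro ballI)
  fix x t :: real assume x: "x \<in> {0..<1}" and t: "t \<in> dyadic_cell n x"
  have atom: "t \<in> A \<longleftrightarrow> x \<in> A"
    if "A \<in> sigma_sets {0..<1} {dyadic_interval n k |k. k < 2 ^ n}" for A
    using that
  proof induction
    case (Basic A)
    then show ?case using t same_signs_iff_floor[OF x, of t n]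
      by (auto simp: cylinder_def dyadic_interval_iff_floor)
  qed (use x t in \<open>auto simp: cylinder_def\<close>)
  have "h -` {h x} \<inter> space (dyadic_filtration n) \<in> sets (dyadic_filtration n)"
    using assms by (rule measurable_sets) simp
  also have "sets (dyadic_filtration n) = sigma_sets {0..<1} {dyadic_interval n k |k. k < 2 ^ n}"
    unfolding dyadic_filtration_def using dyadic_interval_subset by (intro sets_measure_of) auto
  finally have "t \<in> h -` {h x} \<inter> space (dyadic_filtration n)"
    by (rule atom[THEN iffD2]) (use x in simp)
  then show "h t = h x" by simp
qed

lemma dyadic_step_bounded:
  fixes h :: "real \<Rightarrow> real"
  assumes "dyadic_step n h"
  obtains B where "0 \<le> B" "\<And>x. x \<in> {0..<1} \<Longrightarrow> \<bar>h x\<bar> \<le> B"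
proof (rule that)
  show "0 \<le> (\<Sum>k<2 ^ n. \<bar>h (real k / 2 ^ n)\<bar>)" by (intro sum_nonneg) auto
  fix x :: real assume x: "x \<in> {0..<1}"
  obtain k where k: "k < 2 ^ n" "x \<in> dyadic_interval n k" using dyadic_index[OF x] by blast
  have "\<bar>h x\<bar> = \<bar>h (real k / 2 ^ n)\<bar>" using dyadic_step_interval[OF assms k] by simp
  also have "\<dots> \<le> (\<Sum>k<2 ^ n. \<bar>h (real k / 2 ^ n)\<bar>)"
    by (rule member_le_sum) (use k in auto)
  finally show "\<bar>h x\<bar> \<le> (\<Sum>k<2 ^ n. \<bar>h (real k / 2 ^ n)\<bar>)" .
qed

lemma dyadic_step_integrable:
  fixes h :: "real \<Rightarrow> real"
  assumes "dyadic_step n h"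
  shows "integrable unit_leb h"
proof -
  obtain B where "0 \<le> B" "\<And>x. x \<in> {0..<1} \<Longrightarrow> \<bar>h x\<bar> \<le> B"
    using dyadic_step_bounded[OF assms] by metis
  with assms show ?thesis
    by (intro unit.integrable_const_bound[of _ B] AE_I2) auto
qed

lemma integral_step_rademacher:
  fixes u :: "real \<Rightarrow> real"
  assumes "dyadic_step m u"
  shows "(\<integral>x. u x * rademacher m x \<partial>unit_leb) = 0"
proof -
  have split: "indicator (dyadic_interval m k) x * rademacher m x
      = indicator (dyadic_interval (Suc m) (2 * k)) x
        - indicator (dyadic_interval (Suc m) (Suc (2 * k))) x" for k x
  proof -
    have "(2 * z = int (2 * k)) = (z = int k)" "(2 * z + 1 = int (2 * k)) = False"
      "(2 * z = int (Suc (2 * k))) = False" "(2 * z + 1 = int (Suc (2 * k))) = (z = int k)"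
      for z :: int
      by presburger+
    then show ?thesis
      unfolding indicator_def dyadic_interval_iff_floor floor_power_Suc
      using rademacher_cases[of m x] by (elim disjE) (simp_all only: of_bool_def, simp_all)
  qed
  have "(\<integral>x. u x * rademacher m x \<partial>unit_leb)
      = (\<integral>x. (\<Sum>k<2 ^ m. u (real k / 2 ^ m) *
          (indicator (dyadic_interval (Suc m) (2 * k)) x
          - indicator (dyadic_interval (Suc m) (Suc (2 * k))) x)) \<partial>unit_leb)"
  proof (intro Bochner_Integration.integral_cong refl)
    fix x assume "x \<in> space unit_leb"
    then show "u x * rademacher m x = (\<Sum>k<2 ^ m. u (real k / 2 ^ m) *
          (indicator (dyadic_interval (Suc m) (2 * k)) x
          - indicator (dyadic_interval (Suc m) (Suc (2 * k))) x))"
      by (subst dyadic_step_expansion[OF assms]) (simp_all only: sum_distrib_right mult.assoc split space_unit_leb)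
  qed
  also have "\<dots> = (\<Sum>k<2 ^ m. \<integral>x. u (real k / 2 ^ m) *
          (indicator (dyadic_interval (Suc m) (2 * k)) x
          - indicator (dyadic_interval (Suc m) (Suc (2 * k))) x) \<partial>unit_leb)"
    by (intro Bochner_Integration.integral_sum integrable_mult_right
        Bochner_Integration.integrable_diff integrable_real_indicator dyadic_interval_sets)
      (auto simp: unit.emeasure_eq_measure)
  also have "\<dots> = (\<Sum>k<(2::nat) ^ m. 0)"
  proof (intro sum.cong refl)
    fix k :: nat assume "k \<in> {..<2 ^ m}"
    then have k: "2 * k < 2 ^ Suc m" "Suc (2 * k) < 2 ^ Suc m" by auto
    have int: "integrable unit_leb (indicator (dyadic_interval (Suc m) l) :: real \<Rightarrow> real)"
      if "l < 2 ^ Suc m" for l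
      using that by (intro integrable_real_indicator dyadic_interval_sets)
        (auto simp: unit.emeasure_eq_measure)
    have val: "(\<integral>x. indicator (dyadic_interval (Suc m) l) x \<partial>unit_leb) = (1 / 2 ^ Suc m :: real)"
      if "l < 2 ^ Suc m" for l
      using measure_dyadic_interval[OF that] dyadic_interval_subset[OF that]
      by (simp add: Int_absorb2)
    show "(\<integral>x. u (real k / 2 ^ m) * (indicator (dyadic_interval (Suc m) (2 * k)) x
        - indicator (dyadic_interval (Suc m) (Suc (2 * k))) x) \<partial>unit_leb) = 0"
      using int[OF k(1)] int[OF k(2)] val[OF k(1)] val[OF k(2)] by simp
  qed
  finally show ?thesis by simp
qed

text \<open>The highest binary digit of \<open>l\<close> contributes a Rademacher factor that is independent of
  everything else.\<close>

lemma integral_step_walsh_high: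
  fixes u :: "real \<Rightarrow> real"
  assumes "dyadic_step n u" "2 ^ n \<le> l"
  shows "(\<integral>x. u x * walsh l x \<partial>unit_leb) = 0"
proof -
  have l0: "0 < l" using assms(2) by (metis gr0I not_less zero_less_numeral zero_less_power)
  define m where "m = floor_log l"
  have m: "2 ^ m \<le> l" "l < 2 ^ Suc m"
    using l0 floor_log_exp2_le[of l] floor_log_exp2_gt[of l] by (auto simp: m_def)
  have "n \<le> m"
  proof (rule ccontr)
    assume "\<not> n \<le> m"
    then have "(2::nat) ^ Suc m \<le> 2 ^ n" by (intro power_increasing) auto
    with assms(2) m(2) show False by linarith
  qed
  have "l div 2 ^ m = 1" using m by (intro div_nat_eqI) simp_all
  then have w: "walsh l x = (\<Prod>k<m. rademacher k x ^ (l div 2 ^ k mod 2)) * rademacher m x" for x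
    unfolding walsh_eq walsh_sign_upto[OF m(2)] by simp
  have "dyadic_step m (\<lambda>x. u x * (\<Prod>k<m. rademacher k x ^ (l div 2 ^ k mod 2)))"
    using dyadic_step_mono[OF assms(1) \<open>n \<le> m\<close>]
    by (intro dyadic_step_comp2[where F = "(*)"] dyadic_step_prod
        dyadic_step_comp[where F = "\<lambda>x. x ^ _"] dyadic_step_rademacher) simp_all
  from integral_step_rademacher[OF this] show ?thesis by (simp add: w mult.assoc)
qed

lemma dirichlet_sign_power2:
  assumes "\<And>k. e k = 1 \<or> e k = -1"
  shows "dirichlet_sign e (2 ^ n) = 2 ^ n * of_bool (\<forall>k<n. e k = 1)"
  using assms
proof (induction n arbitrary: e)
  case 0
  show ?case by (simp add: dirichlet_sign_def)
next
  case (Suc n)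
  have "dirichlet_sign (\<lambda>k. e (Suc k)) (2 ^ n) = 2 ^ n * of_bool (\<forall>k<n. e (Suc k) = 1)"
    by (rule Suc.IH) (rule Suc.prems)
  then show ?case
    using Suc.prems[of 0] unfolding power_Suc dirichlet_sign_even All_less_Suc2
    by (elim disjE) simp_all
qed

lemma walsh_sign_mult: "walsh_sign (\<lambda>k. d k * e k) n = walsh_sign d n * walsh_sign e n"
  by (simp add: walsh_sign_def power_mult_distrib prod.distrib)

section \<open>Martingales and Fejer means\<close>

lemma martingale_step:
  "dyadic_martingale f \<Longrightarrow> dyadic_step n (f n)"
  unfolding dyadic_martingale_def by (blast intro: dyadic_stepI_measurable)

lemma dyadic_step_mult_integrable:
  fixes u v :: "real \<Rightarrow> real"
  assumes "dyadic_step n u" "dyadic_step m v"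
  shows "integrable unit_leb (\<lambda>x. u x * v x)"
  using assms
  by (intro dyadic_step_integrable[of "max n m"] dyadic_step_comp2[where F = "(*)"])
    (auto elim: dyadic_step_mono)

lemma martingale_integral:
  assumes f: "dyadic_martingale f" and u: "dyadic_step n u" and "n \<le> m"
  shows "(\<integral>x. u x * f m x \<partial>unit_leb) = (\<integral>x. u x * f n x \<partial>unit_leb)"
proof -
  interpret finite_measure_subalgebra unit_leb "dyadic_filtration n"
    by unfold_locales (rule subalgebra_dyadic_filtration)
  let ?c = "real_cond_exp unit_leb (dyadic_filtration n) (f m)"
  have "(\<integral>x. u x * f m x \<partial>unit_leb) = (\<integral>x. u x * ?c x \<partial>unit_leb)"
    using u martingale_step[OF f, of m]
    by (intro real_cond_exp_intg(2)[symmetric] dyadic_step_mult_integrable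
        dyadic_step_measurable_filtration dyadic_step_measurable)
  also have "\<dots> = (\<integral>x. u x * f n x \<partial>unit_leb)"
  proof (rule integral_cong_AE)
    have "AE x in unit_leb. ?c x = f n x"
      using f \<open>n \<le> m\<close> by (auto simp: dyadic_martingale_def)
    then show "AE x in unit_leb. u x * ?c x = u x * f n x" by eventually_elim simp
    have [measurable]: "u \<in> borel_measurable unit_leb" "f n \<in> borel_measurable unit_leb"
      using u martingale_step[OF f, of n] by (auto intro: dyadic_step_measurable)
    have [measurable]: "?c \<in> borel_measurable unit_leb"
      by (rule borel_measurable_cond_exp2)
    show "(\<lambda>x. u x * ?c x) \<in> borel_measurable unit_leb" by measurable
    show "(\<lambda>x. u x * f n x) \<in> borel_measurable unit_leb" by measurable
  qed
  finally show ?thesis .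
qed

text \<open>The integrals defining the Walsh coefficient number \<open>l\<close> are constant from the index \<open>N\<close> on.\<close>

lemma walsh_coeff_eq:
  assumes f: "dyadic_martingale f" and "l < 2 ^ N"
  shows "walsh_coeff f l = (\<integral>x. f N x * walsh l x \<partial>unit_leb)"
  unfolding walsh_coeff_def
proof (rule limI, rule tendsto_eventually)
  show "\<forall>\<^sub>F m in sequentially. (\<integral>x. f m x * walsh l x \<partial>unit_leb) = (\<integral>x. f N x * walsh l x \<partial>unit_leb)"
    using eventually_ge_at_top[of N]
  proof eventually_elim
    case (elim m)
    from martingale_integral[OF f dyadic_step_walsh[OF assms(2)] this] show ?case
      by (simp add: mult.commute)
  qed
qed

text \<open>The Fejer mean of a function on \<open>[0,1)\<close>, written with the kernel.\<close>

definition fejer_op :: "nat \<Rightarrow> (real \<Rightarrow> real) \<Rightarrow> real \<Rightarrow> real" where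
  "fejer_op n h x =
     (\<integral>t. h t * fejer_sign (\<lambda>k. rademacher k x * rademacher k t) n \<partial>unit_leb) / real n"

lemma fejer_kernel_expand:
  "fejer_sign (\<lambda>k. rademacher k x * rademacher k t) n
     = (\<Sum>k=1..n. \<Sum>l<k. walsh l x * walsh l t)"
  by (simp add: fejer_sign_def dirichlet_sign_def walsh_sign_mult walsh_eq)

lemma step_walsh_integrable:
  "dyadic_step N h \<Longrightarrow> integrable unit_leb (\<lambda>t. h t * walsh l t)"
  by (rule dyadic_step_mult_integrable[OF _ dyadic_step_walsh]) (auto intro: less_exp)

lemma fejer_kernel_integrable:
  assumes "dyadic_step N h"
  shows "integrable unit_leb (\<lambda>t. h t * fejer_sign (\<lambda>k. rademacher k x * rademacher k t) n)"
  unfolding fejer_kernel_expand sum_distrib_left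
  using step_walsh_integrable[OF assms]
  by (intro Bochner_Integration.integrable_sum)
    (simp add: mult.left_commute[of _ "walsh _ x"])

lemma fejer_op_walsh:
  assumes "dyadic_step N h"
  shows "fejer_op n h x = (\<Sum>k=1..n. \<Sum>l<k. (\<integral>t. h t * walsh l t \<partial>unit_leb) * walsh l x) / real n"
proof -
  have "(\<integral>t. h t * fejer_sign (\<lambda>k. rademacher k x * rademacher k t) n \<partial>unit_leb)
      = (\<integral>t. (\<Sum>k=1..n. \<Sum>l<k. walsh l x * (h t * walsh l t)) \<partial>unit_leb)"
    unfolding fejer_kernel_expand sum_distrib_left by (simp add: mult.left_commute)
  also have "\<dots> = (\<Sum>k=1..n. \<Sum>l<k. walsh l x * (\<integral>t. h t * walsh l t \<partial>unit_leb))"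
    using step_walsh_integrable[OF assms]
    by (simp add: Bochner_Integration.integral_sum Bochner_Integration.integrable_sum)
  finally show ?thesis by (simp add: fejer_op_def mult.commute)
qed

lemma fejer_mean_eq_op:
  assumes f: "dyadic_martingale f" and "n \<le> 2 ^ N"
  shows "fejer_mean f n x = fejer_op n (f N) x"
  unfolding fejer_op_walsh[OF martingale_step[OF f]] fejer_mean_def walsh_partial_sum_def
  using assms(2)
  by (intro arg_cong2[where f = "(/)"] sum.cong refl arg_cong2[where f = "(*)"] walsh_coeff_eq[OF f]) auto

lemma fejer_op_diff:
  assumes "dyadic_step N g" "dyadic_step N h"
  shows "fejer_op n (\<lambda>t. g t - h t) x = fejer_op n g x - fejer_op n h x"
  using fejer_kernel_integrable[OF assms(1)] fejer_kernel_integrable[OF assms(2)]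
  by (simp add: fejer_op_def left_diff_distrib diff_divide_distrib)

lemma fejer_op_scale: "fejer_op n (\<lambda>t. c * h t) x = c * fejer_op n h x"
  by (simp add: fejer_op_def mult.assoc)

text \<open>The dyadic interval of length \<open>2\<^sup>-\<^sup>i\<close> obtained from the one around \<open>x\<close> by reversing the sign
  number \<open>j\<close>. For \<open>i \<le> j\<close> no sign is reversed and it is the dyadic interval around \<open>x\<close>.\<close>

definition flip_cell :: "nat \<Rightarrow> nat \<Rightarrow> real \<Rightarrow> real set" where
  "flip_cell i j x = cylinder i (\<lambda>k. if k = j then - rademacher k x else rademacher k x)"

lemma flip_cell_sets [measurable]: "flip_cell i j x \<in> sets unit_leb"
  by (simp add: flip_cell_def)

lemma in_flip_cell_iff:
  assumes "t \<in> {0..<1}"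
  shows "t \<in> flip_cell i j x \<longleftrightarrow>
    (\<forall>k<i. rademacher k x * rademacher k t = (if k = j then -1 else 1))"
proof -
  have "(rademacher k t = (if k = j then - rademacher k x else rademacher k x)) \<longleftrightarrow>
      (rademacher k x * rademacher k t = (if k = j then -1 else 1))" for k
    using rademacher_cases[of k x] rademacher_cases[of k t] by auto
  with assms show ?thesis by (simp add: flip_cell_def cylinder_def)
qed

lemma dyadic_step_indicator_integrable:
  fixes h :: "real \<Rightarrow> real"
  assumes "dyadic_step N h" "A \<in> sets unit_leb"
  shows "integrable unit_leb (\<lambda>t. indicator A t * h t)"
  using integrable_mult_indicator[OF assms(2) dyadic_step_integrable[OF assms(1)]] by simp

lemma fejer_op_bound:
  assumes h: "dyadic_step N h" and n: "n \<le> 2 ^ N" "2 ^ N \<le> 2 * n"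
  shows "\<bar>fejer_op n h x\<bar> \<le> (\<Sum>i\<le>N. \<Sum>j\<le>i. 4 * (2 ^ j / 2 ^ N *
           (2 ^ i * (\<integral>t. indicator (flip_cell i j x) t * \<bar>h t\<bar> \<partial>unit_leb))))"
proof -
  have habs: "dyadic_step N (\<lambda>t. \<bar>h t\<bar>)" by (rule dyadic_step_comp[OF h])
  have n0: "0 < real n" using n(2) by (metis gr0I mult_0_right not_less of_nat_0_less_iff zero_less_numeral zero_less_power)
  have "2 / real n \<le> 4 / 2 ^ N"
  proof -
    have "real (2 ^ N) \<le> real (2 * n)" using n(2) by (simp only: of_nat_le_iff)
    then show ?thesis using n0 by (simp add: field_simps)
  qed
  let ?S = "\<Sum>i\<le>N. \<Sum>j\<le>i. 2 ^ (i + j) * (\<integral>t. indicator (flip_cell i j x) t * \<bar>h t\<bar> \<partial>unit_leb)"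
  have S0: "0 \<le> ?S" by (intro sum_nonneg mult_nonneg_nonneg) simp_all
  have "\<bar>\<integral>t. h t * fejer_sign (\<lambda>k. rademacher k x * rademacher k t) n \<partial>unit_leb\<bar>
      \<le> (\<integral>t. 2 * (\<Sum>i\<le>N. \<Sum>j\<le>i. 2 ^ (i + j) * (indicator (flip_cell i j x) t * \<bar>h t\<bar>)) \<partial>unit_leb)"
  proof (rule order_trans[OF integral_abs_bound], rule integral_mono)
    show "integrable unit_leb (\<lambda>t. \<bar>h t * fejer_sign (\<lambda>k. rademacher k x * rademacher k t) n\<bar>)"
      by (intro integrable_abs fejer_kernel_integrable[OF h])
    show "integrable unit_leb (\<lambda>t. 2 * (\<Sum>i\<le>N. \<Sum>j\<le>i. 2 ^ (i + j) * (indicator (flip_cell i j x) t * \<bar>h t\<bar>)))"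
      by (intro integrable_mult_right Bochner_Integration.integrable_sum
          dyadic_step_indicator_integrable[OF habs] flip_cell_sets)
    fix t assume "t \<in> space unit_leb"
    then have t: "t \<in> {0..<1}" by simp
    have "\<bar>fejer_sign (\<lambda>k. rademacher k x * rademacher k t) n\<bar>
        \<le> 2 * (\<Sum>i\<le>N. \<Sum>j\<le>i. 2 ^ (i + j) * indicator (flip_cell i j x) t)"
    proof -
      have "rademacher k x * rademacher k t \<in> {-1, 1}" for k
        using rademacher_cases[of k x] rademacher_cases[of k t] by auto
      from fejer_sign_bound[OF this n(1)] show ?thesis
        by (simp add: indicator_def in_flip_cell_iff[OF t] of_bool_def)
    qed
    then have "\<bar>h t\<bar> * \<bar>fejer_sign (\<lambda>k. rademacher k x * rademacher k t) n\<bar>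
        \<le> \<bar>h t\<bar> * (2 * (\<Sum>i\<le>N. \<Sum>j\<le>i. 2 ^ (i + j) * indicator (flip_cell i j x) t))"
      by (intro mult_left_mono) auto
    then show "\<bar>h t * fejer_sign (\<lambda>k. rademacher k x * rademacher k t) n\<bar>
        \<le> 2 * (\<Sum>i\<le>N. \<Sum>j\<le>i. 2 ^ (i + j) * (indicator (flip_cell i j x) t * \<bar>h t\<bar>))"
      unfolding abs_mult sum_distrib_left by (simp only: mult_ac)
  qed
  also have "\<dots> = 2 * ?S"
    using dyadic_step_indicator_integrable[OF habs flip_cell_sets]
    by (simp add: Bochner_Integration.integral_sum Bochner_Integration.integrable_sum)
  finally have "\<bar>fejer_op n h x\<bar> \<le> (2 * ?S) / real n"
    using n0 by (simp add: fejer_op_def abs_divide divide_right_mono)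
  also have "\<dots> = (2 / real n) * ?S" by simp
  also have "\<dots> \<le> (4 / 2 ^ N) * ?S"
    by (rule mult_right_mono) (use \<open>2 / real n \<le> 4 / 2 ^ N\<close> S0 in auto)
  also have "\<dots> = (\<Sum>i\<le>N. \<Sum>j\<le>i. 4 * (2 ^ j / 2 ^ N *
           (2 ^ i * (\<integral>t. indicator (flip_cell i j x) t * \<bar>h t\<bar> \<partial>unit_leb))))"
    by (simp add: sum_distrib_left power_add mult_ac)
  finally show ?thesis .
qed

lemma dyadic_cell_self: "x \<in> {0..<1} \<Longrightarrow> x \<in> dyadic_cell n x"
  by (simp add: cylinder_def)

lemma integral_indicator_cell:
  fixes h :: "real \<Rightarrow> real"
  assumes "dyadic_step n h" "x \<in> {0..<1}"
  shows "(\<integral>t. indicator (dyadic_cell n x) t * h t \<partial>unit_leb) = h x / 2 ^ n"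
proof -
  have "(\<integral>t. indicator (dyadic_cell n x) t * h t \<partial>unit_leb)
      = (\<integral>t. h x * indicator (dyadic_cell n x) t \<partial>unit_leb)"
    by (rule Bochner_Integration.integral_cong)
      (use dyadic_stepD[OF assms] in \<open>auto simp: indicator_def\<close>)
  also have "\<dots> = h x * measure unit_leb (dyadic_cell n x \<inter> {0..<1})"
    by (simp add: unit.emeasure_eq_measure)
  also have "dyadic_cell n x \<inter> {0..<1} = dyadic_cell n x" by (auto simp: cylinder_def)
  finally show ?thesis by (simp add: measure_dyadic_cell)
qed

lemma walsh_expansion:
  assumes h: "dyadic_step M h" and x: "x \<in> {0..<1}" and k: "2 ^ M \<le> k"
  shows "(\<Sum>l<k. (\<integral>t. h t * walsh l t \<partial>unit_leb) * walsh l x) = h x"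
proof -
  have "(\<Sum>l<k. (\<integral>t. h t * walsh l t \<partial>unit_leb) * walsh l x)
      = (\<Sum>l<2 ^ M. (\<integral>t. h t * walsh l t \<partial>unit_leb) * walsh l x)"
    by (rule sum.mono_neutral_right) (use k integral_step_walsh_high[OF h] in auto)
  also have "\<dots> = (\<integral>t. (\<Sum>l<2 ^ M. walsh l x * (h t * walsh l t)) \<partial>unit_leb)"
    using step_walsh_integrable[OF h]
    by (simp add: Bochner_Integration.integral_sum mult.commute)
  also have "\<dots> = (\<integral>t. 2 ^ M * (indicator (dyadic_cell M x) t * h t) \<partial>unit_leb)"
  proof (rule Bochner_Integration.integral_cong)
    fix t assume "t \<in> space unit_leb"
    then have t: "t \<in> {0..<1}" by simp
    have e: "rademacher k x * rademacher k t = 1 \<or> rademacher k x * rademacher k t = -1" for k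
      using rademacher_cases[of k x] rademacher_cases[of k t] by auto
    have iff: "rademacher k x * rademacher k t = 1 \<longleftrightarrow> rademacher k t = rademacher k x" for k
      using rademacher_cases[of k x] rademacher_cases[of k t] by auto
    have "(\<Sum>l<2 ^ M. walsh l x * (h t * walsh l t))
        = h t * dirichlet_sign (\<lambda>k. rademacher k x * rademacher k t) (2 ^ M)"
      by (simp add: dirichlet_sign_def walsh_sign_mult walsh_eq sum_distrib_left mult_ac)
    also have "\<dots> = 2 ^ M * (indicator (dyadic_cell M x) t * h t)"
      using t by (simp add: dirichlet_sign_power2[of _ M, OF e] iff indicator_def cylinder_def)
    finally show "(\<Sum>l<2 ^ M. walsh l x * (h t * walsh l t))
        = 2 ^ M * (indicator (dyadic_cell M x) t * h t)" .
  qed simp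
  also have "\<dots> = h x"
    using integral_indicator_cell[OF h x] by simp
  finally show ?thesis .
qed

text \<open>A step function is a Walsh polynomial, so its Fejer means converge uniformly, with rate
  \<open>1 / n\<close>.\<close>

lemma fejer_op_converges:
  assumes h: "dyadic_step M h"
  obtains C where "0 \<le> C" "\<And>n x. 0 < n \<Longrightarrow> x \<in> {0..<1} \<Longrightarrow> \<bar>fejer_op n h x - h x\<bar> \<le> C / real n"
proof -
  define c where "c l = (\<integral>t. h t * walsh l t \<partial>unit_leb)" for l
  obtain B where B: "0 \<le> B" "\<And>x. x \<in> {0..<1} \<Longrightarrow> \<bar>h x\<bar> \<le> B" using dyadic_step_bounded[OF h] by metis
  define A where "A = (\<Sum>l<2 ^ M. \<bar>c l\<bar>) + B"
  have A0: "0 \<le> A" using B by (auto simp: A_def intro!: add_nonneg_nonneg sum_nonneg)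
  have walsh1: "\<bar>walsh l x\<bar> = 1" for l x
    unfolding walsh_def abs_prod by (rule prod.neutral) (use rademacher_cases in \<open>auto simp: power_abs, metis abs_1 abs_minus power_one\<close>)
  have "\<bar>fejer_op n h x - h x\<bar> \<le> (2 ^ M * A) / real n" if n: "0 < n" and x: "x \<in> {0..<1}" for n x
  proof -
    let ?d = "\<lambda>k. (\<Sum>l<k. c l * walsh l x) - h x"
    have d: "\<bar>?d k\<bar> \<le> (if k < 2 ^ M then A else 0)" for k
    proof (cases "k < 2 ^ M")
      case True
      have "\<bar>\<Sum>l<k. c l * walsh l x\<bar> \<le> (\<Sum>l<k. \<bar>c l * walsh l x\<bar>)" by (rule sum_abs)
      also have "\<dots> = (\<Sum>l<k. \<bar>c l\<bar>)" by (simp add: abs_mult walsh1)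
      also have "\<dots> \<le> (\<Sum>l<2 ^ M. \<bar>c l\<bar>)" by (rule sum_mono2) (use True in auto)
      finally show ?thesis using True B(2)[OF x] unfolding A_def by simp
    next
      case False
      then show ?thesis using walsh_expansion[OF h x, of k] by (simp add: c_def)
    qed
    have "fejer_op n h x - h x = (\<Sum>k=1..n. ?d k) / real n"
      using n by (simp add: fejer_op_walsh[OF h] c_def sum_subtractf diff_divide_distrib)
    also have "\<bar>\<dots>\<bar> \<le> (\<Sum>k=1..n. if k < 2 ^ M then A else 0) / real n"
      unfolding abs_divide using n by (intro divide_mono order_trans[OF sum_abs] sum_mono d) (auto intro!: sum_nonneg A0)
    also have "(\<Sum>k=1..n. if k < 2 ^ M then A else 0) \<le> (\<Sum>k\<in>{..<(2::nat) ^ M}. A)"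
      unfolding sum.inter_filter[symmetric, OF finite_atLeastAtMost]
      by (rule sum_mono2) (use A0 in auto)
    finally show ?thesis using n by (simp add: divide_right_mono)
  qed
  with A0 show ?thesis by (intro that[of "2 ^ M * A"]) auto
qed

lemma flip_cell_sym:
  assumes "x \<in> {0..<1}" "t \<in> {0..<1}"
  shows "t \<in> flip_cell i j x \<longleftrightarrow> x \<in> flip_cell i j t"
  unfolding in_flip_cell_iff[OF assms(1)] in_flip_cell_iff[OF assms(2)] by (simp add: mult.commute)

lemma measure_flip_cell: "measure unit_leb (flip_cell i j x) = 1 / 2 ^ i"
  unfolding flip_cell_def by (rule measure_cylinder) (use rademacher_cases[of _ x] in fastforce)

lemma flip_cell_kernel_measurable:
  fixes G :: "real \<Rightarrow> ennreal"
  assumes [measurable]: "G \<in> borel_measurable unit_leb"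
  shows "(\<lambda>(x, t). indicator (flip_cell i j x) t * G t) \<in> borel_measurable (unit_leb \<Otimes>\<^sub>M unit_leb)"
proof -
  \<comment> \<open>The relation is expressed through Rademacher signs, where joint measurability is evident.\<close>
  define R where "R = {z \<in> space (unit_leb \<Otimes>\<^sub>M unit_leb).
    \<forall>k<i. rademacher k (fst z) * rademacher k (snd z) = (if k = j then -1 else 1)}"
  have "R \<in> sets (unit_leb \<Otimes>\<^sub>M unit_leb)" unfolding R_def by measurable
  then have meas: "(\<lambda>z. indicator R z * G (snd z)) \<in> borel_measurable (unit_leb \<Otimes>\<^sub>M unit_leb)"
    by measurable
  have eq: "indicator R z * G (snd z) = (case z of (x, t) \<Rightarrow> indicator (flip_cell i j x) t * G t)"
    if "z \<in> space (unit_leb \<Otimes>\<^sub>M unit_leb)" for z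
  proof -
    obtain x t where z: "z = (x, t)" "x \<in> {0..<1}" "t \<in> {0..<1}"
      using \<open>z \<in> _\<close> by (cases z) (simp add: space_pair_measure)
    have "z \<in> R \<longleftrightarrow> t \<in> flip_cell i j x"
      using that by (simp add: R_def in_flip_cell_iff[OF z(3)] z(1))
    then show ?thesis by (simp add: z(1) indicator_def)
  qed
  show ?thesis by (rule measurable_cong[THEN iffD1, OF eq meas])
qed

lemma nn_integral_flip_cell_measurable:
  fixes G :: "real \<Rightarrow> ennreal"
  assumes "G \<in> borel_measurable unit_leb"
  shows "(\<lambda>x. \<integral>\<^sup>+t. indicator (flip_cell i j x) t * G t \<partial>unit_leb) \<in> borel_measurable unit_leb"
  using flip_cell_kernel_measurable[OF assms] by (rule unit.borel_measurable_nn_integral)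

text \<open>Averaging over a reflected dyadic interval and then integrating gives back the integral, because
  \<open>t \<in> flip_cell i j x\<close> is a symmetric relation.\<close>

lemma nn_integral_flip_cell:
  assumes G: "G \<in> borel_measurable unit_leb"
  shows "(\<integral>\<^sup>+x. (\<integral>\<^sup>+t. indicator (flip_cell i j x) t * G t \<partial>unit_leb) \<partial>unit_leb)
    = ennreal (1 / 2 ^ i) * (\<integral>\<^sup>+t. G t \<partial>unit_leb)"
proof -
  interpret pair_sigma_finite unit_leb unit_leb by unfold_locales
  have "(\<integral>\<^sup>+x. (\<integral>\<^sup>+t. indicator (flip_cell i j x) t * G t \<partial>unit_leb) \<partial>unit_leb)
      = (\<integral>\<^sup>+t. (\<integral>\<^sup>+x. indicator (flip_cell i j x) t * G t \<partial>unit_leb) \<partial>unit_leb)"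
    by (rule Fubini'[OF flip_cell_kernel_measurable[OF G], symmetric])
  also have "\<dots> = (\<integral>\<^sup>+t. ennreal (1 / 2 ^ i) * G t \<partial>unit_leb)"
  proof (rule nn_integral_cong)
    fix t assume "t \<in> space unit_leb"
    then have t: "t \<in> {0..<1}" by simp
    have "(\<integral>\<^sup>+x. indicator (flip_cell i j x) t * G t \<partial>unit_leb)
        = (\<integral>\<^sup>+x. G t * indicator (flip_cell i j t) x \<partial>unit_leb)"
    proof (rule nn_integral_cong)
      fix x assume "x \<in> space unit_leb"
      then have "t \<in> flip_cell i j x \<longleftrightarrow> x \<in> flip_cell i j t" using flip_cell_sym t by simp
      then show "indicator (flip_cell i j x) t * G t = G t * indicator (flip_cell i j t) x"
        by (simp add: indicator_def)
    qed
    also have "\<dots> = G t * emeasure unit_leb (flip_cell i j t)"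
      by (rule nn_integral_cmult_indicator) simp
    finally show "(\<integral>\<^sup>+x. indicator (flip_cell i j x) t * G t \<partial>unit_leb) = ennreal (1 / 2 ^ i) * G t"
      by (simp add: unit.emeasure_eq_measure measure_flip_cell mult.commute)
  qed
  also have "\<dots> = ennreal (1 / 2 ^ i) * (\<integral>\<^sup>+t. G t \<partial>unit_leb)"
    by (rule nn_integral_cmult) (rule G)
  finally show ?thesis .
qed

section \<open>The modular of a variable exponent\<close>

text \<open>The modular \<open>\<integral> \<bar>u\<bar>\<^sup>p\<close> of the variable exponent space, for real functions.\<close>

definition modular :: "(real \<Rightarrow> real) \<Rightarrow> (real \<Rightarrow> real) \<Rightarrow> ennreal" where
  "modular p u = (\<integral>\<^sup>+ x. ennreal (\<bar>u x\<bar> powr p x) \<partial>unit_leb)"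

text \<open>An exponent with essential bounds \<open>pm\<close> and \<open>pp\<close>, which need not be the optimal ones.\<close>

locale variable_exponent =
  fixes p :: "real \<Rightarrow> real" and pm pp :: real
  assumes p_measurable [measurable]: "p \<in> borel_measurable unit_leb"
    and pm_pos: "0 < pm"
    and pm_le_pp: "pm \<le> pp"
    and p_bounds: "AE x in unit_leb. pm \<le> p x \<and> p x \<le> pp"

text \<open>The log-Hoelder condition is used in the following form: on every dyadic interval of length
  \<open>2\<^sup>-\<^sup>j\<close>, some \<open>q\<close> (the essential infimum) lies below \<open>p\<close>, by so little that
  \<open>2 powr (j * (p t - q))\<close> stays bounded.\<close>

locale log_hoelder_exponent = variable_exponent +
  fixes K :: real
  assumes pm_half: "1 / 2 < pm"
    and K_ge_1: "1 \<le> K"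
    and gap: "1 / pm - 1 / pp < 1"
    and log_hoelder: "\<And>j k. k < 2 ^ j \<Longrightarrow> \<exists>q\<ge>pm. AE t in unit_leb.
      t \<in> dyadic_interval j k \<longrightarrow> q \<le> p t \<and> (2 ^ j) powr (p t - q) \<le> K"

lemma powr_le_one_plus:
  fixes y q r :: real
  assumes "0 \<le> y" "0 < q" "q \<le> r"
  shows "y powr q \<le> 1 + y powr r"
proof (cases "y \<le> 1")
  case True
  then have "y powr q \<le> 1" using assms by (intro powr_le1) auto
  then show ?thesis by (smt (verit) powr_ge_zero)
next
  case False
  then have "y powr q \<le> y powr r" using assms by (intro powr_mono) auto
  then show ?thesis by simp
qed

context variable_exponent
begin

lemma pp_pos: "0 < pp" using pm_pos pm_le_pp by simp

lemma step_powr_integrable: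
  assumes "dyadic_step N h"
  shows "integrable unit_leb (\<lambda>t. \<bar>h t\<bar> powr p t)"
proof -
  obtain B where B: "0 \<le> B" "\<And>x. x \<in> {0..<1} \<Longrightarrow> \<bar>h x\<bar> \<le> B" using dyadic_step_bounded[OF assms] by metis
  have [measurable]: "h \<in> borel_measurable unit_leb" by (rule dyadic_step_measurable[OF assms])
  have "AE x in unit_leb. norm (\<bar>h x\<bar> powr p x) \<le> max 1 B powr pp"
    using p_bounds AE_space
  proof eventually_elim
    case (elim x)
    have "\<bar>h x\<bar> powr p x \<le> max 1 B powr p x"
      using elim B(2)[of x] pm_pos by (intro powr_mono2) auto
    also have "\<dots> \<le> max 1 B powr pp" using elim by (intro powr_mono) auto
    finally show ?case by simp
  qed
  then show ?thesis by (rule unit.integrable_const_bound) measurable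
qed

lemma step_powr_indicator_integrable:
  assumes "dyadic_step N h" "A \<in> sets unit_leb"
  shows "integrable unit_leb (\<lambda>t. indicator A t * \<bar>h t\<bar> powr p t)"
  using integrable_mult_indicator[OF assms(2) step_powr_integrable[OF assms(1)]] by simp

lemma cylinder_powr_mean:
  assumes h: "dyadic_step N h" and i: "i \<le> N" and s: "\<And>k. s k = 1 \<or> s k = -1"
    and q: "0 < q" "AE t in unit_leb. t \<in> cylinder i s \<longrightarrow> q \<le> p t"
  shows "(\<integral>t. indicator (cylinder i s) t * \<bar>h t\<bar> powr q \<partial>unit_leb)
    \<le> (1 + 2 ^ i * (\<integral>t. indicator (cylinder i s) t * \<bar>h t\<bar> powr p t \<partial>unit_leb)) / 2 ^ i"
    (is "?L \<le> _")
proof -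
  let ?J = "cylinder i s"
  have intJ: "integrable unit_leb (indicator ?J :: real \<Rightarrow> real)"
    by (intro integrable_real_indicator) (auto simp: unit.emeasure_eq_measure)
  have int1: "integrable unit_leb (\<lambda>t. indicator ?J t * \<bar>h t\<bar> powr q)"
    by (intro dyadic_step_indicator_integrable[of N] dyadic_step_comp[OF h] cylinder_sets)
  have "?L \<le> (\<integral>t. indicator ?J t + indicator ?J t * \<bar>h t\<bar> powr p t \<partial>unit_leb)"
  proof (rule integral_mono_AE)
    show "integrable unit_leb (\<lambda>t. indicator ?J t * \<bar>h t\<bar> powr q)" by (rule int1)
    show "integrable unit_leb (\<lambda>t. indicator ?J t + indicator ?J t * \<bar>h t\<bar> powr p t)"
      by (intro Bochner_Integration.integrable_add intJ step_powr_indicator_integrable[OF h]) simp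
    show "AE t in unit_leb. indicator ?J t * \<bar>h t\<bar> powr q
        \<le> indicator ?J t + indicator ?J t * \<bar>h t\<bar> powr p t"
      using q(2) by eventually_elim (auto simp: indicator_def q(1) intro!: powr_le_one_plus)
  qed
  also have "\<dots> = measure unit_leb (?J \<inter> {0..<1})
      + (\<integral>t. indicator ?J t * \<bar>h t\<bar> powr p t \<partial>unit_leb)"
    using intJ step_powr_indicator_integrable[OF h cylinder_sets[of i s]] by simp
  also have "?J \<inter> {0..<1} = ?J" by (auto simp: cylinder_def)
  finally show ?thesis by (simp add: measure_cylinder[OF s] field_simps)
qed

text \<open>A substitute for Jensen's inequality. For \<open>q < 1\<close> it relies on \<open>h\<close> being constant on the intervals
  of length \<open>2\<^sup>-\<^sup>N\<close>, which bounds \<open>\<bar>h\<bar>\<close> pointwise by its means. The exponent \<open>1 - a\<close> is a common upper bound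
  for \<open>0\<close> and \<open>1 / q - 1\<close>.\<close>

lemma cylinder_mean_bound:
  assumes h: "dyadic_step N h" and i: "i \<le> N" and s: "\<And>k. s k = 1 \<or> s k = -1"
    and q: "pm \<le> q" "AE t in unit_leb. t \<in> cylinder i s \<longrightarrow> q \<le> p t"
    and a: "a \<le> 1" "a \<le> 2 - 1 / pm"
    and B: "B = 1 + 2 ^ i * (\<integral>t. indicator (cylinder i s) t * \<bar>h t\<bar> powr p t \<partial>unit_leb)"
  shows "2 ^ i * (\<integral>t. indicator (cylinder i s) t * \<bar>h t\<bar> \<partial>unit_leb)
    \<le> 2 * (2 powr ((real N - real i) * (1 - a)) * B powr (1 / q))"
proof -
  let ?J = "cylinder i s"
  have q0: "0 < q" using q(1) pm_pos by simp
  have intJ: "integrable unit_leb (indicator ?J :: real \<Rightarrow> real)"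
    by (intro integrable_real_indicator) (auto simp: unit.emeasure_eq_measure)
  have int1: "integrable unit_leb (\<lambda>t. indicator ?J t * \<bar>h t\<bar> powr q)"
    by (intro dyadic_step_indicator_integrable[of N] dyadic_step_comp[OF h] cylinder_sets)
  have int0: "integrable unit_leb (\<lambda>t. indicator ?J t * \<bar>h t\<bar>)"
    by (intro dyadic_step_indicator_integrable[of N] dyadic_step_comp[OF h] cylinder_sets)
  have mJ: "(\<integral>t. indicator ?J t \<partial>unit_leb) = 1 / (2 ^ i :: real)"
  proof -
    have "?J \<inter> {0..<1} = ?J" by (auto simp: cylinder_def)
    then show ?thesis by (simp add: measure_cylinder[OF s])
  qed
  have B1: "1 \<le> B"
    unfolding B by (auto intro!: mult_nonneg_nonneg Bochner_Integration.integral_nonneg)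
  have mean: "2 ^ i * (\<integral>t. indicator ?J t * \<bar>h t\<bar> powr q \<partial>unit_leb) \<le> B"
    using cylinder_powr_mean[OF h i s q0 q(2)] unfolding B[symmetric] by (simp add: field_simps)
  have e1: "1 \<le> 2 powr ((real N - real i) * (1 - a))"
    using i a by (intro ge_one_powr_ge_zero mult_nonneg_nonneg) auto
  show ?thesis
  proof (cases "1 \<le> q")
    case True
    let ?b = "B powr (1 / q)"
    have b: "1 \<le> ?b" using B1 q0 by (intro ge_one_powr_ge_zero) auto
    \<comment> \<open>Below the threshold \<open>?b\<close> the first summand dominates, above it the second one.\<close>
    have pw: "\<bar>h t\<bar> \<le> ?b + ?b powr (1 - q) * \<bar>h t\<bar> powr q" for t
    proof (cases "\<bar>h t\<bar> \<le> ?b")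
      case False
      have "\<bar>h t\<bar> = \<bar>h t\<bar> powr (1 - q) * \<bar>h t\<bar> powr q"
        using False b by (simp add: powr_add[symmetric])
      also have "\<dots> \<le> ?b powr (1 - q) * \<bar>h t\<bar> powr q"
        using False b True by (intro mult_right_mono powr_mono2') auto
      finally show ?thesis using b by linarith
    qed (auto intro: order_trans add_increasing2)
    have "2 ^ i * (\<integral>t. indicator ?J t * \<bar>h t\<bar> \<partial>unit_leb)
        \<le> 2 ^ i * (\<integral>t. ?b * indicator ?J t
            + ?b powr (1 - q) * (indicator ?J t * \<bar>h t\<bar> powr q) \<partial>unit_leb)"
    proof (intro mult_left_mono integral_mono Bochner_Integration.integrable_add
        integrable_mult_right int0 intJ int1)
      show "indicator ?J t * \<bar>h t\<bar>
          \<le> ?b * indicator ?J t + ?b powr (1 - q) * (indicator ?J t * \<bar>h t\<bar> powr q)" for t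
        using pw by (simp add: indicator_def)
    qed simp
    also have "\<dots> = ?b + ?b powr (1 - q) * (2 ^ i * (\<integral>t. indicator ?J t * \<bar>h t\<bar> powr q \<partial>unit_leb))"
      using intJ int1 mJ by (simp add: distrib_left)
    also have "\<dots> \<le> ?b + ?b powr (1 - q) * B"
      using mean by (intro add_left_mono mult_left_mono) auto
    also have "?b powr (1 - q) * B = ?b"
    proof -
      have "?b powr (1 - q) * B = B powr ((1 - q) / q) * B powr 1"
        using B1 by (simp add: powr_powr)
      also have "\<dots> = B powr ((1 - q) / q + 1)" by (simp only: powr_add)
      also have "(1 - q) / q + 1 = 1 / q" using q0 by (simp add: field_simps)
      finally show ?thesis .
    qed
    also have "?b + ?b = 2 * (1 * ?b)" by simp
    also have "\<dots> \<le> 2 * (2 powr ((real N - real i) * (1 - a)) * ?b)"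
      using e1 b by (intro mult_left_mono mult_right_mono) auto
    finally show ?thesis .
  next
    case False
    define D where "D = 2 powr (real N - real i) * B"
    have D0: "0 < D" using B1 by (simp add: D_def)
    \<comment> \<open>\<open>h\<close> is constant on the interval of length \<open>2\<^sup>-\<^sup>N\<close> around \<open>t\<close>, whose share of the mean is at most the whole.\<close>
    have pt: "\<bar>h t\<bar> powr q \<le> D" if t: "t \<in> ?J" for t
    proof -
      have t01: "t \<in> {0..<1}" using t by (simp add: cylinder_def)
      have sub: "dyadic_cell N t \<subseteq> ?J" using t i by (auto simp: cylinder_def)
      have "\<bar>h t\<bar> powr q / 2 ^ N
          = (\<integral>u. indicator (dyadic_cell N t) u * \<bar>h u\<bar> powr q \<partial>unit_leb)"
        by (rule integral_indicator_cell[symmetric, OF dyadic_step_comp[OF h] t01])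
      also have "\<dots> \<le> (\<integral>u. indicator ?J u * \<bar>h u\<bar> powr q \<partial>unit_leb)"
        using sub by (intro integral_mono dyadic_step_indicator_integrable[of N] dyadic_step_comp[OF h]
            cylinder_sets) (auto simp: indicator_def)
      also have "\<dots> \<le> B / 2 ^ i" using mean by (simp add: field_simps)
      finally have "\<bar>h t\<bar> powr q \<le> 2 ^ N / 2 ^ i * B" by (simp add: field_simps)
      also have "(2::real) ^ N / 2 ^ i = 2 powr (real N - real i)"
        by (simp add: powr_diff powr_realpow)
      finally show ?thesis by (simp add: D_def)
    qed
    have pw: "\<bar>h t\<bar> \<le> D powr (1 / q - 1) * \<bar>h t\<bar> powr q" if t: "t \<in> ?J" for t
    proof (cases "h t = 0")
      case False
      have "\<bar>h t\<bar> = (\<bar>h t\<bar> powr q) powr (1 / q - 1) * \<bar>h t\<bar> powr q"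
        using False q0 by (simp add: powr_powr powr_add[symmetric] field_simps)
      also have "\<dots> \<le> D powr (1 / q - 1) * \<bar>h t\<bar> powr q"
        using pt[OF t] \<open>\<not> 1 \<le> q\<close> q0 by (intro mult_right_mono powr_mono2) (auto simp: field_simps)
      finally show ?thesis .
    qed simp
    have "2 ^ i * (\<integral>t. indicator ?J t * \<bar>h t\<bar> \<partial>unit_leb)
        \<le> 2 ^ i * (\<integral>t. D powr (1 / q - 1) * (indicator ?J t * \<bar>h t\<bar> powr q) \<partial>unit_leb)"
      using int0 int1 pw
      by (intro mult_left_mono integral_mono integrable_mult_right) (auto simp: indicator_def)
    also have "\<dots> = D powr (1 / q - 1) * (2 ^ i * (\<integral>t. indicator ?J t * \<bar>h t\<bar> powr q \<partial>unit_leb))"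
      by simp
    also have "\<dots> \<le> D powr (1 / q - 1) * B"
      using mean by (intro mult_left_mono) auto
    also have "\<dots> = 2 powr ((real N - real i) * (1 / q - 1)) * (B powr (1 / q - 1) * B powr 1)"
      using B1 by (simp add: D_def powr_mult powr_powr)
    also have "B powr (1 / q - 1) * B powr 1 = B powr (1 / q)"
      by (simp only: powr_add[symmetric]) simp
    also have "2 powr ((real N - real i) * (1 / q - 1)) \<le> 2 powr ((real N - real i) * (1 - a))"
    proof -
      have "1 / q \<le> 1 / pm" using q(1) pm_pos by (simp add: frac_le)
      then show ?thesis using a i by (intro powr_mono mult_left_mono) auto
    qed
    finally have "2 ^ i * (\<integral>t. indicator ?J t * \<bar>h t\<bar> \<partial>unit_leb)
        \<le> 1 * (2 powr ((real N - real i) * (1 - a)) * B powr (1 / q))" by (simp add: mult_right_mono)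
    also have "\<dots> \<le> 2 * (2 powr ((real N - real i) * (1 - a)) * B powr (1 / q))"
      by (intro mult_right_mono) auto
    finally show ?thesis .
  qed
qed
end

text \<open>The estimate of a single summand, with \<open>d = i - j\<close>, \<open>e = N - i\<close>, \<open>r = p x\<close>. The loss
  \<open>B powr ((r - q) / q)\<close> is split along \<open>B \<le> 2 powr (1 + d + j)\<close>: the condition on \<open>K\<close> takes care of \<open>j\<close>,
  and the gap condition on \<open>1 / pm - 1 / pp\<close> leaves a decay in \<open>d\<close>.\<close>

lemma exponent_bookkeeping:
  fixes B d e j K a b r q pm pp :: real
  assumes B: "1 \<le> B" "B \<le> 2 powr (1 + d + j)" and de: "0 \<le> d" "0 \<le> e" "0 \<le> j"
    and q: "0 < pm" "pm \<le> q" "q \<le> r" "r \<le> pp"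
    and K: "1 \<le> K" "2 powr (j * (r - q)) \<le> K"
    and a: "0 \<le> a" and \<beta>: "\<beta> \<le> a * pm" "\<beta> \<le> pm * (1 - (1 / pm - 1 / pp))" and gap: "1 / pm - 1 / pp \<le> 1"
    and t: "0 \<le> t" "t \<le> 2 * (2 powr (- d - e * a) * B powr (1 / q))"
  shows "t powr r \<le> (2 powr pp * 2 powr (pp / pm) * K powr (1 / pm)) * 2 powr (- \<beta> * (d + e)) * B"
proof -
  have q0: "0 < q" "0 < r" "0 < pp" using q by auto
  have "t powr r \<le> (2 * (2 powr (- d - e * a) * B powr (1 / q))) powr r"
    using t q0 by (intro powr_mono2) auto
  also have "\<dots> = 2 powr r * (2 powr ((- d - e * a) * r) * B powr (r / q))"
    by (simp add: powr_mult powr_powr)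
  also have "B powr (r / q) = B * B powr ((r - q) / q)"
  proof -
    have "r / q = 1 + (r - q) / q" using q0 by (simp add: field_simps)
    then show ?thesis using B(1) by (simp add: powr_add)
  qed
  also have "2 powr r * (2 powr ((- d - e * a) * r) * (B * B powr ((r - q) / q)))
      \<le> 2 powr pp * (2 powr ((- d - e * a) * r) * (B * (2 powr (pp / pm) * 2 powr (d * (r / q - 1)) * K powr (1 / pm))))"
  proof (intro mult_mono)
    show "2 powr r \<le> 2 powr pp" using q by (intro powr_mono) auto
    have "B powr ((r - q) / q) \<le> (2 powr (1 + d + j)) powr ((r - q) / q)"
      using B q q0 by (intro powr_mono2) auto
    also have "\<dots> = 2 powr ((r - q) / q) * 2 powr (d * (r / q - 1)) * (2 powr (j * (r - q))) powr (1 / q)"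
    proof -
      have "r / q - 1 = (r - q) / q" using q0 by (simp add: diff_divide_distrib)
      then show ?thesis
        by (simp add: powr_powr powr_add[symmetric] distrib_right add_divide_distrib)
    qed
    also have "\<dots> \<le> 2 powr (pp / pm) * 2 powr (d * (r / q - 1)) * K powr (1 / pm)"
    proof (intro mult_mono)
      have "(r - q) / q \<le> pp / pm" using q q0 by (intro frac_le) auto
      then show "2 powr ((r - q) / q) \<le> 2 powr (pp / pm)" by simp
      have "(2 powr (j * (r - q))) powr (1 / q) \<le> K powr (1 / q)"
        using K q0 by (intro powr_mono2) auto
      also have "\<dots> \<le> K powr (1 / pm)" using K q q0 by (intro powr_mono) (auto simp: frac_le)
      finally show "(2 powr (j * (r - q))) powr (1 / q) \<le> K powr (1 / pm)" .
    qed auto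
    finally show "B powr ((r - q) / q) \<le> 2 powr (pp / pm) * 2 powr (d * (r / q - 1)) * K powr (1 / pm)" .
  qed (use B in auto)
  also have "\<dots> = (2 powr pp * 2 powr (pp / pm) * K powr (1 / pm)) * 2 powr ((- d - e * a) * r + d * (r / q - 1)) * B"
    by (simp only: powr_add mult_ac)
  also have "\<dots> \<le> (2 powr pp * 2 powr (pp / pm) * K powr (1 / pm)) * 2 powr (- \<beta> * (d + e)) * B"
  proof (intro mult_right_mono mult_left_mono)
    have "r * (1 + 1 / r - 1 / q) \<ge> pm * (1 - (1 / pm - 1 / pp))"
    proof (rule mult_mono)
      have "1 / pp \<le> 1 / r" "1 / q \<le> 1 / pm" using q q0 by (simp_all add: frac_le)
      then show "1 - (1 / pm - 1 / pp) \<le> 1 + 1 / r - 1 / q" by simp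
    qed (use q q0 gap in auto)
    then have "\<beta> \<le> r * (1 + 1 / r - 1 / q)" using \<beta> by simp
    also have "\<dots> = r - (r / q - 1)" using q0 by (simp add: field_simps)
    finally have "d * \<beta> \<le> d * (r - (r / q - 1))" using de by (intro mult_left_mono)
    moreover have "e * \<beta> \<le> e * (a * r)"
    proof -
      have "a * pm \<le> a * r" using a q by (intro mult_left_mono) auto
      then show ?thesis using \<beta> de by (intro mult_left_mono) auto
    qed
    ultimately have "(- d - e * a) * r + d * (r / q - 1) \<le> - \<beta> * (d + e)"
      by (simp add: algebra_simps)
    then show "2 powr ((- d - e * a) * r + d * (r / q - 1)) \<le> 2 powr (- \<beta> * (d + e))" by simp
  qed (use B in auto)
  finally show ?thesis .
qed

text \<open>A quasi-triangle inequality that holds for exponents on either side of 1: a sum with weights of total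
  mass at most 1 is dominated by its largest normalised summand.\<close>

lemma powr_sum_le:
  fixes u w :: "'b \<Rightarrow> real"
  assumes "finite T" "\<And>i. i \<in> T \<Longrightarrow> 0 < w i" "\<And>i. i \<in> T \<Longrightarrow> 0 \<le> u i" "(\<Sum>i\<in>T. w i) \<le> 1" "0 < r"
  shows "(\<Sum>i\<in>T. u i) powr r \<le> (\<Sum>i\<in>T. (u i / w i) powr r)"
proof (cases "T = {}")
  case False
  obtain k where k: "k \<in> T" "\<And>i. i \<in> T \<Longrightarrow> u i / w i \<le> u k / w k"
  proof -
    have "Max ((\<lambda>i. u i / w i) ` T) \<in> (\<lambda>i. u i / w i) ` T" using assms(1) False by (intro Max_in) auto
    then obtain k where "k \<in> T" "Max ((\<lambda>i. u i / w i) ` T) = u k / w k" by auto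
    moreover have "u i / w i \<le> Max ((\<lambda>i. u i / w i) ` T)" if "i \<in> T" for i
      using assms(1) that by (intro Max_ge) auto
    ultimately show ?thesis using that by auto
  qed
  have "(\<Sum>i\<in>T. u i) \<le> (\<Sum>i\<in>T. w i * (u k / w k))"
  proof (rule sum_mono)
    fix i assume i: "i \<in> T"
    have "u i = w i * (u i / w i)" using assms(2)[OF i] by simp
    also have "\<dots> \<le> w i * (u k / w k)" using assms(2)[OF i] k(2)[OF i] by (intro mult_left_mono) auto
    finally show "u i \<le> w i * (u k / w k)" .
  qed
  also have "\<dots> = (\<Sum>i\<in>T. w i) * (u k / w k)" by (simp only: sum_distrib_right)
  also have "\<dots> \<le> 1 * (u k / w k)"
    using assms(2)[OF k(1)] assms(3)[OF k(1)] assms(4) by (intro mult_right_mono) auto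
  finally have "(\<Sum>i\<in>T. u i) powr r \<le> (u k / w k) powr r"
    using assms by (intro powr_mono2) (auto intro: sum_nonneg)
  also have "\<dots> \<le> (\<Sum>i\<in>T. (u i / w i) powr r)"
    using k(1) assms(1) by (intro member_le_sum[where f = "\<lambda>i. (u i / w i) powr r"]) auto
  finally show ?thesis .
qed simp

lemma geometric_double_sum:
  fixes q :: real
  assumes "0 < q" "q < 1"
  shows "(\<Sum>i\<le>N. \<Sum>j\<le>i. q ^ (N - j)) \<le> 1 / (1 - q)\<^sup>2"
proof -
  have geo: "(\<Sum>j\<le>n. q ^ (n - j)) \<le> 1 / (1 - q)" for n
  proof -
    have "(\<Sum>j\<le>n. q ^ (n - j)) = (\<Sum>j\<le>n. q ^ j)"
      by (rule sum.reindex_bij_witness[of _ "\<lambda>j. n - j" "\<lambda>j. n - j"]) auto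
    also have "\<dots> = (1 - q ^ Suc n) / (1 - q)"
      using sum_gp_basic[of q n] assms by (simp add: eq_divide_eq mult.commute)
    also have "\<dots> \<le> 1 / (1 - q)" using assms by (intro divide_right_mono) auto
    finally show ?thesis .
  qed
  have "(\<Sum>i\<le>N. \<Sum>j\<le>i. q ^ (N - j)) = (\<Sum>i\<le>N. q ^ (N - i) * (\<Sum>j\<le>i. q ^ (i - j)))"
    unfolding sum_distrib_left by (intro sum.cong refl) (simp add: power_add[symmetric])
  also have "\<dots> \<le> (\<Sum>i\<le>N. q ^ (N - i) * (1 / (1 - q)))"
    using assms geo by (intro sum_mono mult_left_mono) auto
  also have "\<dots> = (\<Sum>i\<le>N. q ^ (N - i)) * (1 / (1 - q))" by (simp only: sum_distrib_right)
  also have "\<dots> \<le> 1 / (1 - q) * (1 / (1 - q))"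
    using assms geo by (intro mult_right_mono) auto
  finally show ?thesis by (simp add: power2_eq_square)
qed

section \<open>Uniform modular bound for Fejer means\<close>

context log_hoelder_exponent
begin

lemma modular_step_eq:
  "dyadic_step N h \<Longrightarrow> modular p h = ennreal (\<integral>t. \<bar>h t\<bar> powr p t \<partial>unit_leb)"
  unfolding modular_def by (intro nn_integral_eq_integral step_powr_integrable) auto

lemma AE_log_hoelder_cell:
  "AE x in unit_leb. \<forall>j. \<exists>q\<ge>pm. q \<le> p x \<and> (2 ^ j) powr (p x - q) \<le> K \<and>
     (AE t in unit_leb. t \<in> dyadic_cell j x \<longrightarrow> q \<le> p t)"
proof -
  define Q where "Q j k = (SOME q. pm \<le> q \<and> (AE t in unit_leb.
      t \<in> dyadic_interval j k \<longrightarrow> q \<le> p t \<and> (2 ^ j) powr (p t - q) \<le> K))" for j k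
  have Q: "pm \<le> Q j k \<and> (AE t in unit_leb.
      t \<in> dyadic_interval j k \<longrightarrow> Q j k \<le> p t \<and> (2 ^ j) powr (p t - Q j k) \<le> K)"
    if "k < 2 ^ j" for j k
    unfolding Q_def by (rule someI_ex[OF log_hoelder[OF that]])
  have "AE x in unit_leb. \<forall>j. \<forall>k. k < 2 ^ j \<longrightarrow> x \<in> dyadic_interval j k \<longrightarrow>
      Q j k \<le> p x \<and> (2 ^ j) powr (p x - Q j k) \<le> K"
    unfolding AE_all_countable using Q by simp
  then show ?thesis
    using AE_space
  proof eventually_elim
    case (elim x)
    show ?case
    proof
      fix j
      obtain k where k: "k < 2 ^ j" "dyadic_cell j x = dyadic_interval j k"
        by (rule cylinder_eq_dyadic_interval[of "\<lambda>k. rademacher k x" j]) (rule rademacher_cases)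
      have x: "x \<in> dyadic_interval j k" using elim(2) dyadic_cell_self[of x j] k(2) by simp
      show "\<exists>q\<ge>pm. q \<le> p x \<and> (2 ^ j) powr (p x - q) \<le> K \<and>
          (AE t in unit_leb. t \<in> dyadic_cell j x \<longrightarrow> q \<le> p t)"
      proof (intro exI[of _ "Q j k"] conjI)
        show "AE t in unit_leb. t \<in> dyadic_cell j x \<longrightarrow> Q j k \<le> p t"
          unfolding k(2) using Q[OF k(1)] by (auto elim: eventually_mono)
      qed (use Q[OF k(1)] elim(1) k(1) x in auto)
    qed
  qed
qed

lemma flip_cell_subset: "j \<le> i \<Longrightarrow> flip_cell i j x \<subseteq> dyadic_cell j x"
  by (auto simp: flip_cell_def cylinder_def)

text \<open>The rate of geometric decay of the summands; it is positive because of \<open>1/2 < pm\<close> and of the gap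
  condition.\<close>

definition decay :: real where
  "decay = min (pm * (1 - (1 / pm - 1 / pp))) (min 1 (2 - 1 / pm) * pm)"

lemma decay_pos: "0 < decay"
proof -
  have "1 / pm < 2" using pm_half by (simp add: field_simps)
  then show ?thesis using pm_pos gap by (simp add: decay_def)
qed

text \<open>Here \<open>q\<close> is a lower bound for \<open>p\<close> on the dyadic interval of length \<open>2\<^sup>-\<^sup>j\<close> around \<open>x\<close>, which
  contains \<open>flip_cell i j x\<close>.\<close>

lemma flip_term_bound:
  assumes h: "dyadic_step N h" and mod: "(\<integral>t. \<bar>h t\<bar> powr p t \<partial>unit_leb) \<le> 1"
    and ij: "j \<le> i" "i \<le> N" and q: "pm \<le> q" "q \<le> p x" "p x \<le> pp" "(2 ^ j) powr (p x - q) \<le> K"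
    and q_cell: "AE t in unit_leb. t \<in> dyadic_cell j x \<longrightarrow> q \<le> p t"
  shows "(2 ^ j / 2 ^ N * (2 ^ i * (\<integral>t. indicator (flip_cell i j x) t * \<bar>h t\<bar> \<partial>unit_leb))) powr p x
    \<le> (2 powr pp * 2 powr (pp / pm) * K powr (1 / pm)) * 2 powr (- decay * (real N - real j)) *
      (1 + 2 ^ i * (\<integral>t. indicator (flip_cell i j x) t * \<bar>h t\<bar> powr p t \<partial>unit_leb))"
    (is "?t powr _ \<le> _ * ?B")
proof -
  define a where "a = min 1 (2 - 1 / pm)"
  have "1 / pm < 2" using pm_half by (simp add: field_simps)
  then have a: "0 \<le> a" "a \<le> 1" "a \<le> 2 - 1 / pm" by (auto simp: a_def)
  have decay_le: "decay \<le> a * pm" "decay \<le> pm * (1 - (1 / pm - 1 / pp))" by (auto simp: decay_def a_def)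
  define d where "d = real i - real j"
  define e where "e = real N - real i"
  have d0: "0 \<le> d" "0 \<le> e" using ij by (auto simp: d_def e_def)
  have B1: "1 \<le> ?B" by (auto intro!: mult_nonneg_nonneg Bochner_Integration.integral_nonneg)
  have AEJ: "AE t in unit_leb. t \<in> flip_cell i j x \<longrightarrow> q \<le> p t"
    using q_cell flip_cell_subset[OF ij(1), of x] by (auto elim!: eventually_mono)
  have "(\<integral>t. indicator (flip_cell i j x) t * \<bar>h t\<bar> powr p t \<partial>unit_leb)
      \<le> (\<integral>t. \<bar>h t\<bar> powr p t \<partial>unit_leb)"
    by (intro integral_mono step_powr_indicator_integrable[OF h] step_powr_integrable[OF h] flip_cell_sets)
      (auto simp: indicator_def)
  with mod have "?B \<le> 1 + 2 ^ i * 1" by (intro add_left_mono mult_left_mono) auto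
  also have "\<dots> \<le> 2 ^ Suc i" by simp
  also have "\<dots> = 2 powr (1 + d + real j)" by (simp add: d_def powr_realpow[symmetric] powr_add)
  finally have B2: "?B \<le> 2 powr (1 + d + real j)" .
  have mean: "2 ^ i * (\<integral>t. indicator (flip_cell i j x) t * \<bar>h t\<bar> \<partial>unit_leb)
      \<le> 2 * (2 powr ((real N - real i) * (1 - a)) * ?B powr (1 / q))"
    unfolding flip_cell_def
    by (rule cylinder_mean_bound[OF h ij(2) _ q(1) _ a(2,3) refl])
      (use rademacher_cases[of _ x] AEJ in \<open>fastforce, simp add: flip_cell_def\<close>)
  have "?t \<le> 2 ^ j / 2 ^ N * (2 * (2 powr ((real N - real i) * (1 - a)) * ?B powr (1 / q)))"
    by (rule mult_left_mono[OF mean]) simp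
  also have "\<dots> = 2 * ((2 ^ j / 2 ^ N * 2 powr ((real N - real i) * (1 - a))) * ?B powr (1 / q))" by simp
  also have "2 ^ j / 2 ^ N * 2 powr ((real N - real i) * (1 - a)) = 2 powr (- d - e * a)"
    by (simp add: powr_realpow[symmetric] powr_diff[symmetric] powr_add[symmetric] d_def e_def algebra_simps)
  finally have t: "?t \<le> 2 * (2 powr (- d - e * a) * ?B powr (1 / q))" .
  have "2 powr (real j * (p x - q)) \<le> K"
    using q(4) by (simp add: powr_powr powr_realpow[symmetric])
  from exponent_bookkeeping[OF B1 B2 d0 _ pm_pos q(1,2,3) K_ge_1 this a(1) decay_le _ _ t]
  have "?t powr p x \<le> (2 powr pp * 2 powr (pp / pm) * K powr (1 / pm)) * 2 powr (- decay * (d + e)) * ?B"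
    using gap by (auto intro!: mult_nonneg_nonneg)
  then show ?thesis by (simp add: d_def e_def)
qed

lemma fejer_op_powr_bound:
  obtains C q :: real where "0 \<le> C" "0 < q" "q < 1"
    "\<And>N n h. dyadic_step N h \<Longrightarrow> (\<integral>t. \<bar>h t\<bar> powr p t \<partial>unit_leb) \<le> 1 \<Longrightarrow> n \<le> 2 ^ N \<Longrightarrow> 2 ^ N \<le> 2 * n \<Longrightarrow>
      AE x in unit_leb. \<bar>fejer_op n h x\<bar> powr p x \<le> (\<Sum>i\<le>N. \<Sum>j\<le>i. C * q ^ (N - j) *
        (1 + 2 ^ i * (\<integral>t. indicator (flip_cell i j x) t * \<bar>h t\<bar> powr p t \<partial>unit_leb)))"
proof -
  \<comment> \<open>The weights \<open>c * \<rho> ^ (N - j)\<close> have total mass at most 1 and cost at most half of the decay.\<close>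
  define \<rho> where "\<rho> = 2 powr (- decay / (2 * pp))"
  define q where "q = 2 powr (- decay / 2)"
  define c where "c = (1 - \<rho>)\<^sup>2"
  define C0 where "C0 = 2 powr pp * 2 powr (pp / pm) * K powr (1 / pm)"
  have neg: "2 powr z < 1" if "z < 0" for z :: real using powr_less_mono[OF that, of 2] by simp
  have \<rho>: "0 < \<rho>" "\<rho> < 1" using decay_pos pp_pos by (auto simp: \<rho>_def intro!: neg divide_pos_pos)
  have q01: "0 < q" "q < 1" using decay_pos by (auto simp: q_def intro!: neg)
  have c: "0 < c" "c \<le> 1" using \<rho> by (auto simp: c_def power_le_one)
  have C0: "0 \<le> C0" by (auto simp: C0_def)
  have bound: "AE x in unit_leb. \<bar>fejer_op n h x\<bar> powr p x \<le> (\<Sum>i\<le>N. \<Sum>j\<le>i. (4 / c) powr pp * C0 * q ^ (N - j) *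
        (1 + 2 ^ i * (\<integral>t. indicator (flip_cell i j x) t * \<bar>h t\<bar> powr p t \<partial>unit_leb)))"
    if h: "dyadic_step N h" and mod: "(\<integral>t. \<bar>h t\<bar> powr p t \<partial>unit_leb) \<le> 1"
      and n: "n \<le> 2 ^ N" "2 ^ N \<le> 2 * n" for N n h
    using AE_log_hoelder_cell p_bounds
  proof eventually_elim
    case (elim x)
    define T where "T = (SIGMA i:{..N}. {..i})"
    define t where "t i j = 2 ^ j / 2 ^ N * (2 ^ i * (\<integral>t. indicator (flip_cell i j x) t * \<bar>h t\<bar> \<partial>unit_leb))" for i j
    define B where "B i j = 1 + 2 ^ i * (\<integral>t. indicator (flip_cell i j x) t * \<bar>h t\<bar> powr p t \<partial>unit_leb)" for i j
    have t0: "0 \<le> t i j" for i j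
      unfolding t_def by (intro mult_nonneg_nonneg Bochner_Integration.integral_nonneg) auto
    have B0: "0 \<le> B i j" for i j
      unfolding B_def by (intro add_nonneg_nonneg mult_nonneg_nonneg Bochner_Integration.integral_nonneg) auto
    have px: "0 < p x" "p x \<le> pp" using elim(2) pm_pos by auto
    have "\<bar>fejer_op n h x\<bar> \<le> (\<Sum>i\<le>N. \<Sum>j\<le>i. 4 * t i j)"
      using fejer_op_bound[OF h n, of x] by (simp add: t_def)
    also have "\<dots> = (\<Sum>(i, j)\<in>T. 4 * t i j)" unfolding T_def by (rule sum.Sigma) auto
    finally have "\<bar>fejer_op n h x\<bar> powr p x \<le> (\<Sum>(i, j)\<in>T. 4 * t i j) powr p x"
      using px by (intro powr_mono2) auto
    also have "\<dots> = (\<Sum>z\<in>T. 4 * t (fst z) (snd z)) powr p x" by (simp add: case_prod_unfold)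
    also have "\<dots> \<le> (\<Sum>z\<in>T. (4 * t (fst z) (snd z) / (c * \<rho> ^ (N - snd z))) powr p x)"
    proof (rule powr_sum_le)
      have "(\<Sum>z\<in>T. c * \<rho> ^ (N - snd z)) = c * (\<Sum>i\<le>N. \<Sum>j\<le>i. \<rho> ^ (N - j))"
        unfolding T_def by (subst sum.Sigma) (auto simp: sum_distrib_left case_prod_unfold)
      also have "\<dots> \<le> c * (1 / (1 - \<rho>)\<^sup>2)" using geometric_double_sum[OF \<rho>] c by (intro mult_left_mono) auto
      also have "\<dots> = 1" using \<rho> by (simp add: c_def)
      finally show "(\<Sum>z\<in>T. c * \<rho> ^ (N - snd z)) \<le> 1" .
    qed (use c \<rho> t0 px in \<open>auto simp: T_def\<close>)
    also have "\<dots> \<le> (\<Sum>z\<in>T. (4 / c) powr pp * C0 * q ^ (N - snd z) * B (fst z) (snd z))"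
    proof (rule sum_mono)
      fix z assume "z \<in> T"
      then obtain i j where z: "z = (i, j)" "i \<le> N" "j \<le> i" by (auto simp: T_def)
      obtain Q where Q: "pm \<le> Q" "Q \<le> p x" "(2 ^ j) powr (p x - Q) \<le> K"
        "AE t in unit_leb. t \<in> dyadic_cell j x \<longrightarrow> Q \<le> p t" using elim(1) by blast
      have tb: "t i j powr p x \<le> C0 * 2 powr (- decay * (real N - real j)) * B i j"
        unfolding t_def B_def C0_def by (rule flip_term_bound[OF h mod z(3,2) Q(1,2) px(2) Q(3,4)])
      have "(4 * t i j / (c * \<rho> ^ (N - j))) powr p x
          = (4 / c) powr p x * (1 / \<rho> ^ (N - j)) powr p x * t i j powr p x"
        using c \<rho> t0[of i j] by (simp add: powr_mult powr_divide)
      also have "\<dots> \<le> (4 / c) powr pp * (1 / \<rho> ^ (N - j)) powr pp * (C0 * 2 powr (- decay * (real N - real j)) * B i j)"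
      proof (intro mult_mono)
        show "(4 / c) powr p x \<le> (4 / c) powr pp"
          using c px by (intro powr_mono) (auto simp: field_simps)
        show "(1 / \<rho> ^ (N - j)) powr p x \<le> (1 / \<rho> ^ (N - j)) powr pp"
          using \<rho> px by (intro powr_mono) (auto simp: power_le_one)
      qed (use tb in auto)
      also have "(1 / \<rho> ^ (N - j)) powr pp = 2 powr (decay / 2 * (real N - real j))"
      proof -
        have "\<rho> ^ (N - j) = 2 powr (- decay / (2 * pp) * (real N - real j))"
          unfolding \<rho>_def using z by (simp add: powr_powr powr_realpow[symmetric] of_nat_diff)
        then have "1 / \<rho> ^ (N - j) = 2 powr (decay / (2 * pp) * (real N - real j))"
          by (simp add: powr_minus_divide)
        then show ?thesis using pp_pos by (simp add: powr_powr)
      qed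
      also have "(4 / c) powr pp * 2 powr (decay / 2 * (real N - real j)) * (C0 * 2 powr (- decay * (real N - real j)) * B i j)
          = (4 / c) powr pp * C0 * (2 powr (decay / 2 * (real N - real j)) * 2 powr (- decay * (real N - real j))) * B i j"
        by simp
      also have "2 powr (decay / 2 * (real N - real j)) * 2 powr (- decay * (real N - real j)) = q ^ (N - j)"
      proof -
        have "q ^ (N - j) = 2 powr (- decay / 2 * (real N - real j))"
          unfolding q_def using z by (simp add: powr_powr powr_realpow[symmetric] of_nat_diff)
        moreover have "decay / 2 * (real N - real j) + - decay * (real N - real j)
            = - decay / 2 * (real N - real j)"
          by (simp add: field_simps)
        ultimately show ?thesis by (simp only: powr_add[symmetric])
      qed
      finally show "(4 * t (fst z) (snd z) / (c * \<rho> ^ (N - snd z))) powr p x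
          \<le> (4 / c) powr pp * C0 * q ^ (N - snd z) * B (fst z) (snd z)" by (simp add: z)
    qed
    also have "\<dots> = (\<Sum>i\<le>N. \<Sum>j\<le>i. (4 / c) powr pp * C0 * q ^ (N - j) * B i j)"
      unfolding T_def by (subst sum.Sigma) (auto simp: case_prod_unfold)
    finally show ?case by (simp add: B_def)
  qed
  show ?thesis by (rule that[OF _ q01 bound]) (use C0 in auto)
qed

lemma fejer_op_modular_bounded:
  obtains C :: real where "0 \<le> C"
    "\<And>N n h. dyadic_step N h \<Longrightarrow> modular p h \<le> 1 \<Longrightarrow> n \<le> 2 ^ N \<Longrightarrow> 2 ^ N \<le> 2 * n \<Longrightarrow>
      modular p (fejer_op n h) \<le> ennreal C"
proof (rule fejer_op_powr_bound)
  fix C q :: real assume C: "0 \<le> C" "0 < q" "q < 1"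
    "\<And>N n h. dyadic_step N h \<Longrightarrow> (\<integral>t. \<bar>h t\<bar> powr p t \<partial>unit_leb) \<le> 1 \<Longrightarrow> n \<le> 2 ^ N \<Longrightarrow> 2 ^ N \<le> 2 * n \<Longrightarrow>
      AE x in unit_leb. \<bar>fejer_op n h x\<bar> powr p x \<le> (\<Sum>i\<le>N. \<Sum>j\<le>i. C * q ^ (N - j) *
        (1 + 2 ^ i * (\<integral>t. indicator (flip_cell i j x) t * \<bar>h t\<bar> powr p t \<partial>unit_leb)))"
  have "modular p (fejer_op n h) \<le> ennreal (2 * C * (1 / (1 - q)\<^sup>2))"
    if h: "dyadic_step N h" and mod: "modular p h \<le> 1" and n: "n \<le> 2 ^ N" "2 ^ N \<le> 2 * n" for N n h
  proof -
    define G where "G t = \<bar>h t\<bar> powr p t" for t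
    have [measurable]: "h \<in> borel_measurable unit_leb" by (rule dyadic_step_measurable[OF h])
    have G [measurable]: "G \<in> borel_measurable unit_leb" unfolding G_def by measurable
    have mod': "(\<integral>t. \<bar>h t\<bar> powr p t \<partial>unit_leb) \<le> 1"
      using mod unfolding modular_step_eq[OF h] by (simp add: ennreal_le_1)
    have modG: "(\<integral>\<^sup>+t. ennreal (G t) \<partial>unit_leb) \<le> 1" using mod by (simp add: modular_def G_def)
    have inner: "ennreal (\<integral>t. indicator (flip_cell i j x) t * G t \<partial>unit_leb)
        = (\<integral>\<^sup>+t. indicator (flip_cell i j x) t * ennreal (G t) \<partial>unit_leb)" for i j x
    proof -
      have "(\<integral>\<^sup>+t. indicator (flip_cell i j x) t * ennreal (G t) \<partial>unit_leb)
          = (\<integral>\<^sup>+t. ennreal (indicator (flip_cell i j x) t * G t) \<partial>unit_leb)"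
        by (intro nn_integral_cong) (simp add: indicator_def)
      also have "\<dots> = ennreal (\<integral>t. indicator (flip_cell i j x) t * G t \<partial>unit_leb)"
        unfolding G_def by (rule nn_integral_eq_integral[OF step_powr_indicator_integrable[OF h flip_cell_sets]]) simp
      finally show ?thesis by simp
    qed
    have F: "(\<integral>\<^sup>+x. ennreal (2 ^ i * (\<integral>t. indicator (flip_cell i j x) t * G t \<partial>unit_leb)) \<partial>unit_leb) \<le> 1"
      and M: "(\<lambda>x. ennreal (2 ^ i * (\<integral>t. indicator (flip_cell i j x) t * G t \<partial>unit_leb))) \<in> borel_measurable unit_leb"
      for i j
    proof -
      have eq: "ennreal (2 ^ i * (\<integral>t. indicator (flip_cell i j x) t * G t \<partial>unit_leb))
          = ennreal (2 ^ i) * (\<integral>\<^sup>+t. indicator (flip_cell i j x) t * ennreal (G t) \<partial>unit_leb)" for x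
        unfolding inner[symmetric] by (rule ennreal_mult') simp
      have G': "(\<lambda>t. ennreal (G t)) \<in> borel_measurable unit_leb" by measurable
      note M' = nn_integral_flip_cell_measurable[OF G', of i j]
      show "(\<lambda>x. ennreal (2 ^ i * (\<integral>t. indicator (flip_cell i j x) t * G t \<partial>unit_leb)))
          \<in> borel_measurable unit_leb"
        unfolding eq using M' by measurable
      have "(\<integral>\<^sup>+x. ennreal (2 ^ i * (\<integral>t. indicator (flip_cell i j x) t * G t \<partial>unit_leb)) \<partial>unit_leb)
          = ennreal (2 ^ i) * (ennreal (1 / 2 ^ i) * (\<integral>\<^sup>+t. ennreal (G t) \<partial>unit_leb))"
        unfolding eq nn_integral_cmult[OF M'] nn_integral_flip_cell[OF G'] ..
      also have "\<dots> = ennreal (2 ^ i * (1 / 2 ^ i)) * (\<integral>\<^sup>+t. ennreal (G t) \<partial>unit_leb)"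
        by (subst ennreal_mult) (auto simp: mult.assoc)
      also have "\<dots> = (\<integral>\<^sup>+t. ennreal (G t) \<partial>unit_leb)" by simp
      finally show "(\<integral>\<^sup>+x. ennreal (2 ^ i * (\<integral>t. indicator (flip_cell i j x) t * G t \<partial>unit_leb)) \<partial>unit_leb) \<le> 1"
        using modG by simp
    qed
    have "modular p (fejer_op n h) \<le> (\<integral>\<^sup>+x. (\<Sum>i\<le>N. \<Sum>j\<le>i. ennreal (C * q ^ (N - j)) *
        (1 + ennreal (2 ^ i * (\<integral>t. indicator (flip_cell i j x) t * G t \<partial>unit_leb)))) \<partial>unit_leb)"
      unfolding modular_def
    proof (rule nn_integral_mono_AE)
      show "AE x in unit_leb. ennreal (\<bar>fejer_op n h x\<bar> powr p x) \<le> (\<Sum>i\<le>N. \<Sum>j\<le>i. ennreal (C * q ^ (N - j)) *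
        (1 + ennreal (2 ^ i * (\<integral>t. indicator (flip_cell i j x) t * G t \<partial>unit_leb))))"
        using C(4)[OF h mod' n]
      proof eventually_elim
        case (elim x)
        have B0: "0 \<le> 2 ^ i * (\<integral>t. indicator (flip_cell i j x) t * G t \<partial>unit_leb)" for i j
          unfolding G_def by (intro mult_nonneg_nonneg Bochner_Integration.integral_nonneg) auto
        have "ennreal (\<bar>fejer_op n h x\<bar> powr p x) \<le> ennreal (\<Sum>i\<le>N. \<Sum>j\<le>i. C * q ^ (N - j) *
          (1 + 2 ^ i * (\<integral>t. indicator (flip_cell i j x) t * G t \<partial>unit_leb)))"
          using elim by (intro ennreal_leI) (simp add: G_def)
        also have "\<dots> = (\<Sum>i\<le>N. \<Sum>j\<le>i. ennreal (C * q ^ (N - j)) *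
          (1 + ennreal (2 ^ i * (\<integral>t. indicator (flip_cell i j x) t * G t \<partial>unit_leb))))"
          using B0 C(1,2) by (simp add: sum_ennreal[symmetric] ennreal_mult ennreal_plus sum_nonneg)
        finally show ?case .
      qed
    qed
    also have "\<dots> = (\<Sum>i\<le>N. \<Sum>j\<le>i. ennreal (C * q ^ (N - j)) *
        (1 + (\<integral>\<^sup>+x. ennreal (2 ^ i * (\<integral>t. indicator (flip_cell i j x) t * G t \<partial>unit_leb)) \<partial>unit_leb)))"
      using M by (simp add: nn_integral_sum nn_integral_cmult nn_integral_add unit.emeasure_space_1[simplified])
    also have "\<dots> \<le> (\<Sum>i\<le>N. \<Sum>j\<le>i. ennreal (C * q ^ (N - j)) * (1 + 1))"
      using F by (intro sum_mono mult_left_mono add_left_mono) auto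
    also have "\<dots> = (\<Sum>i\<le>N. \<Sum>j\<le>i. ennreal (C * q ^ (N - j) * 2))"
      using C(1,2) by (intro sum.cong refl) (simp add: ennreal_mult one_add_one)
    also have "\<dots> = ennreal (\<Sum>i\<le>N. \<Sum>j\<le>i. C * q ^ (N - j) * 2)"
      using C(1,2) by (simp add: sum_nonneg)
    also have "\<dots> = ennreal (2 * C * (\<Sum>i\<le>N. \<Sum>j\<le>i. q ^ (N - j)))"
      by (simp add: sum_distrib_left mult_ac)
    also have "\<dots> \<le> ennreal (2 * C * (1 / (1 - q)\<^sup>2))"
      using geometric_double_sum[OF C(2,3)] C(1) by (intro ennreal_leI mult_left_mono) auto
    finally show ?thesis .
  qed
  with C(1) show thesis by (intro that[of "2 * C * (1 / (1 - q)\<^sup>2)"]) auto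
qed
end

section \<open>Convergence of dyadic martingales with finite maximal function\<close>

lemma dyadic_cell_trans: "y \<in> dyadic_cell n x \<Longrightarrow> k \<le> n \<Longrightarrow> dyadic_cell k y = dyadic_cell k x"
  by (auto simp: cylinder_def)

lemma dyadic_step_set:
  assumes "dyadic_step n (indicator A :: real \<Rightarrow> real)" "A \<subseteq> {0..<1}"
  shows "A \<in> sets unit_leb"
proof -
  have [measurable]: "(indicator A :: real \<Rightarrow> real) \<in> borel_measurable unit_leb"
    by (rule dyadic_step_measurable[OF assms(1)])
  have "{x \<in> space unit_leb. indicator A x = (1 :: real)} \<in> sets unit_leb" by measurable
  moreover have "{x \<in> space unit_leb. indicator A x = (1 :: real)} = A"
    using assms(2) by (auto simp: indicator_def)
  ultimately show ?thesis by simp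
qed

text \<open>If every interval of length \<open>2\<^sup>-\<^sup>n\<close> in \<open>A\<close> meets \<open>V\<close>, then it has at least one of its two halves
  in \<open>V\<close>.\<close>

lemma measure_le_twice_dense:
  assumes A: "dyadic_step n (indicator A :: real \<Rightarrow> real)" "A \<subseteq> {0..<1}"
    and V: "dyadic_step (Suc n) (indicator V :: real \<Rightarrow> real)" "V \<subseteq> {0..<1}"
    and meet: "\<And>x. x \<in> A \<Longrightarrow> dyadic_cell n x \<inter> V \<noteq> {}"
  shows "measure unit_leb A \<le> 2 * measure unit_leb (A \<inter> V)"
proof -
  have [measurable]: "A \<in> sets unit_leb" "V \<in> sets unit_leb"
    using A V by (auto intro: dyadic_step_set)
  have cell: "flip_cell n n x = dyadic_cell n x" for x
    by (auto simp: flip_cell_def cylinder_def)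
  have "ennreal (1 / 2 ^ Suc n) * emeasure unit_leb A
      = (\<integral>\<^sup>+x. ennreal (1 / 2 ^ Suc n) * indicator A x \<partial>unit_leb)"
    by (simp add: nn_integral_cmult_indicator)
  also have "\<dots> \<le> (\<integral>\<^sup>+x. (\<integral>\<^sup>+t. indicator (flip_cell n n x) t * indicator (A \<inter> V) t \<partial>unit_leb) \<partial>unit_leb)"
  proof (intro nn_integral_mono)
    fix x assume "x \<in> space unit_leb"
    then have x: "x \<in> {0..<1}" by simp
    show "ennreal (1 / 2 ^ Suc n) * indicator A x
        \<le> (\<integral>\<^sup>+t. indicator (flip_cell n n x) t * indicator (A \<inter> V) t \<partial>unit_leb)"
    proof (cases "x \<in> A")
      case True
      obtain y where y: "y \<in> dyadic_cell n x" "y \<in> V" using meet[OF True] by auto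
      have sub: "dyadic_cell (Suc n) y \<subseteq> dyadic_cell n x \<inter> (A \<inter> V)"
      proof
        fix t assume t: "t \<in> dyadic_cell (Suc n) y"
        then have tn: "t \<in> dyadic_cell n x"
          using cylinder_antimono[of n "Suc n" "\<lambda>k. rademacher k y"] dyadic_cell_trans[OF y(1), of n] by auto
        have "indicator A t = (indicator A x :: real)" by (rule dyadic_stepD[OF A(1) x tn])
        moreover have "indicator V t = (indicator V y :: real)"
          using y V(2) by (intro dyadic_stepD[OF V(1) _ t]) auto
        ultimately show "t \<in> dyadic_cell n x \<inter> (A \<inter> V)"
          using tn True y(2) by (auto simp: indicator_def split: if_splits)
      qed
      have "ennreal (1 / 2 ^ Suc n) = emeasure unit_leb (dyadic_cell (Suc n) y)"
        by (simp only: unit.emeasure_eq_measure measure_dyadic_cell)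
      also have "\<dots> \<le> emeasure unit_leb (dyadic_cell n x \<inter> (A \<inter> V))"
        using sub by (intro emeasure_mono) auto
      also have "\<dots> = (\<integral>\<^sup>+t. indicator (dyadic_cell n x \<inter> (A \<inter> V)) t \<partial>unit_leb)"
        by (rule nn_integral_indicator[symmetric]) auto
      also have "\<dots> = (\<integral>\<^sup>+t. indicator (flip_cell n n x) t * indicator (A \<inter> V) t \<partial>unit_leb)"
        by (simp only: cell indicator_inter_arith)
      finally show ?thesis using True by simp
    qed simp
  qed
  also have "\<dots> = ennreal (1 / 2 ^ n) * (\<integral>\<^sup>+t. indicator (A \<inter> V) t \<partial>unit_leb)"
    by (rule nn_integral_flip_cell) measurable
  also have "(\<integral>\<^sup>+t. indicator (A \<inter> V) t \<partial>unit_leb) = emeasure unit_leb (A \<inter> V)"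
    by (rule nn_integral_indicator) auto
  finally have "1 / 2 ^ Suc n * measure unit_leb A \<le> 1 / 2 ^ n * measure unit_leb (A \<inter> V)"
    by (simp add: unit.emeasure_eq_measure ennreal_mult[symmetric] del: power_Suc)
  then show ?thesis by (simp add: field_simps)
qed

text \<open>A martingale together with a level at which it is stopped.\<close>

locale stopped_martingale =
  fixes f :: "nat \<Rightarrow> real \<Rightarrow> real" and L :: real
  assumes mart: "dyadic_martingale f" and L_nonneg: "0 \<le> L"
begin

lemmas step = martingale_step[OF mart]

text \<open>The points where stopping has not happened up to time \<open>n\<close>. Stopping is predictable: it is decided at
  time \<open>k - 1\<close>, by looking at \<open>f k\<close> on the whole dyadic interval of the previous generation. Thus the stopped
  martingale never exceeds the level, and \<open>active n\<close> is a union of dyadic intervals of length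
  \<open>2 ^ (1 - n)\<close>. At \<open>k = 0\<close> the truncated difference \<open>k - 1\<close> is \<open>0\<close>.\<close>

definition active :: "nat \<Rightarrow> real set" where
  "active n = {x \<in> {0..<1}. \<forall>k\<le>n. \<forall>y\<in>dyadic_cell (k - 1) x. \<bar>f k y\<bar> \<le> L}"

text \<open>The points where \<open>\<bar>f\<bar>\<close> exceeds the level up to time \<open>n\<close>.\<close>

definition exceed :: "nat \<Rightarrow> real set" where
  "exceed n = {x \<in> {0..<1}. \<exists>k\<le>n. L < \<bar>f k x\<bar>}"

text \<open>The stopped martingale; it is 0 on the points that are not even active at time 0.\<close>

definition stopped :: "nat \<Rightarrow> real \<Rightarrow> real" where
  "stopped n x = indicator (active 0) x * f 0 x
     + (\<Sum>k<n. indicator (active (Suc k)) x * (f (Suc k) x - f k x))"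

lemma active_antimono: "m \<le> n \<Longrightarrow> active n \<subseteq> active m"
  by (auto simp: active_def)

lemma activeD: "x \<in> active n \<Longrightarrow> k \<le> n \<Longrightarrow> \<bar>f k x\<bar> \<le> L"
  using dyadic_cell_self[of x "k - 1"] by (auto simp: active_def)

lemma step_active: "dyadic_step (n - 1) (indicator (active n) :: real \<Rightarrow> real)"
  unfolding dyadic_step_def
proof (intro ballI)
  fix x t :: real assume x: "x \<in> {0..<1}" and t: "t \<in> dyadic_cell (n - 1) x"
  have t01: "t \<in> {0..<1}" using t by (simp add: cylinder_def)
  have "dyadic_cell (k - 1) t = dyadic_cell (k - 1) x" if "k \<le> n" for k
    using that by (intro dyadic_cell_trans[OF t]) auto
  then have "t \<in> active n \<longleftrightarrow> x \<in> active n" using x t01 by (simp add: active_def)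
  then show "indicator (active n) t = (indicator (active n) x :: real)" by (simp add: indicator_def)
qed

lemma active_subset: "active n \<subseteq> {0..<1}" by (auto simp: active_def)

lemma step_exceed: "dyadic_step n (indicator (exceed n) :: real \<Rightarrow> real)"
  unfolding dyadic_step_def
proof (intro ballI)
  fix x t :: real assume x: "x \<in> {0..<1}" and t: "t \<in> dyadic_cell n x"
  have "f k t = f k x" if "k \<le> n" for k
    using dyadic_stepD[OF dyadic_step_mono[OF step that] x t] .
  then show "indicator (exceed n) t = (indicator (exceed n) x :: real)"
    using x t by (auto simp: indicator_def exceed_def cylinder_def)
qed

text \<open>Stopping at time \<open>n + 1\<close> happens on whole intervals of length \<open>2\<^sup>-\<^sup>n\<close>, and on one half of each of them
  the level is actually exceeded, for the first time.\<close>

lemma measure_inactive: "measure unit_leb ({0..<1} - active n) \<le> 2 * measure unit_leb (exceed n)"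
proof (induction n)
  case 0
  have "{0..<1} - active 0 \<subseteq> exceed 0"
  proof
    fix x assume x: "x \<in> {0..<1} - active 0"
    then obtain y where y: "y \<in> dyadic_cell 0 x" "L < \<bar>f 0 y\<bar>" by (auto simp: active_def not_le)
    then have "f 0 y = f 0 x" using x by (intro dyadic_stepD[OF step]) auto
    with y x show "x \<in> exceed 0" by (auto simp: exceed_def)
  qed
  then have "measure unit_leb ({0..<1} - active 0) \<le> measure unit_leb (exceed 0)"
    by (intro unit.finite_measure_mono dyadic_step_set[OF step_exceed]) (auto simp: exceed_def)
  then show ?case using measure_nonneg[of unit_leb "exceed 0"] by linarith
next
  case (Suc n)
  \<comment> \<open>The points stopped exactly at time \<open>Suc n\<close>: none of them has exceeded the level before.\<close>
  define D where "D = active n - active (Suc n)"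
  define V where "V = {x \<in> {0..<1}. L < \<bar>f (Suc n) x\<bar>}"
  have stA: "dyadic_step n (indicator (active n) :: real \<Rightarrow> real)"
    by (rule dyadic_step_mono[OF step_active]) simp
  have stA': "dyadic_step n (indicator (active (Suc n)) :: real \<Rightarrow> real)"
    using step_active[of "Suc n"] by simp
  have stD: "dyadic_step n (indicator D :: real \<Rightarrow> real)"
  proof -
    have "indicator D = (\<lambda>x. indicator (active n) x * (1 - indicator (active (Suc n)) x) :: real)"
      by (auto simp: D_def indicator_def)
    then show ?thesis using dyadic_step_comp2[OF stA stA', of "\<lambda>u v. u * (1 - v)"] by simp
  qed
  have stV: "dyadic_step (Suc n) (indicator V :: real \<Rightarrow> real)"
    unfolding dyadic_step_def
  proof (intro ballI)
    fix x t :: real assume x: "x \<in> {0..<1}" and t: "t \<in> dyadic_cell (Suc n) x"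
    have "f (Suc n) t = f (Suc n) x" by (rule dyadic_stepD[OF step x t])
    moreover have "t \<in> {0..<1}" using t by (simp add: cylinder_def)
    ultimately show "indicator V t = (indicator V x :: real)"
      using x by (simp add: V_def indicator_def)
  qed
  have sub: "D \<subseteq> {0..<1}" "V \<subseteq> {0..<1}" using active_subset by (auto simp: D_def V_def)
  have "measure unit_leb D \<le> 2 * measure unit_leb (D \<inter> V)"
  proof (rule measure_le_twice_dense[OF stD sub(1) stV sub(2)])
    fix x assume x: "x \<in> D"
    then have x01: "x \<in> {0..<1}" using sub by auto
    from x obtain k y where k: "k \<le> Suc n" "y \<in> dyadic_cell (k - 1) x" "L < \<bar>f k y\<bar>"
      using x01 by (auto simp: D_def active_def not_le)
    have "\<not> k \<le> n"
    proof
      assume "k \<le> n"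
      moreover have "x \<in> active n" using x by (simp add: D_def)
      ultimately have "\<bar>f k y\<bar> \<le> L" using k(2) unfolding active_def by blast
      with k(3) show False by simp
    qed
    with k(1) have "k = Suc n" by simp
    with k have "y \<in> dyadic_cell n x \<inter> V" by (auto simp: V_def cylinder_def)
    then show "dyadic_cell n x \<inter> V \<noteq> {}" by auto
  qed
  moreover have [measurable]: "D \<in> sets unit_leb" "V \<in> sets unit_leb" "exceed n \<in> sets unit_leb"
      "exceed (Suc n) \<in> sets unit_leb" "active n \<in> sets unit_leb"
    using stD stV step_exceed sub stA active_subset[of n]
    by (auto intro!: dyadic_step_set simp: exceed_def)
  moreover have "measure unit_leb ({0..<1} - active (Suc n))
      = measure unit_leb ({0..<1} - active n) + measure unit_leb D"
  proof -
    have "{0..<1} - active (Suc n) = ({0..<1} - active n) \<union> D"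
      using active_antimono[of n "Suc n"] active_subset[of n] by (auto simp: D_def)
    moreover have "({0..<1} - active n) \<inter> D = {}" by (auto simp: D_def)
    moreover have "{0..<1} - active n \<in> sets unit_leb"
      using sets.compl_sets[of "active n" unit_leb] by simp
    ultimately show ?thesis by (simp add: unit.finite_measure_Union)
  qed
  moreover have "measure unit_leb (exceed n) + measure unit_leb (D \<inter> V) \<le> measure unit_leb (exceed (Suc n))"
  proof -
    have disj: "exceed n \<inter> (D \<inter> V) = {}"
      using activeD[of _ n] by (force simp: exceed_def D_def)
    have "measure unit_leb (exceed n) + measure unit_leb (D \<inter> V) = measure unit_leb (exceed n \<union> (D \<inter> V))"
      by (rule unit.finite_measure_Union[symmetric]) (use disj in auto)
    also have "\<dots> \<le> measure unit_leb (exceed (Suc n))"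
      by (intro unit.finite_measure_mono \<open>exceed (Suc n) \<in> sets unit_leb\<close>)
        (auto simp: exceed_def V_def le_Suc_eq)
    finally show ?thesis .
  qed
  ultimately show ?case using Suc.IH by linarith
qed

lemma stopped_Suc:
  "stopped (Suc n) x = stopped n x + indicator (active (Suc n)) x * (f (Suc n) x - f n x)"
  by (simp add: stopped_def)

lemma stopped_active: "x \<in> active n \<Longrightarrow> stopped n x = f n x"
proof (induction n)
  case 0
  then show ?case by (simp add: stopped_def)
next
  case (Suc n)
  then have "x \<in> active n" using active_antimono[of n "Suc n"] by auto
  with Suc show ?case by (simp add: stopped_Suc)
qed

lemma stopped_bounded: "\<bar>stopped n x\<bar> \<le> L"
proof (induction n)
  case 0
  show ?case using activeD[of x 0 0] L_nonneg by (auto simp: stopped_def indicator_def)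
next
  case (Suc n)
  show ?case
  proof (cases "x \<in> active (Suc n)")
    case True
    then show ?thesis using stopped_active[OF True] activeD[OF True, of "Suc n"] by simp
  next
    case False
    then show ?thesis using Suc by (simp add: stopped_Suc)
  qed
qed

lemma step_stopped: "dyadic_step n (stopped n)"
proof (induction n)
  case 0
  show ?case unfolding stopped_def
    using dyadic_step_comp2[OF step_active[of 0, simplified] step[of 0], of "(*)"] by simp
next
  case (Suc n)
  have "dyadic_step (Suc n) (\<lambda>x. indicator (active (Suc n)) x * (f (Suc n) x - f n x))"
    using dyadic_step_mono[OF step_active[of "Suc n"]] dyadic_step_mono[OF step[of n], of "Suc n"] step[of "Suc n"]
    by (intro dyadic_step_comp2[where F = "(*)"] dyadic_step_comp2[where F = "(-)"]) auto
  then show ?case unfolding stopped_Suc[abs_def]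
    by (intro dyadic_step_comp2[where F = "(+)"] dyadic_step_mono[OF Suc]) auto
qed

lemma integrable_stopped_mult: "integrable unit_leb (\<lambda>x. stopped m x * stopped n x)"
  by (rule dyadic_step_mult_integrable[OF step_stopped step_stopped])

lemma integral_stopped_mult:
  assumes "n \<le> m"
  shows "(\<integral>x. stopped n x * stopped m x \<partial>unit_leb) = (\<integral>x. stopped n x * stopped n x \<partial>unit_leb)"
  using assms
proof (induction m rule: dec_induct)
  case (step m)
  define u where "u x = stopped n x * indicator (active (Suc m)) x" for x
  have u: "dyadic_step m u"
    unfolding u_def using dyadic_step_mono[OF step_stopped step(1)] step_active[of "Suc m"]
    by (intro dyadic_step_comp2[where F = "(*)"]) auto
  have int: "integrable unit_leb (\<lambda>x. u x * f (Suc m) x)" "integrable unit_leb (\<lambda>x. u x * f m x)"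
    using dyadic_step_mult_integrable[OF u martingale_step[OF mart]] by auto
  have "(\<integral>x. stopped n x * stopped (Suc m) x \<partial>unit_leb)
      = (\<integral>x. stopped n x * stopped m x + (u x * f (Suc m) x - u x * f m x) \<partial>unit_leb)"
    by (intro Bochner_Integration.integral_cong refl) (simp add: stopped_Suc u_def algebra_simps)
  also have "\<dots> = (\<integral>x. stopped n x * stopped m x \<partial>unit_leb)
      + ((\<integral>x. u x * f (Suc m) x \<partial>unit_leb) - (\<integral>x. u x * f m x \<partial>unit_leb))"
    using int integrable_stopped_mult[of n m] by simp
  also have "(\<integral>x. u x * f (Suc m) x \<partial>unit_leb) = (\<integral>x. u x * f m x \<partial>unit_leb)"
    by (rule martingale_integral[OF mart u]) simp
  finally show ?case using step.IH by simp
qed simp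

text \<open>A bounded martingale has orthogonal increments, so it is a Cauchy sequence in \<open>L\<^sub>2\<close>.\<close>

lemma stopped_L1_Cauchy:
  assumes "0 < e"
  obtains N where "\<And>m n. N \<le> m \<Longrightarrow> N \<le> n \<Longrightarrow> (\<integral>x. \<bar>stopped m x - stopped n x\<bar> \<partial>unit_leb) < e"
proof -
  define a where "a n = (\<integral>x. stopped n x * stopped n x \<partial>unit_leb)" for n
  have sq: "(\<integral>x. (stopped m x - stopped n x)\<^sup>2 \<partial>unit_leb) = a m - a n" if "n \<le> m" for m n
  proof -
    have "(\<integral>x. (stopped m x - stopped n x)\<^sup>2 \<partial>unit_leb)
        = (\<integral>x. stopped m x * stopped m x - 2 * (stopped n x * stopped m x) + stopped n x * stopped n x \<partial>unit_leb)"
      by (intro Bochner_Integration.integral_cong refl) (simp add: power2_eq_square algebra_simps)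
    also have "\<dots> = a m - 2 * (\<integral>x. stopped n x * stopped m x \<partial>unit_leb) + a n"
      using integrable_stopped_mult by (simp add: a_def)
    finally show ?thesis using integral_stopped_mult[OF that] by (simp add: a_def)
  qed
  have "incseq a"
  proof (rule incseq_SucI)
    fix n
    have "0 \<le> (\<integral>x. (stopped (Suc n) x - stopped n x)\<^sup>2 \<partial>unit_leb)" by simp
    then show "a n \<le> a (Suc n)" using sq[of n "Suc n"] by simp
  qed
  moreover have "a n \<le> L * L" for n
  proof -
    have "a n \<le> (\<integral>x. L * L \<partial>unit_leb)"
      unfolding a_def
    proof (rule integral_mono[OF integrable_stopped_mult])
      fix x show "stopped n x * stopped n x \<le> L * L"
        using stopped_bounded[of n x] by (metis abs_ge_zero abs_mult_self_eq mult_mono')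
    qed simp
    then show ?thesis by (simp add: measure_restrict_space)
  qed
  ultimately have "convergent a"
    by (intro Bseq_mono_convergent) (auto simp: incseq_def a_def intro!: BseqI'[of _ "L * L"])
  then have "Cauchy a" by (rule convergent_Cauchy)
  moreover have "0 < e\<^sup>2" using assms by simp
  ultimately obtain N where N: "\<And>m n. N \<le> m \<Longrightarrow> N \<le> n \<Longrightarrow> \<bar>a m - a n\<bar> < e\<^sup>2"
    unfolding Cauchy_def dist_real_def by blast
  have main: "(\<integral>x. \<bar>stopped m x - stopped n x\<bar> \<partial>unit_leb) < e" if "n \<le> m" "N \<le> n" for m n
  proof -
    have int2: "integrable unit_leb (\<lambda>x. (stopped m x - stopped n x)\<^sup>2)"
      using dyadic_step_mono[OF step_stopped that(1)] step_stopped[of m]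
      by (intro dyadic_step_integrable[of m] dyadic_step_comp2[where F = "\<lambda>u v. (u - v)\<^sup>2"])
    have int1: "integrable unit_leb (\<lambda>x. \<bar>stopped m x - stopped n x\<bar>)"
      using dyadic_step_mono[OF step_stopped that(1)] step_stopped[of m]
      by (intro dyadic_step_integrable[of m] dyadic_step_comp2[where F = "\<lambda>u v. \<bar>u - v\<bar>"])
    \<comment> \<open>Young's inequality, which bounds the mean of the increment by its mean square.\<close>
    have pw: "\<bar>z\<bar> \<le> e / 2 + z\<^sup>2 / (2 * e)" for z :: real
    proof -
      have "0 \<le> (\<bar>z\<bar> - e)\<^sup>2" by simp
      then have "2 * e * \<bar>z\<bar> \<le> e\<^sup>2 + z\<^sup>2" by (simp add: power2_diff mult_ac add.commute)
      then show ?thesis using assms by (simp add: field_simps power2_eq_square)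
    qed
    have "(\<integral>x. \<bar>stopped m x - stopped n x\<bar> \<partial>unit_leb)
        \<le> (\<integral>x. e / 2 + (stopped m x - stopped n x)\<^sup>2 / (2 * e) \<partial>unit_leb)"
      using int1 int2 pw by (intro integral_mono) auto
    also have "\<dots> = e / 2 + (a m - a n) / (2 * e)"
      using int2 sq[OF that(1)] unit.prob_space by simp
    also have "\<dots> < e / 2 + e\<^sup>2 / (2 * e)"
      using N[of m n] that assms by (intro add_strict_left_mono divide_strict_right_mono) auto
    also have "\<dots> = e" using assms by (simp add: power2_eq_square)
    finally show ?thesis .
  qed
  show thesis
  proof (rule that)
    fix m n assume "N \<le> m" "N \<le> n"
    then show "(\<integral>x. \<bar>stopped m x - stopped n x\<bar> \<partial>unit_leb) < e"
      using main[of n m] main[of m n] by (cases "n \<le> m") (auto simp: abs_minus_commute)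
  qed
qed
end

lemma arctan_lipschitz: "\<bar>arctan a - arctan b\<bar> \<le> \<bar>a - b\<bar>" for a b :: real
proof -
  have "norm (arctan a - arctan b) \<le> 1 * norm (a - b)"
  proof (rule field_differentiable_bound[of UNIV arctan "\<lambda>x. inverse (1 + x\<^sup>2)"])
    show "(arctan has_field_derivative inverse (1 + x\<^sup>2)) (at x within UNIV)" for x :: real
      by (rule DERIV_arctan)
    show "norm (inverse (1 + x\<^sup>2)) \<le> 1" for x :: real
    proof -
      have "1 \<le> 1 + x\<^sup>2" by simp
      then show ?thesis using inverse_le_1_iff[of "1 + x\<^sup>2"] by (simp add: abs_of_pos)
    qed
  qed auto
  then show ?thesis by simp
qed

lemma arctan_diff_le_pi: "\<bar>arctan a - arctan b\<bar> \<le> pi" for a b :: real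
  using arctan_bounded[of a] arctan_bounded[of b] by linarith

lemma exceedance_small:
  assumes f: "dyadic_martingale f" and fin: "AE x in unit_leb. \<exists>L. \<forall>k. \<bar>f k x\<bar> \<le> L" and "0 < e"
  obtains L :: real where "0 \<le> L" "measure unit_leb {x \<in> {0..<1}. \<exists>k. L < \<bar>f k x\<bar>} < e"
proof -
  define S where "S m = {x \<in> space unit_leb. \<exists>k. real m < \<bar>f k x\<bar>}" for m
  have [measurable]: "f k \<in> borel_measurable unit_leb" for k
    by (rule dyadic_step_measurable[OF martingale_step[OF f]])
  have S [measurable]: "S m \<in> sets unit_leb" for m unfolding S_def by measurable
  have "(\<lambda>m. measure unit_leb (S m)) \<longlonglongrightarrow> measure unit_leb (\<Inter>m. S m)"
  proof (rule unit.finite_Lim_measure_decseq)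
    show "range S \<subseteq> sets unit_leb" using S by blast
    show "decseq S"
    proof (rule decseq_SucI)
      fix m
      have "real m < c" if "real (Suc m) < c" for c using that by simp
      then show "S (Suc m) \<subseteq> S m" unfolding S_def by blast
    qed
  qed
  moreover have "measure unit_leb (\<Inter>m. S m) = 0"
  proof -
    have "AE x in unit_leb. x \<notin> (\<Inter>m. S m)"
      using fin
    proof eventually_elim
      case (elim x)
      then obtain L where L: "\<And>k. \<bar>f k x\<bar> \<le> L" by blast
      obtain m :: nat where "L \<le> real m" using real_arch_simple by blast
      then have "\<bar>f k x\<bar> \<le> real m" for k using L[of k] by linarith
      then have "x \<notin> S m" by (auto simp: S_def not_less)
      then show ?case by blast
    qed
    moreover have "(\<Inter>m. S m) \<in> sets unit_leb" by measurable
    ultimately show ?thesis using unit.prob_eq_0 by blast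
  qed
  ultimately have "\<forall>\<^sub>F m in sequentially. measure unit_leb (S m) < e"
    using order_tendstoD(2)[of _ 0 sequentially e] \<open>0 < e\<close> by auto
  then obtain m where "measure unit_leb (S m) < e" by (auto simp: eventually_sequentially)
  then show thesis by (intro that[of "real m"]) (auto simp: S_def)
qed

text \<open>The bounded injective function \<open>arctan\<close> turns convergence in measure into convergence in
  \<open>L\<^sub>1\<close>.\<close>

lemma martingale_arctan_Cauchy:
  assumes f: "dyadic_martingale f" and fin: "AE x in unit_leb. \<exists>L. \<forall>k. \<bar>f k x\<bar> \<le> L" and e: "0 < e"
  shows "\<exists>N. \<forall>i\<ge>N. \<forall>j\<ge>N. (\<integral>x. norm (arctan (f i x) - arctan (f j x)) \<partial>unit_leb) < e"
proof -
  have "0 < e / (4 * pi)" using e by simp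
  then obtain L where L: "0 \<le> L" "measure unit_leb {x \<in> {0..<1}. \<exists>k. L < \<bar>f k x\<bar>} < e / (4 * pi)"
    by (rule exceedance_small[OF f fin])
  interpret stopped_martingale f L using f L(1) by unfold_locales
  have [measurable]: "f k \<in> borel_measurable unit_leb" for k
    by (rule dyadic_step_measurable[OF step])
  have [measurable]: "stopped k \<in> borel_measurable unit_leb" for k
    by (rule dyadic_step_measurable[OF step_stopped])
  have "0 < e / 2" using e by simp
  then obtain N where
    N: "\<And>m n. N \<le> m \<Longrightarrow> N \<le> n \<Longrightarrow> (\<integral>x. \<bar>stopped m x - stopped n x\<bar> \<partial>unit_leb) < e / 2"
    by (rule stopped_L1_Cauchy) blast
  show ?thesis
  proof (intro exI[of _ N] allI impI)
    fix i j assume ij: "N \<le> i" "N \<le> j"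
    define n where "n = max i j"
    define Z where "Z = {0..<1} - active n"
    have Zs [measurable]: "Z \<in> sets unit_leb"
      using sets.compl_sets[OF dyadic_step_set[OF step_active active_subset], of n] by (simp add: Z_def)
    have "measure unit_leb (exceed n) \<le> measure unit_leb {x \<in> {0..<1}. \<exists>k. L < \<bar>f k x\<bar>}"
    proof (rule unit.finite_measure_mono)
      have "{x \<in> space unit_leb. \<exists>k. L < \<bar>f k x\<bar>} \<in> sets unit_leb" by measurable
      then show "{x \<in> {0..<1}. \<exists>k. L < \<bar>f k x\<bar>} \<in> sets unit_leb" by simp
    qed (auto simp: exceed_def)
    then have Z: "measure unit_leb Z < 2 * (e / (4 * pi))"
      using measure_inactive[of n] L(2) by (simp add: Z_def)
    have intS: "integrable unit_leb (\<lambda>x. \<bar>stopped i x - stopped j x\<bar>)"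
      using dyadic_step_integrable[OF step_stopped, of i] dyadic_step_integrable[OF step_stopped, of j]
      by simp
    have intZ: "integrable unit_leb (indicator Z :: real \<Rightarrow> real)"
      by (intro integrable_real_indicator Zs) (simp add: unit.emeasure_eq_measure)
    have "(\<integral>x. norm (arctan (f i x) - arctan (f j x)) \<partial>unit_leb)
        \<le> (\<integral>x. \<bar>stopped i x - stopped j x\<bar> + pi * indicator Z x \<partial>unit_leb)"
    proof (rule integral_mono)
      show "integrable unit_leb (\<lambda>x. norm (arctan (f i x) - arctan (f j x)))"
        using arctan_diff_le_pi by (intro unit.integrable_const_bound[of _ pi] AE_I2) (auto)
      show "integrable unit_leb (\<lambda>x. \<bar>stopped i x - stopped j x\<bar> + pi * indicator Z x)"
        by (intro Bochner_Integration.integrable_add integrable_mult_right intS intZ)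
      fix x assume x: "x \<in> space unit_leb"
      show "norm (arctan (f i x) - arctan (f j x)) \<le> \<bar>stopped i x - stopped j x\<bar> + pi * indicator Z x"
      proof (cases "x \<in> Z")
        case True
        then show ?thesis using arctan_diff_le_pi[of "f i x" "f j x"] by simp
      next
        case False
        then have "x \<in> active n" using x by (simp add: Z_def)
        then have "x \<in> active i" "x \<in> active j"
          using active_antimono[of i n] active_antimono[of j n] by (auto simp: n_def)
        then show ?thesis using False arctan_lipschitz by (simp add: stopped_active)
      qed
    qed
    also have "\<dots> = (\<integral>x. \<bar>stopped i x - stopped j x\<bar> \<partial>unit_leb) + pi * measure unit_leb (Z \<inter> {0..<1})"
      using intS intZ by simp
    also have "Z \<inter> {0..<1} = Z" by (auto simp: Z_def)
    also have "(\<integral>x. \<bar>stopped i x - stopped j x\<bar> \<partial>unit_leb) + pi * measure unit_leb Z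
        < e / 2 + pi * (2 * (e / (4 * pi)))"
      using N[OF ij] Z by (intro add_strict_mono mult_strict_left_mono) auto
    also have "\<dots> = e" by simp
    finally show "(\<integral>x. norm (arctan (f i x) - arctan (f j x)) \<partial>unit_leb) < e" .
  qed
qed

lemma tendsto_of_arctan:
  assumes "(\<lambda>n. arctan (X n)) \<longlonglongrightarrow> arctan y"
  shows "X \<longlonglongrightarrow> y"
proof -
  have "isCont tan (arctan y)" by (rule isCont_tan) (rule cos_arctan_not_zero)
  from isCont_tendsto_compose[OF this assms] show ?thesis by (simp add: tan_arctan)
qed

lemma convergent_of_arctan:
  fixes X :: "nat \<Rightarrow> real"
  assumes "Cauchy (\<lambda>n. arctan (X n))" "\<And>n. \<bar>X n\<bar> \<le> L"
  shows "convergent X"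
proof -
  from assms(1) obtain y where y: "(\<lambda>n. arctan (X n)) \<longlonglongrightarrow> y"
    by (meson Cauchy_convergent convergentD)
  have "arctan (X n) \<le> arctan L" "arctan (- L) \<le> arctan (X n)" for n
    using assms(2)[of n] by (auto simp: arctan_le_iff)
  then have "y \<le> arctan L" "arctan (- L) \<le> y"
    using y by (auto intro: LIMSEQ_le_const LIMSEQ_le_const2)
  then have "- (pi / 2) < y" "y < pi / 2"
    using arctan_bounded[of L] arctan_bounded[of "- L"] by linarith+
  then have "arctan (tan y) = y" by (rule arctan_tan)
  have "X \<longlonglongrightarrow> tan y"
    by (rule tendsto_of_arctan) (subst \<open>arctan (tan y) = y\<close>, rule y)
  then show ?thesis by (rule convergentI)
qed

text \<open>The conclusion is convergence in measure, in terms of subsequences.\<close>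

lemma martingale_limit:
  assumes f: "dyadic_martingale f" and fin: "AE x in unit_leb. \<exists>L. \<forall>k. \<bar>f k x\<bar> \<le> L"
  obtains g where "g \<in> borel_measurable unit_leb"
    "\<And>s :: nat \<Rightarrow> nat. strict_mono s \<Longrightarrow> \<exists>r :: nat \<Rightarrow> nat. strict_mono r \<and> (AE x in unit_leb. (\<lambda>n. f (s (r n)) x) \<longlonglongrightarrow> g x)"
proof -
  have [measurable]: "f k \<in> borel_measurable unit_leb" for k
    by (rule dyadic_step_measurable[OF martingale_step[OF f]])
  have int: "integrable unit_leb (\<lambda>x. arctan (u x))" if [measurable]: "u \<in> borel_measurable unit_leb" for u
  proof (rule unit.integrable_const_bound[of _ "pi / 2"])
    have "norm (arctan (u x)) \<le> pi / 2" for x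
      unfolding real_norm_def using arctan_bounded[of "u x"] by linarith
    then show "AE x in unit_leb. norm (arctan (u x)) \<le> pi / 2" by simp
  qed measurable
  note Cauchy = martingale_arctan_Cauchy[OF f fin]
  obtain r0 where r0: "strict_mono r0" "AE x in unit_leb. Cauchy (\<lambda>i. arctan (f (r0 i) x))"
    by (rule cauchy_L1_AE_cauchy_subseq[where M = unit_leb and s = "\<lambda>n x. arctan (f n x)", OF int Cauchy]) simp_all
  define g where "g x = lim (\<lambda>i. f (r0 i) x)" for x
  have g [measurable]: "g \<in> borel_measurable unit_leb" unfolding g_def by measurable
  have lim: "AE x in unit_leb. (\<lambda>i. f (r0 i) x) \<longlonglongrightarrow> g x"
    using r0(2) fin
  proof eventually_elim
    case (elim x)
    then obtain L where L: "\<And>k. \<bar>f k x\<bar> \<le> L" by blast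
    have "convergent (\<lambda>i. f (r0 i) x)" by (rule convergent_of_arctan[OF elim(1) L])
    then show ?case by (simp add: g_def convergent_LIMSEQ_iff)
  qed
  have L1: "(\<lambda>n. \<integral>x. norm (arctan (f n x) - arctan (g x)) \<partial>unit_leb) \<longlonglongrightarrow> 0"
  proof (rule LIMSEQ_I)
    fix e :: real assume e: "0 < e"
    then obtain N where N: "\<And>i j. N \<le> i \<Longrightarrow> N \<le> j \<Longrightarrow> (\<integral>x. norm (arctan (f i x) - arctan (f j x)) \<partial>unit_leb) < e / 2"
      using Cauchy[of "e / 2"] by auto
    have "(\<integral>x. norm (arctan (f n x) - arctan (g x)) \<partial>unit_leb) \<le> e / 2" if n: "N \<le> n" for n
    proof (rule LIMSEQ_le_const2)
      show "(\<lambda>i. \<integral>x. norm (arctan (f n x) - arctan (f (r0 i) x)) \<partial>unit_leb)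
          \<longlonglongrightarrow> (\<integral>x. norm (arctan (f n x) - arctan (g x)) \<partial>unit_leb)"
      proof (rule integral_dominated_convergence[where w = "\<lambda>_. pi"])
        show "AE x in unit_leb. (\<lambda>i. norm (arctan (f n x) - arctan (f (r0 i) x)))
            \<longlonglongrightarrow> norm (arctan (f n x) - arctan (g x))"
          using lim by eventually_elim (intro tendsto_intros)
        show "AE x in unit_leb. norm (norm (arctan (f n x) - arctan (f (r0 i) x))) \<le> pi" for i
          using arctan_diff_le_pi by (intro AE_I2) auto
      qed auto
      have "N \<le> r0 i" if "N \<le> i" for i using seq_suble[OF r0(1), of i] that by linarith
      then show "\<exists>M. \<forall>i\<ge>M. (\<integral>x. norm (arctan (f n x) - arctan (f (r0 i) x)) \<partial>unit_leb) \<le> e / 2"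
        using N n by (intro exI[of _ N]) (auto intro: less_imp_le)
    qed
    then have "norm ((\<integral>x. norm (arctan (f n x) - arctan (g x)) \<partial>unit_leb) - 0) < e" if "N \<le> n" for n
      using that e by (fastforce simp: abs_of_nonneg Bochner_Integration.integral_nonneg)
    then show "\<exists>N. \<forall>n\<ge>N. norm ((\<integral>x. norm (arctan (f n x) - arctan (g x)) \<partial>unit_leb) - 0) < e" by blast
  qed
  show thesis
  proof (rule that[OF g])
    fix s :: "nat \<Rightarrow> nat" assume s: "strict_mono s"
    have "\<exists>r::nat \<Rightarrow> nat. strict_mono r \<and> (AE x in unit_leb. (\<lambda>n. arctan (f (s (r n)) x) - arctan (g x)) \<longlonglongrightarrow> 0)"
      using LIMSEQ_subseq_LIMSEQ[OF L1 s] by (intro tendsto_L1_AE_subseq) (auto intro!: int simp: o_def)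
    then obtain r :: "nat \<Rightarrow> nat" where r: "strict_mono r"
      "AE x in unit_leb. (\<lambda>n. arctan (f (s (r n)) x) - arctan (g x)) \<longlonglongrightarrow> 0" by blast
    from r(2) have "AE x in unit_leb. (\<lambda>n. f (s (r n)) x) \<longlonglongrightarrow> g x"
      by eventually_elim (rule tendsto_of_arctan, simp add: LIM_zero_cancel)
    with r(1) show "\<exists>r :: nat \<Rightarrow> nat. strict_mono r \<and> (AE x in unit_leb. (\<lambda>n. f (s (r n)) x) \<longlonglongrightarrow> g x)" by blast
  qed
qed

section \<open>Norm convergence\<close>

lemma ennpowr_div_ennreal:
  "0 < l \<Longrightarrow> ennpowr (ennreal \<bar>y\<bar> / ennreal l) a = ennreal (\<bar>y / l\<bar> powr a)"
  by (simp add: ennpowr_def divide_ennreal abs_divide)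

lemma lp_norm_le_iff_modular:
  assumes "0 < l" "modular p (\<lambda>x. u x / l) \<le> 1"
  shows "lp_norm p (\<lambda>x. ennreal \<bar>u x\<bar>) \<le> ennreal l"
  unfolding lp_norm_def
proof (rule Inf_lower, safe, intro exI conjI refl)
  show "(\<integral>\<^sup>+ x. ennpowr (ennreal \<bar>u x\<bar> / ennreal l) (p x) \<partial>unit_leb) \<le> 1"
    using assms by (simp add: modular_def ennpowr_div_ennreal)
qed (use assms in auto)

lemma tendsto_zero_ennrealI:
  fixes a :: "nat \<Rightarrow> ennreal"
  assumes "\<And>e :: real. 0 < e \<Longrightarrow> \<forall>\<^sub>F n in sequentially. a n \<le> ennreal e"
  shows "a \<longlonglongrightarrow> 0"
proof (rule order_tendstoI)
  fix b :: ennreal assume "0 < b"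
  then obtain c where c: "0 < c" "c < b" using dense by blast
  then have "c < top" using top.not_eq_extremum by fastforce
  then obtain e where e: "c = ennreal e" "0 \<le> e" by (cases c) auto
  with c have "0 < e" by (simp add: ennreal_less_zero_iff)
  from assms[OF this] show "\<forall>\<^sub>F n in sequentially. a n < b"
    by eventually_elim (use c e in \<open>auto intro: le_less_trans\<close>)
qed auto

lemma tendsto_zero_ennreal_subseqI:
  fixes a :: "nat \<Rightarrow> ennreal"
  assumes sub: "\<And>s :: nat \<Rightarrow> nat. strict_mono s \<Longrightarrow> \<exists>r :: nat \<Rightarrow> nat. (\<lambda>n. a (s (r n))) \<longlonglongrightarrow> 0"
  shows "a \<longlonglongrightarrow> 0"
proof (rule tendsto_zero_ennrealI, rule ccontr)
  fix e :: real assume e: "0 < e" and "\<not> (\<forall>\<^sub>F n in sequentially. a n \<le> ennreal e)"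
  then have "infinite {n. \<not> a n \<le> ennreal e}"
    by (simp add: frequently_cofinite[symmetric] cofinite_eq_sequentially frequently_def)
  then obtain s :: "nat \<Rightarrow> nat" where s: "strict_mono s" "\<And>n. s n \<in> {n. \<not> a n \<le> ennreal e}"
    using infinite_enumerate by blast
  obtain r :: "nat \<Rightarrow> nat" where "(\<lambda>n. a (s (r n))) \<longlonglongrightarrow> 0" using sub[OF s(1)] by blast
  then have "\<forall>\<^sub>F n in sequentially. a (s (r n)) < ennreal e"
    using e by (intro order_tendstoD(2)[of _ 0]) (auto simp: ennreal_less_zero_iff)
  then obtain n where "a (s (r n)) < ennreal e" by (auto simp: eventually_sequentially)
  with s(2)[of "r n"] show False by simp
qed

lemma fejer_op_measurable:
  assumes "dyadic_step N h"
  shows "fejer_op n h \<in> borel_measurable unit_leb"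
proof -
  have [measurable]: "walsh l \<in> borel_measurable unit_leb" for l
    by (rule dyadic_step_measurable[OF dyadic_step_walsh[of l l]]) (rule less_exp)
  show ?thesis unfolding fejer_op_walsh[OF assms, abs_def] by measurable
qed

context variable_exponent
begin

lemma modular_mono_AE:
  assumes "AE x in unit_leb. \<bar>u x\<bar> \<le> \<bar>v x\<bar>"
  shows "modular p u \<le> modular p v"
  unfolding modular_def
proof (rule nn_integral_mono_AE)
  show "AE x in unit_leb. ennreal (\<bar>u x\<bar> powr p x) \<le> ennreal (\<bar>v x\<bar> powr p x)"
    using assms p_bounds by eventually_elim (use pm_pos in \<open>auto intro!: ennreal_leI powr_mono2\<close>)
qed

lemma modular_scale_ge1:
  assumes [measurable]: "u \<in> borel_measurable unit_leb" and c: "1 \<le> c"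
  shows "modular p (\<lambda>x. c * u x) \<le> ennreal (c powr pp) * modular p u"
proof -
  have "modular p (\<lambda>x. c * u x) \<le> (\<integral>\<^sup>+x. ennreal (c powr pp) * ennreal (\<bar>u x\<bar> powr p x) \<partial>unit_leb)"
    unfolding modular_def
  proof (rule nn_integral_mono_AE)
    show "AE x in unit_leb. ennreal (\<bar>c * u x\<bar> powr p x) \<le> ennreal (c powr pp) * ennreal (\<bar>u x\<bar> powr p x)"
      using p_bounds
    proof eventually_elim
      case (elim x)
      have "c powr p x \<le> c powr pp" using c elim by (intro powr_mono) auto
      then show ?case using c
        by (auto simp: abs_mult powr_mult ennreal_mult[symmetric] intro!: ennreal_leI mult_right_mono)
    qed
  qed
  also have "\<dots> = ennreal (c powr pp) * modular p u"
    unfolding modular_def by (rule nn_integral_cmult) measurable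
  finally show ?thesis .
qed

lemma modular_scale_le1:
  assumes [measurable]: "u \<in> borel_measurable unit_leb" and c: "0 < c" "c \<le> 1"
  shows "modular p (\<lambda>x. c * u x) \<le> ennreal (c powr pm) * modular p u"
proof -
  have "modular p (\<lambda>x. c * u x) \<le> (\<integral>\<^sup>+x. ennreal (c powr pm) * ennreal (\<bar>u x\<bar> powr p x) \<partial>unit_leb)"
    unfolding modular_def
  proof (rule nn_integral_mono_AE)
    show "AE x in unit_leb. ennreal (\<bar>c * u x\<bar> powr p x) \<le> ennreal (c powr pm) * ennreal (\<bar>u x\<bar> powr p x)"
      using p_bounds
    proof eventually_elim
      case (elim x)
      have "c powr p x \<le> c powr pm" using c elim by (intro powr_mono') auto
      then show ?case using c
        by (auto simp: abs_mult powr_mult ennreal_mult[symmetric] intro!: ennreal_leI mult_right_mono)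
    qed
  qed
  also have "\<dots> = ennreal (c powr pm) * modular p u"
    unfolding modular_def by (rule nn_integral_cmult) measurable
  finally show ?thesis .
qed

lemma modular_add3:
  assumes [measurable]: "u \<in> borel_measurable unit_leb" "v \<in> borel_measurable unit_leb" "w \<in> borel_measurable unit_leb"
  shows "modular p (\<lambda>x. u x + v x + w x) \<le> ennreal (3 powr pp) * (modular p u + modular p v + modular p w)"
proof -
  have "modular p (\<lambda>x. u x + v x + w x) \<le> (\<integral>\<^sup>+x. ennreal (3 powr pp) *
      (ennreal (\<bar>u x\<bar> powr p x) + ennreal (\<bar>v x\<bar> powr p x) + ennreal (\<bar>w x\<bar> powr p x)) \<partial>unit_leb)"
    unfolding modular_def
  proof (rule nn_integral_mono_AE)
    show "AE x in unit_leb. ennreal (\<bar>u x + v x + w x\<bar> powr p x) \<le> ennreal (3 powr pp) *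
      (ennreal (\<bar>u x\<bar> powr p x) + ennreal (\<bar>v x\<bar> powr p x) + ennreal (\<bar>w x\<bar> powr p x))"
      using p_bounds
    proof eventually_elim
      case (elim x)
      let ?m = "max \<bar>u x\<bar> (max \<bar>v x\<bar> \<bar>w x\<bar>)"
      have "\<bar>u x + v x + w x\<bar> powr p x \<le> (3 * ?m) powr p x"
        using elim pm_pos by (intro powr_mono2) auto
      also have "\<dots> = 3 powr p x * ?m powr p x" by (rule powr_mult)
      also have "\<dots> \<le> 3 powr pp * (\<bar>u x\<bar> powr p x + \<bar>v x\<bar> powr p x + \<bar>w x\<bar> powr p x)"
        using elim by (intro mult_mono powr_mono) (auto simp: max_def)
      finally show ?case
        by (simp add: ennreal_mult[symmetric] ennreal_plus[symmetric] del: ennreal_plus)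
    qed
  qed
  also have "\<dots> = ennreal (3 powr pp) * (modular p u + modular p v + modular p w)"
    unfolding modular_def by (simp add: nn_integral_cmult nn_integral_add)
  finally show ?thesis .
qed

text \<open>As \<open>p\<close> is bounded, convergence to 0 in the modular implies convergence to 0 in the quasi-norm.\<close>

lemma lp_norm_tendsto_zero:
  assumes u: "\<And>n. u n \<in> borel_measurable unit_leb" and lim: "(\<lambda>n. modular p (u n)) \<longlonglongrightarrow> 0"
  shows "(\<lambda>n. lp_norm p (\<lambda>x. ennreal \<bar>u n x\<bar>)) \<longlonglongrightarrow> 0"
proof (rule tendsto_zero_ennrealI)
  fix e :: real assume e: "0 < e"
  define l where "l = min 1 e"
  have l: "0 < l" "l \<le> 1" "l \<le> e" using e by (auto simp: l_def)
  have "\<forall>\<^sub>F n in sequentially. modular p (u n) < ennreal (l powr pp)"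
    using l lim by (intro order_tendstoD(2)[of _ 0]) (auto simp: ennreal_less_zero_iff)
  then show "\<forall>\<^sub>F n in sequentially. lp_norm p (\<lambda>x. ennreal \<bar>u n x\<bar>) \<le> ennreal e"
  proof eventually_elim
    case (elim n)
    have "modular p (\<lambda>x. u n x / l) \<le> ennreal ((1 / l) powr pp) * modular p (u n)"
      using modular_scale_ge1[OF u[of n], of "1 / l"] l by simp
    also have "\<dots> \<le> ennreal ((1 / l) powr pp) * ennreal (l powr pp)"
      using elim by (intro mult_left_mono) auto
    also have "\<dots> = 1" using l by (simp add: ennreal_mult[symmetric] powr_divide)
    finally have "lp_norm p (\<lambda>x. ennreal \<bar>u n x\<bar>) \<le> ennreal l"
      by (rule lp_norm_le_iff_modular[OF l(1)])
    also have "\<dots> \<le> ennreal e" using l by (intro ennreal_leI)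
    finally show ?case .
  qed
qed

lemma maximal_function_measurable:
  assumes "dyadic_martingale f"
  shows "maximal_function f \<in> borel_measurable unit_leb"
proof -
  have [measurable]: "f k \<in> borel_measurable unit_leb" for k
    by (rule dyadic_step_measurable[OF martingale_step[OF assms]])
  show ?thesis unfolding maximal_function_def[abs_def] by measurable
qed

text \<open>Dominated convergence with twice the maximal function as majorant.\<close>

lemma hardy_martingale_limit:
  assumes "f \<in> hardy_space p"
  obtains g where "g \<in> lp_space p" "(\<lambda>n. modular p (\<lambda>x. f n x - g x)) \<longlonglongrightarrow> 0"
proof -
  have f: "dyadic_martingale f" and fin: "lp_norm p (maximal_function f) < \<infinity>"
    using assms by (auto simp: hardy_space_def)
  have [measurable]: "f k \<in> borel_measurable unit_leb" for k
    by (rule dyadic_step_measurable[OF martingale_step[OF f]])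
  note maximal_function_measurable[OF f, measurable]
  obtain l where l: "0 < l"
    "(\<integral>\<^sup>+ x. ennpowr (maximal_function f x / ennreal l) (p x) \<partial>unit_leb) \<le> 1"
    using fin unfolding lp_norm_def Inf_less_iff by blast
  have meas: "(\<lambda>x. ennpowr (maximal_function f x / ennreal l) (p x)) \<in> borel_measurable unit_leb"
    unfolding ennpowr_def by measurable
  have "AE x in unit_leb. ennpowr (maximal_function f x / ennreal l) (p x) \<noteq> \<infinity>"
    using l(2) by (intro nn_integral_PInf_AE[OF meas]) (auto simp: top_unique)
  then have M_fin: "AE x in unit_leb. maximal_function f x < \<infinity>"
  proof eventually_elim
    case (elim x)
    show ?case
    proof (rule ccontr)
      assume "\<not> ?thesis"
      then have "maximal_function f x = \<infinity>" by (simp add: less_top[symmetric])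
      then have "maximal_function f x / ennreal l = \<infinity>"
        by (simp add: ennreal_top_divide)
      with elim show False by (simp add: ennpowr_def)
    qed
  qed
  define W where "W x = enn2real (maximal_function f x)" for x
  have [measurable]: "W \<in> borel_measurable unit_leb" unfolding W_def by measurable
  have W0: "0 \<le> W x" for x by (simp add: W_def)
  have W: "AE x in unit_leb. maximal_function f x = ennreal (W x)"
    using M_fin by eventually_elim (simp add: W_def)
  have fW: "AE x in unit_leb. \<forall>k. \<bar>f k x\<bar> \<le> W x"
    using W
  proof eventually_elim
    case (elim x)
    have "ennreal \<bar>f k x\<bar> \<le> maximal_function f x" for k
      unfolding maximal_function_def by (rule SUP_upper) simp
    then show ?case using W0[of x] by (simp add: elim ennreal_le_iff)
  qed
  have modW: "modular p (\<lambda>x. W x / l) \<le> 1"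
  proof -
    have "modular p (\<lambda>x. W x / l) = (\<integral>\<^sup>+ x. ennpowr (maximal_function f x / ennreal l) (p x) \<partial>unit_leb)"
      unfolding modular_def
    proof (rule nn_integral_cong_AE)
      show "AE x in unit_leb. ennreal (\<bar>W x / l\<bar> powr p x) = ennpowr (maximal_function f x / ennreal l) (p x)"
        using W
      proof eventually_elim
        case (elim x)
        then show ?case using ennpowr_div_ennreal[OF l(1), of "W x" "p x"] W0[of x] by simp
      qed
    qed
    then show ?thesis using l(2) by simp
  qed
  have mod2W: "modular p (\<lambda>x. 2 * W x) < \<infinity>"
  proof -
    define c where "c = max 1 (2 * l)"
    have "modular p (\<lambda>x. 2 * W x) \<le> modular p (\<lambda>x. c * (W x / l))"
    proof (rule modular_mono_AE, rule AE_I2)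
      fix x
      have "2 * W x = (2 * l) * (W x / l)" using l by simp
      also have "\<dots> \<le> c * (W x / l)" using W0[of x] l by (intro mult_right_mono) (auto simp: c_def)
      finally show "\<bar>2 * W x\<bar> \<le> \<bar>c * (W x / l)\<bar>"
        using W0[of x] abs_ge_self[of "c * (W x / l)"] by linarith
    qed
    also have "\<dots> \<le> ennreal (c powr pp) * modular p (\<lambda>x. W x / l)"
      by (rule modular_scale_ge1) (auto simp: c_def)
    also have "\<dots> \<le> ennreal (c powr pp) * 1" by (rule mult_left_mono[OF modW]) simp
    finally show ?thesis by (simp add: le_less_trans)
  qed
  have "AE x in unit_leb. \<exists>L. \<forall>k. \<bar>f k x\<bar> \<le> L" using fW by eventually_elim blast
  from martingale_limit[OF f this] obtain g where g [measurable]: "g \<in> borel_measurable unit_leb"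
    and sub: "\<And>s :: nat \<Rightarrow> nat. strict_mono s \<Longrightarrow> \<exists>r :: nat \<Rightarrow> nat. strict_mono r \<and> (AE x in unit_leb. (\<lambda>n. f (s (r n)) x) \<longlonglongrightarrow> g x)"
    by blast
  have gW: "AE x in unit_leb. \<bar>g x\<bar> \<le> W x"
  proof -
    obtain r :: "nat \<Rightarrow> nat" where r: "AE x in unit_leb. (\<lambda>n. f (r n) x) \<longlonglongrightarrow> g x"
      using sub[of "\<lambda>n. n"] by (auto simp: strict_mono_def)
    from r fW show ?thesis
    proof eventually_elim
      case (elim x)
      show ?case by (rule LIMSEQ_le_const2[OF tendsto_rabs[OF elim(1)]]) (use elim(2) in auto)
    qed
  qed
  have "modular p (\<lambda>x. g x / l) \<le> modular p (\<lambda>x. W x / l)"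
  proof (rule modular_mono_AE)
    show "AE x in unit_leb. \<bar>g x / l\<bar> \<le> \<bar>W x / l\<bar>"
      using gW by eventually_elim (use l W0 in \<open>auto simp: abs_divide intro!: divide_right_mono\<close>)
  qed
  then have "lp_norm p (\<lambda>x. ennreal \<bar>g x\<bar>) \<le> ennreal l"
    by (intro lp_norm_le_iff_modular[OF l(1)] order_trans[OF _ modW])
  then have gL: "g \<in> lp_space p" by (simp add: lp_space_def le_less_trans)
  have "(\<lambda>n. modular p (\<lambda>x. f n x - g x)) \<longlonglongrightarrow> 0"
  proof (rule tendsto_zero_ennreal_subseqI)
    fix s :: "nat \<Rightarrow> nat" assume "strict_mono s"
    from sub[OF this] obtain r :: "nat \<Rightarrow> nat" where
      r: "AE x in unit_leb. (\<lambda>n. f (s (r n)) x) \<longlonglongrightarrow> g x" by blast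
    have "(\<lambda>n. \<integral>\<^sup>+x. ennreal (\<bar>f (s (r n)) x - g x\<bar> powr p x) \<partial>unit_leb)
        \<longlonglongrightarrow> (\<integral>\<^sup>+x. 0 \<partial>unit_leb)"
    proof (rule nn_integral_dominated_convergence[where w = "\<lambda>x. ennreal (\<bar>2 * W x\<bar> powr p x)"])
      show "(\<integral>\<^sup>+x. ennreal (\<bar>2 * W x\<bar> powr p x) \<partial>unit_leb) < \<infinity>" using mod2W by (simp add: modular_def)
      show "AE x in unit_leb. ennreal (\<bar>f (s (r n)) x - g x\<bar> powr p x) \<le> ennreal (\<bar>2 * W x\<bar> powr p x)" for n
        using fW gW p_bounds
      proof eventually_elim
        case (elim x)
        have "\<bar>f (s (r n)) x - g x\<bar> \<le> \<bar>2 * W x\<bar>" using elim(1)[rule_format, of "s (r n)"] elim(2) by linarith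
        then show ?case using elim(3) pm_pos by (intro ennreal_leI powr_mono2) auto
      qed
      show "AE x in unit_leb. (\<lambda>n. ennreal (\<bar>f (s (r n)) x - g x\<bar> powr p x)) \<longlonglongrightarrow> 0"
        using r p_bounds
      proof eventually_elim
        case (elim x)
        have "(\<lambda>n. \<bar>f (s (r n)) x - g x\<bar>) \<longlonglongrightarrow> 0"
          using elim(1) by (intro tendsto_rabs_zero LIM_zero)
        then have "(\<lambda>n. \<bar>f (s (r n)) x - g x\<bar> powr p x) \<longlonglongrightarrow> 0 powr p x"
          using elim(2) pm_pos by (intro tendsto_powr2 tendsto_const) auto
        then show ?case by (simp add: tendsto_ennreal_iff ennreal_0[symmetric] del: ennreal_0)
      qed
    qed measurable
    then show "\<exists>r :: nat \<Rightarrow> nat. (\<lambda>n. modular p (\<lambda>x. f (s (r n)) x - g x)) \<longlonglongrightarrow> 0"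
      unfolding modular_def by auto
  qed
  with gL show thesis by (rule that)
qed
end

lemma dyadic_exponent:
  fixes n :: nat
  assumes "0 < n"
  obtains N where "n \<le> 2 ^ N" "2 ^ N \<le> 2 * n"
proof
  define N where "N = (LEAST N. n \<le> 2 ^ N)"
  have "n \<le> 2 ^ n" by (rule less_imp_le) (rule less_exp)
  then show "n \<le> 2 ^ N" unfolding N_def by (rule LeastI)
  show "2 ^ N \<le> 2 * n"
  proof (cases N)
    case 0
    with assms show ?thesis by simp
  next
    case (Suc M)
    then have "\<not> n \<le> 2 ^ M" unfolding N_def using not_less_Least[of M "\<lambda>N. n \<le> 2 ^ N"] by simp
    with Suc show ?thesis by simp
  qed
qed

context log_hoelder_exponent
begin

text \<open>The uniform bound, rescaled.\<close>

lemma fejer_op_modular_small: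
  fixes e :: real
  assumes e: "0 < e"
  obtains d :: real where "0 < d"
    "\<And>N n h. dyadic_step N h \<Longrightarrow> modular p h \<le> ennreal d \<Longrightarrow> n \<le> 2 ^ N \<Longrightarrow> 2 ^ N \<le> 2 * n \<Longrightarrow>
      modular p (fejer_op n h) \<le> ennreal e"
proof (rule fejer_op_modular_bounded)
  fix C :: real assume C: "0 \<le> C"
    "\<And>N n h. dyadic_step N h \<Longrightarrow> modular p h \<le> 1 \<Longrightarrow> n \<le> 2 ^ N \<Longrightarrow> 2 ^ N \<le> 2 * n \<Longrightarrow>
      modular p (fejer_op n h) \<le> ennreal C"
  define a where "a = min 1 ((e / (C + 1)) powr (1 / pm))"
  have a: "0 < a" "a \<le> 1" using e C(1) by (auto simp: a_def)
  have aC: "a powr pm * C \<le> e"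
  proof -
    have "a powr pm \<le> ((e / (C + 1)) powr (1 / pm)) powr pm"
      using a pm_pos by (intro powr_mono2) (auto simp: a_def)
    also have "\<dots> = e / (C + 1)" using e C(1) pm_pos by (simp add: powr_powr)
    finally have "a powr pm * C \<le> e / (C + 1) * C" using C(1) by (rule mult_right_mono)
    also have "\<dots> \<le> e" using e C(1) by (simp add: field_simps)
    finally show ?thesis .
  qed
  have "modular p (fejer_op n h) \<le> ennreal e"
    if h: "dyadic_step N h" and small: "modular p h \<le> ennreal (a powr pp)" and n: "n \<le> 2 ^ N" "2 ^ N \<le> 2 * n" for N n h
  proof -
    \<comment> \<open>Dividing by \<open>a\<close> brings the modular of \<open>h\<close> up to at most 1, where the uniform bound applies.\<close>
    let ?h = "\<lambda>t. 1 / a * h t"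
    have h': "dyadic_step N ?h" by (rule dyadic_step_comp[OF h])
    have "modular p ?h \<le> ennreal ((1 / a) powr pp) * modular p h"
      by (rule modular_scale_ge1[OF dyadic_step_measurable[OF h]]) (use a in simp)
    also have "\<dots> \<le> ennreal ((1 / a) powr pp) * ennreal (a powr pp)"
      by (rule mult_left_mono[OF small]) simp
    also have "\<dots> = 1" using a by (simp add: ennreal_mult[symmetric] powr_divide)
    finally have "modular p (fejer_op n ?h) \<le> ennreal C" by (rule C(2)[OF h' _ n])
    moreover have "modular p (fejer_op n h) = modular p (\<lambda>x. a * fejer_op n ?h x)"
      unfolding fejer_op_scale using a by simp
    moreover have "modular p (\<lambda>x. a * fejer_op n ?h x) \<le> ennreal (a powr pm) * modular p (fejer_op n ?h)"
      by (rule modular_scale_le1[OF fejer_op_measurable[OF h'] a])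
    moreover have "ennreal (a powr pm) * ennreal C \<le> ennreal e"
      using aC C(1) by (simp add: ennreal_mult[symmetric] ennreal_leI)
    ultimately show ?thesis
      by (metis mult_left_mono order_trans zero_le)
  qed
  with a show thesis by (intro that[of "a powr pp"]) auto
qed

theorem fejer_means_converge:
  assumes "f \<in> hardy_space p"
  shows "lp_convergent p (fejer_mean f)"
proof (rule hardy_martingale_limit[OF assms])
  fix g assume g: "g \<in> lp_space p" and lim: "(\<lambda>n. modular p (\<lambda>x. f n x - g x)) \<longlonglongrightarrow> 0"
  have mart: "dyadic_martingale f" using assms by (simp add: hardy_space_def)
  note step = martingale_step[OF mart]
  have [measurable]: "f k \<in> borel_measurable unit_leb" for k by (rule dyadic_step_measurable[OF step])
  have [measurable]: "g \<in> borel_measurable unit_leb" using g by (simp add: lp_space_def)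
  have mean_measurable: "fejer_mean f n \<in> borel_measurable unit_leb" for n
  proof -
    have "fejer_mean f n = fejer_op n (f n)"
      using fejer_mean_eq_op[OF mart, of n n] less_exp[of n] by (intro ext) (simp add: less_imp_le)
    then show ?thesis using fejer_op_measurable[OF step, of n n] by simp
  qed
  have "(\<lambda>n. modular p (\<lambda>x. fejer_mean f n x - g x)) \<longlonglongrightarrow> 0"
  proof (rule tendsto_zero_ennrealI)
    fix e :: real assume e: "0 < e"
    define c where "c = 3 powr pp"
    have c: "0 < c" by (simp add: c_def)
    define e' where "e' = e / (3 * c)"
    have e': "0 < e'" using e c by (simp add: e'_def)
    from fejer_op_modular_small[OF e'] obtain d where d: "0 < d"
      "\<And>N n h. dyadic_step N h \<Longrightarrow> modular p h \<le> ennreal d \<Longrightarrow> n \<le> 2 ^ N \<Longrightarrow> 2 ^ N \<le> 2 * n \<Longrightarrow>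
        modular p (fejer_op n h) \<le> ennreal e'" by blast
    define d' where "d' = min e' (d / (2 * c))"
    have d': "0 < d'" "d' \<le> e'" "c * (2 * d') \<le> d" using d c e' by (auto simp: d'_def min_def field_simps)
    have "\<forall>\<^sub>F n in sequentially. modular p (\<lambda>x. f n x - g x) < ennreal d'"
      using lim d' by (intro order_tendstoD(2)[of _ 0]) (auto simp: ennreal_less_zero_iff)
    then obtain M where M: "\<And>n. M \<le> n \<Longrightarrow> modular p (\<lambda>x. f n x - g x) \<le> ennreal d'"
      unfolding eventually_sequentially using less_imp_le by blast
    have Cauchy: "modular p (\<lambda>x. f N x - f M x) \<le> ennreal d" if "M \<le> N" for N
    proof -
      have "modular p (\<lambda>x. f N x - f M x) = modular p (\<lambda>x. (f N x - g x) + (g x - f M x) + 0)" by simp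
      also have "\<dots> \<le> ennreal c * (modular p (\<lambda>x. f N x - g x) + modular p (\<lambda>x. g x - f M x) + modular p (\<lambda>x. 0))"
        unfolding c_def by (rule modular_add3) measurable
      also have "modular p (\<lambda>x. g x - f M x) = modular p (\<lambda>x. f M x - g x)"
        by (simp add: modular_def abs_minus_commute)
      also have "modular p (\<lambda>x. 0) = 0" by (simp add: modular_def)
      also have "ennreal c * (modular p (\<lambda>x. f N x - g x) + modular p (\<lambda>x. f M x - g x) + 0)
          \<le> ennreal c * (ennreal d' + ennreal d' + 0)"
        using M[OF that] M[of M] by (intro mult_left_mono add_mono) auto
      also have "\<dots> = ennreal (c * (2 * d'))"
        using c d' by (simp add: ennreal_mult[symmetric] ennreal_plus[symmetric] del: ennreal_plus)
      also have "\<dots> \<le> ennreal d" by (rule ennreal_leI) (rule d')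
      finally show ?thesis .
    qed
    obtain B where B: "0 \<le> B" "\<And>n x. 0 < n \<Longrightarrow> x \<in> {0..<1} \<Longrightarrow> \<bar>fejer_op n (f M) x - f M x\<bar> \<le> B / real n"
      by (rule fejer_op_converges[OF step, of M]) blast
    have "(\<lambda>n. (B + 1) / real n) \<longlonglongrightarrow> 0" by (rule lim_const_over_n)
    then have ev: "\<forall>\<^sub>F n in sequentially. (B + 1) / real n < min 1 (e' powr (1 / pm))"
      by (rule order_tendstoD(2)) (use e' in simp)
    have poly: "modular p (\<lambda>x. fejer_op n (f M) x - f M x) \<le> ennreal e'"
      if n: "0 < n" and small: "(B + 1) / real n < min 1 (e' powr (1 / pm))" for n
    proof -
      let ?b = "(B + 1) / real n"
      have b: "0 < ?b" "?b \<le> 1" using n small B(1) by auto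
      have "modular p (\<lambda>x. fejer_op n (f M) x - f M x) \<le> modular p (\<lambda>x. ?b * 1)"
      proof (rule modular_mono_AE, rule AE_I2)
        fix x assume "x \<in> space unit_leb"
        then have "\<bar>fejer_op n (f M) x - f M x\<bar> \<le> B / real n" using B(2)[OF n] by simp
        also have "\<dots> \<le> ?b" by (intro divide_right_mono) auto
        finally show "\<bar>fejer_op n (f M) x - f M x\<bar> \<le> \<bar>?b * 1\<bar>"
          using abs_ge_self[of "?b * 1"] by linarith
      qed
      also have "\<dots> \<le> ennreal (?b powr pm) * modular p (\<lambda>x. 1)"
        by (rule modular_scale_le1[OF _ b]) simp
      also have "modular p (\<lambda>x. 1) = 1"
        using unit.emeasure_space_1 by (simp add: modular_def)
      also have "ennreal (?b powr pm) * 1 \<le> ennreal e'"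
      proof -
        have "?b powr pm \<le> (e' powr (1 / pm)) powr pm"
          using small b pm_pos by (intro powr_mono2) auto
        then show ?thesis using e' pm_pos by (simp add: powr_powr ennreal_leI)
      qed
      finally show ?thesis .
    qed
    show "\<forall>\<^sub>F n in sequentially. modular p (\<lambda>x. fejer_mean f n x - g x) \<le> ennreal e"
      using ev eventually_ge_at_top[of "2 ^ M"]
    proof eventually_elim
      case (elim n)
      have n0: "0 < n" using elim(2) zero_less_power[of "2::nat" M] by linarith
      obtain N where N: "n \<le> 2 ^ N" "2 ^ N \<le> 2 * n" by (rule dyadic_exponent[OF n0])
      have "(2::nat) ^ M \<le> 2 ^ N" using elim(2) N(1) by (rule order_trans)
      then have MN: "M \<le> N" by simp
      let ?h = "\<lambda>t. f N t - f M t"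
      have stepM: "dyadic_step N (f M)" by (rule dyadic_step_mono[OF step MN])
      have h: "dyadic_step N ?h" by (rule dyadic_step_comp2[OF step stepM])
      have m1 [measurable]: "fejer_op n ?h \<in> borel_measurable unit_leb"
        by (rule fejer_op_measurable[OF h])
      have m2 [measurable]: "fejer_op n (f M) \<in> borel_measurable unit_leb"
        by (rule fejer_op_measurable[OF step])
      have "modular p (\<lambda>x. fejer_mean f n x - g x)
          = modular p (\<lambda>x. fejer_op n ?h x + (fejer_op n (f M) x - f M x) + (f M x - g x))"
        by (simp add: fejer_mean_eq_op[OF mart N(1)] fejer_op_diff[OF step stepM])
      also have "\<dots> \<le> ennreal c * (modular p (fejer_op n ?h) + modular p (\<lambda>x. fejer_op n (f M) x - f M x)
          + modular p (\<lambda>x. f M x - g x))"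
        unfolding c_def by (rule modular_add3) measurable
      also have "\<dots> \<le> ennreal c * (ennreal e' + ennreal e' + ennreal e')"
      proof (intro mult_left_mono add_mono)
        show "modular p (fejer_op n ?h) \<le> ennreal e'" by (rule d(2)[OF h Cauchy[OF MN] N])
        show "modular p (\<lambda>x. fejer_op n (f M) x - f M x) \<le> ennreal e'" by (rule poly[OF n0 elim(1)])
        show "modular p (\<lambda>x. f M x - g x) \<le> ennreal e'"
          using M[of M] d'(2) by (meson ennreal_leI order_refl order_trans)
      qed simp
      also have "\<dots> = ennreal (c * (3 * e'))"
        using c e' by (simp add: ennreal_mult[symmetric] ennreal_plus[symmetric] del: ennreal_plus)
      also have "c * (3 * e') = e" using c by (simp add: e'_def)
      finally show ?case .
    qed
  qed
  then have "(\<lambda>n. lp_norm p (\<lambda>x. ennreal \<bar>fejer_mean f n x - g x\<bar>)) \<longlonglongrightarrow> 0"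
    by (rule lp_norm_tendsto_zero[rotated]) (use mean_measurable in measurable)
  with g show ?thesis unfolding lp_convergent_def by blast
qed
end

section \<open>Essential bounds on dyadic intervals\<close>

lemma AE_unit_leb_restrict:
  assumes "A \<in> sets unit_leb" "A \<subseteq> {0..<1}"
  shows "(AE x in lebesgue_on A. P x) \<longleftrightarrow> (AE x in unit_leb. x \<in> A \<longrightarrow> P x)"
proof -
  have A: "A \<in> sets lebesgue" using assms by (simp add: sets_restrict_space_iff)
  have "(AE x in unit_leb. x \<in> A \<longrightarrow> P x) \<longleftrightarrow> (AE x in lebesgue. x \<in> {0..<1} \<longrightarrow> x \<in> A \<longrightarrow> P x)"
    by (rule AE_restrict_space_iff) simp
  also have "\<dots> \<longleftrightarrow> (AE x in lebesgue. x \<in> A \<longrightarrow> P x)"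
    using assms(2) by (intro AE_cong) auto
  also have "\<dots> \<longleftrightarrow> (AE x in lebesgue_on A. P x)"
    by (rule AE_restrict_space_iff[symmetric]) (use A in simp)
  finally show ?thesis by simp
qed

lemma essinf_AE: "AE x in M. essinf M f \<le> f x"
proof (cases "f \<in> borel_measurable M")
  case True
  have "essinf M f = - esssup M (\<lambda>x. - f x)"
    using True by (simp add: essinf_def esssup_def ereal_Limsup_uminus)
  then show ?thesis using esssup_AE[of "\<lambda>x. - f x" M]
    by (auto elim!: eventually_mono simp: ereal_uminus_le_reorder)
qed (simp add: essinf_def)

lemma essinf_greatest: "f \<in> borel_measurable M \<Longrightarrow> AE x in M. c \<le> f x \<Longrightarrow> c \<le> essinf M f"
  by (simp add: essinf_def Liminf_bounded)

lemma measurable_lebesgue_on_subset: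
  assumes "p \<in> borel_measurable unit_leb" "A \<subseteq> {0..<1}"
  shows "(\<lambda>x. ereal (p x)) \<in> borel_measurable (lebesgue_on A)"
proof -
  have "p \<in> borel_measurable (lebesgue_on A)" by (rule measurable_restrict_mono[OF assms])
  then show ?thesis by measurable
qed

lemma p_minus_plus_AE:
  assumes "A \<in> sets unit_leb" "A \<subseteq> {0..<1}"
  shows "AE x in unit_leb. x \<in> A \<longrightarrow> p_minus p A \<le> ereal (p x) \<and> ereal (p x) \<le> p_plus p A"
proof -
  have "AE x in lebesgue_on A. p_minus p A \<le> ereal (p x) \<and> ereal (p x) \<le> p_plus p A"
    unfolding p_minus_def p_plus_def by (intro eventually_conj essinf_AE esssup_AE)
  then show ?thesis unfolding AE_unit_leb_restrict[OF assms] .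
qed

lemma p_minus_plus_bounds:
  assumes p: "p \<in> borel_measurable unit_leb" and A: "A \<in> sets unit_leb" "A \<subseteq> {0..<1}"
    and b: "AE x in unit_leb. a \<le> ereal (p x) \<and> ereal (p x) \<le> b"
  shows "a \<le> p_minus p A" "p_plus p A \<le> b"
proof -
  have "AE x in lebesgue_on A. a \<le> ereal (p x) \<and> ereal (p x) \<le> b"
    unfolding AE_unit_leb_restrict[OF A] using b by eventually_elim simp
  then have "AE x in lebesgue_on A. a \<le> ereal (p x)" "AE x in lebesgue_on A. ereal (p x) \<le> b"
    by (auto elim: eventually_mono)
  then show "a \<le> p_minus p A" "p_plus p A \<le> b"
    unfolding p_minus_def p_plus_def
    using measurable_lebesgue_on_subset[OF p A(2)] by (auto intro: essinf_greatest esssup_I)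
qed

theorem corollary5p24:
  fixes p :: "real \<Rightarrow> real" and K :: real and f :: "nat \<Rightarrow> real \<Rightarrow> real"
  assumes p_measurable: "p \<in> borel_measurable unit_leb"
    and p_pos: "\<And>x. x \<in> {0..<1} \<Longrightarrow> 0 < p x"
    and p_bounds: "0 < p_minus p {0..<1}" "p_minus p {0..<1} \<le> p_plus p {0..<1}"
      "p_plus p {0..<1} < \<infinity>"
    and K_ge_1: "1 \<le> K"
    and log_hoelder: "\<And>n k. k < 2 ^ n \<Longrightarrow>
      measure unit_leb (dyadic_interval n k) powr
        real_of_ereal (p_minus p (dyadic_interval n k) - p_plus p (dyadic_interval n k)) \<le> K"
    and p_gap: "1 / p_minus p {0..<1} - 1 / p_plus p {0..<1} < 1"
    and p_half: "1 / 2 < p_minus p {0..<1}" "p_minus p {0..<1} < \<infinity>"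
    and f_hardy: "f \<in> hardy_space p"
  shows "lp_convergent p (fejer_mean f)"
proof -
  obtain pm where pm: "p_minus p {0..<1} = ereal pm" "0 < pm"
    using p_bounds(1) p_half(2) by (cases "p_minus p {0..<1}") auto
  obtain pp where pp: "p_plus p {0..<1} = ereal pp"
    using p_bounds(1,2,3) by (cases "p_plus p {0..<1}") auto
  have pmpp: "pm \<le> pp" using p_bounds(2) pm pp by simp
  have all: "{0..<1} \<in> sets unit_leb" using sets.top[of unit_leb] by simp
  have bounds: "AE x in unit_leb. ereal pm \<le> ereal (p x) \<and> ereal (p x) \<le> ereal pp"
    using p_minus_plus_AE[OF all order_refl, of p] AE_space unfolding pm pp
    by eventually_elim simp
  interpret log_hoelder_exponent p pm pp K
  proof
    show "AE x in unit_leb. pm \<le> p x \<and> p x \<le> pp" using bounds by simp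
    show "1 / 2 < pm" using p_half(1) pm by (simp add: one_ereal_def)
    show "1 / pm - 1 / pp < 1"
      using p_gap pm(2) pmpp unfolding pm(1) pp by (simp add: one_ereal_def)
    fix j k :: nat assume k: "k < 2 ^ j"
    let ?A = "dyadic_interval j k"
    note A = dyadic_interval_sets[OF k] dyadic_interval_subset[OF k]
    note AE_A = p_minus_plus_AE[OF A, of p]
    note b = p_minus_plus_bounds[OF p_measurable A bounds]
    \<comment> \<open>The interval has positive measure, so some value of \<open>p\<close> lies between the essential bounds, which are
      therefore finite.\<close>
    have "\<not> (AE x in unit_leb. x \<notin> ?A)"
      using unit.prob_eq_0[OF A(1)] measure_dyadic_interval[OF k] by simp
    then have "\<exists>x\<in>?A. p_minus p ?A \<le> ereal (p x) \<and> ereal (p x) \<le> p_plus p ?A"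
      using AE_A by (metis (mono_tags, lifting) eventually_mono)
    then obtain x where x: "p_minus p ?A \<le> ereal (p x)" "ereal (p x) \<le> p_plus p ?A" by blast
    obtain q where q: "p_minus p ?A = ereal q" using x b(1) by (cases "p_minus p ?A") auto
    obtain r where r: "p_plus p ?A = ereal r" using x b(2) by (cases "p_plus p ?A") auto
    have K: "(2 ^ j) powr (r - q) \<le> K"
      using log_hoelder[OF k] unfolding measure_dyadic_interval[OF k] q r
      by (simp add: powr_divide powr_minus_divide[symmetric])
    show "\<exists>q\<ge>pm. AE t in unit_leb. t \<in> ?A \<longrightarrow> q \<le> p t \<and> (2 ^ j) powr (p t - q) \<le> K"
    proof (intro exI[of _ q] conjI)
      show "pm \<le> q" using b(1) q by simp
      show "AE t in unit_leb. t \<in> ?A \<longrightarrow> q \<le> p t \<and> (2 ^ j) powr (p t - q) \<le> K"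
        using AE_A unfolding q r
      proof eventually_elim
        case (elim t)
        have "(2 ^ j) powr (p t - q) \<le> (2 ^ j) powr (r - q)" if "t \<in> ?A"
          using elim that by (intro powr_mono) auto
        with elim K show ?case by auto
      qed
    qed
  qed (use p_measurable pm pmpp K_ge_1 in auto)
  show ?thesis by (rule fejer_means_converge[OF f_hardy])
qed

end
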